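(* Let $\epsilon,\delta>0$. There is a constant $c$, depending on $\delta$, such that for $100\%$ of fundamental discriminants $D$ (i.e. the proportion of fundamental discriminants $D$ with $|D|\le Z$ having the following property tends to $1$ as $Z\to\infty$), a proportion at least $1-\delta$ of the quadratic Dirichlet characters $\chi \pmod{|D|}$ satisfy $$L(1,\chi) \ge \exp \left(-c(\log\log|D|)^{1-\frac{\log 2}{2} + \epsilon} \right).$$
   Context: A quadratic Dirichlet character modulo $q$ is a nonprincipal Dirichlet character $\chi$ modulo $q$ with $\chi^2$ equal to the principal character. $L(s,\chi)$ is the Dirichlet $L$-function of $\chi$. *)

theory Defs
  imports "HOL-Analysis.Analysis" "HOL-Computational_Algebra.Squarefree"
begin

text \<open>
  Discriminants of quadratic number fields, together with 1 (which is irrelevant for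
  statements about natural density).
\<close>
definition fundamental_discriminant :: "int \<Rightarrow> bool" where
  "fundamental_discriminant D \<longleftrightarrow>
     (D mod 4 = 1 \<and> squarefree D) \<or>
     (\<exists>m. D = 4 * m \<and> m mod 4 \<in> {2, 3} \<and> squarefree m)"

text \<open>
  Characters are extended by zero to the numbers not coprime to the modulus. Being periodic,
  they are determined by their values on the natural numbers, so distinct functions of this
  type are distinct characters of the units modulo \<open>q\<close>.
\<close>
definition dirichlet_character :: "nat \<Rightarrow> (nat \<Rightarrow> complex) \<Rightarrow> bool" where
  "dirichlet_character q \<psi> \<longleftrightarrow>
     q > 0 \<and>
     (\<forall>n. \<psi> (n + q) = \<psi> n) \<and>
     (\<forall>m n. \<psi> (m * n) = \<psi> m * \<psi> n) \<and>
     (\<forall>n. \<psi> n \<noteq> 0 \<longleftrightarrow> coprime n q)"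

definition principal_character :: "nat \<Rightarrow> nat \<Rightarrow> complex" where
  "principal_character q = (\<lambda>n. if coprime n q then 1 else 0)"

text \<open>Imprimitive characters are included.\<close>
definition quadratic_characters :: "nat \<Rightarrow> (nat \<Rightarrow> complex) set" where
  "quadratic_characters q =
     {\<psi>. dirichlet_character q \<psi> \<and> \<psi> \<noteq> principal_character q \<and>
         (\<lambda>n. \<psi> n ^ 2) = principal_character q}"

text \<open>
  The Dirichlet series over \<open>n \<ge> 1\<close>, in the usual order of summation. For nonprincipal \<open>\<psi>\<close>
  it converges (conditionally if \<open>Re s \<le> 1\<close>) to the \<open>L\<close>-function on the half-plane
  \<open>Re s > 0\<close>, which contains \<open>s = 1\<close>; outside that half-plane (for principal \<open>\<psi>\<close>, outside
  \<open>Re s > 1\<close>) this is not the analytic continuation.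
\<close>
definition dirichlet_L :: "complex \<Rightarrow> (nat \<Rightarrow> complex) \<Rightarrow> complex" where
  "dirichlet_L s \<psi> = (\<Sum>n. \<psi> (Suc n) / of_nat (Suc n) powr s)"

end

theory Submission
  imports Defs "HOL-Number_Theory.Number_Theory" "HOL-Real_Asymp.Real_Asymp"
begin

text \<open>
  Away from \<open>2\<close> and the ramified primes, a quadratic character modulo \<open>\<bar>D\<bar>\<close> is
  \<open>n \<mapsto> \<xi> n * (n/d)\<close> with \<open>d\<close> an odd squarefree divisor of \<open>D\<close> and \<open>\<xi>\<close> a character modulo 8.
  Put \<open>Y = (ln Z)^4\<close>. The Euler factors at the primes up to \<open>Y\<close> contribute at least a power of
  \<open>1 / ln ln Z\<close>, which is larger than the bound to be proved, so it suffices that the sum of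
  \<open>\<xi> n * (n/d) / n\<close> over the integers \<open>n > 1\<close> without prime factors up to \<open>Y\<close> is small.

  An interval sum of the Jacobi symbol modulo \<open>k\<close> is \<open>O(k powr (2/3))\<close>: average over shifts of
  the interval and use that the correlations of the symbol are at most \<open>gcd h k\<close>. This controls the
  \<open>n\<close> beyond \<open>d powr (7/10)\<close> for every \<open>d\<close>. As \<open>7/10 < 3/4\<close>, the same bound together with quadratic
  reciprocity controls the second moment over \<open>d\<close> of the sum over the smaller \<open>n\<close>, so that the sum
  is small outside a set of moduli \<open>d\<close> so sparse (density about \<open>(ln Z)^2 / Y\<close>) that almost no
  \<open>D\<close> has a divisor \<open>d > W\<close> in it, where \<open>W = exp ((ln Z) powr (1/8))\<close>.

  By Turan's variance bound almost every \<open>D\<close> has many prime factors above \<open>W\<close>, and then only a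
  small proportion of its divisors are at most \<open>W\<close>.
\<close>

section \<open>The Jacobi symbol\<close>

text \<open>Beyond \<open>d powr (7/10)\<close> the tail saves only \<open>d powr (-1/30)\<close>.
  Passing it through the Euler factors up to \<open>Y\<close> by Rankin's trick leaves the power
  \<open>1 / ln Y\<close> of this saving, at the cost of a power of \<open>ln Z\<close>. So
  \<open>d\<close> must exceed \<open>exp (C * (ln ln Z)^2)\<close> for a suitable \<open>C\<close>,
  which explains a lower cut \<open>W\<close> for the divisors. Conversely the primes above
  \<open>W\<close> must keep a divergent reciprocal sum: with the weak Mertens bounds
  \<open>ln ln x / 2\<close> from below and \<open>6 + 2 * ln ln x\<close> from above, the exponent
  in \<open>W\<close> has to be below 1/4, whence 1/8. The bad moduli are removed by a union bound
  over \<open>O(ln Z)\<close> dyadic blocks, each of density about \<open>(ln Z)^2 / Y\<close>, so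
  \<open>Y\<close> has to be of larger order than the cube of \<open>ln Z\<close>. For the remaining
  \<open>D\<close> every character with \<open>d > W\<close> obeys the bound. The proportion of bad
  characters is thus a proportion of small divisors, \<open>O(2^(-k))\<close> if \<open>k\<close>
  prime factors exceed \<open>W\<close>, and \<open>\<delta>\<close> only decides how large
  \<open>k\<close> has to be. At the primes above \<open>Y\<close> dividing \<open>D\<close> the
  character vanishes while the inducing one may not; there are \<open>O(ln Z)\<close> of them, few
  against \<open>Y\<close>.\<close>

lemma not_coprime_prime_nat:
  assumes "\<not> coprime (a::nat) b"
  obtains p where "prime p" "p dvd a" "p dvd b"
proof -
  have "gcd a b \<noteq> 1" using assms by (simp only: coprime_iff_gcd_eq_1 not_False_eq_True)
  then obtain p where p: "prime p" "p dvd gcd a b" using prime_factor_nat by blast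
  then have "p dvd a" "p dvd b" by auto
  then show ?thesis using that p(1) by blast
qed

lemma squarefree_prime_cofactor:
  assumes "squarefree (p * l)" "prime (p::nat)"
  shows "coprime p l"
proof (rule prime_imp_coprime[OF assms(2)])
  show "\<not> p dvd l"
  proof
    assume "p dvd l"
    then have "p\<^sup>2 dvd p * l" by (simp add: power2_eq_square)
    then show False using assms by (auto simp: squarefree_def dest: not_prime_unit)
  qed
qed

section \<open>Legendre symbols modulo an odd prime: values, complete sums, correlations\<close>

lemma Legendre_cong: "[a = b] (mod p) \<Longrightarrow> Legendre a p = Legendre b p"
  unfolding Legendre_def QuadRes_def cong_def by simp

lemma Legendre_mod [simp]: "Legendre (a mod p) p = Legendre a p"
  by (rule Legendre_cong) simp

lemma Legendre_values: "Legendre a p \<in> {-1, 0, 1}"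
  unfolding Legendre_def by auto

lemma Legendre_eq_0_iff: "Legendre a p = 0 \<longleftrightarrow> p dvd a"
  unfolding Legendre_def by (auto simp: cong_0_iff)

text \<open>Euler's criterion gives a congruence modulo \<open>p\<close>; if \<open>p\<close>
  divides neither factor, both sides are 1 or -1 and differ by at most 2, which is less than
  \<open>p\<close>.\<close>

lemma Legendre_mult:
  assumes "prime p" "2 < p"
  shows "Legendre (a * b) (int p) = Legendre a (int p) * Legendre b (int p)"
proof (cases "int p dvd a \<or> int p dvd b")
  case True
  then have "int p dvd a * b" by auto
  with True show ?thesis by (metis Legendre_eq_0_iff mult_eq_0_iff)
next
  case False
  let ?k = "(p - 1) div 2"
  have pr: "prime (int p)" using assms by simp
  have ab: "\<not> int p dvd a * b" using False pr prime_dvd_mult_iff by blast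
  have e: "[Legendre c (int p) = c ^ ?k] (mod int p)" for c
    using euler_criterion[OF assms] by simp
  have "[Legendre (a * b) (int p) = a ^ ?k * b ^ ?k] (mod int p)"
    using e[of "a * b"] by (simp add: power_mult_distrib)
  moreover have "[Legendre a (int p) * Legendre b (int p) = a ^ ?k * b ^ ?k] (mod int p)"
    by (intro cong_mult e)
  ultimately have c: "int p dvd Legendre (a * b) (int p) - Legendre a (int p) * Legendre b (int p)"
    using cong_trans[OF _ cong_sym] unfolding cong_iff_dvd_diff[symmetric] by blast
  have v: "\<bar>Legendre c (int p)\<bar> = 1" if "\<not> int p dvd c" for c
    using that unfolding Legendre_def by (auto simp: cong_0_iff)
  have "\<bar>Legendre (a * b) (int p) - Legendre a (int p) * Legendre b (int p)\<bar> \<le> 1 + 1 * 1"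
    using v[of a] v[of b] v[OF ab] False abs_triangle_ineq4[of "Legendre (a * b) (int p)"]
    by (metis abs_mult)
  moreover have "2 < \<bar>int p\<bar>" using assms by simp
  ultimately show ?thesis
    using dvd_imp_le_int[OF _ c] by (cases "Legendre (a * b) (int p) = Legendre a (int p) * Legendre b (int p)") linarith+
qed

text \<open>A substitution with invertible coefficient permutes the residues. It serves for shifts
  (\<open>\<alpha> = 1\<close>) and for dilations (\<open>\<beta> = 0\<close>).\<close>

lemma sum_affine_residues:
  fixes f :: "int \<Rightarrow> 'a::comm_monoid_add"
  assumes m: "m > 0" and per: "\<And>x. f (x mod m) = f x" and c: "coprime \<alpha> m"
  shows "(\<Sum>i=0..<m. f (\<alpha> * i + \<beta>)) = (\<Sum>i=0..<m. f i)"
proof -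
  let ?g = "\<lambda>i. (\<alpha> * i + \<beta>) mod m"
  have inj: "inj_on ?g {0..<m}"
  proof (rule inj_onI)
    fix x y assume xy: "x \<in> {0..<m}" "y \<in> {0..<m}" "?g x = ?g y"
    then have "[\<alpha> * x + \<beta> = \<alpha> * y + \<beta>] (mod m)" by (simp add: cong_def)
    then have "[\<alpha> * x = \<alpha> * y] (mod m)" using cong_add_rcancel by blast
    then have "[x = y] (mod m)" using c cong_mult_lcancel by blast
    then show "x = y" using xy by (simp add: cong_def)
  qed
  have "?g ` {0..<m} = {0..<m}"
    by (rule endo_inj_surj) (use m inj in auto)
  with inj have "bij_betw ?g {0..<m} {0..<m}" by (simp add: bij_betw_def)
  from sum.reindex_bij_betw[OF this, of f] show ?thesis by (simp add: per)
qed

text \<open>Chinese remainder theorem. It makes complete sums multiplicative in the modulus, which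
  reduces those of \<open>jac\<close> to prime moduli.\<close>

lemma sum_mult_coprime_periods:
  fixes f g :: "int \<Rightarrow> 'a::comm_semiring_0"
  assumes m: "m > 0" and n: "n > 0" and c: "coprime m n"
    and f: "\<And>x. f (x mod m) = f x" and g: "\<And>x. g (x mod n) = g x"
  shows "(\<Sum>i=0..<m * n. f i * g i) = (\<Sum>i=0..<m. f i) * (\<Sum>i=0..<n. g i)"
proof -
  let ?h = "\<lambda>i. (i mod m, i mod n)"
  have inj: "inj_on ?h {0..<m * n}"
  proof (rule inj_onI)
    fix x y assume xy: "x \<in> {0..<m * n}" "y \<in> {0..<m * n}" "?h x = ?h y"
    then have "[x = y] (mod m)" "[x = y] (mod n)" by (simp_all add: cong_def)
    then have "[x = y] (mod m * n)" using c coprime_cong_mult by blast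
    then show "x = y" using xy by (simp add: cong_def)
  qed
  have "?h ` {0..<m * n} = {0..<m} \<times> {0..<n}"
  proof (rule card_subset_eq)
    show "?h ` {0..<m * n} \<subseteq> {0..<m} \<times> {0..<n}" using m n by auto
    show "card (?h ` {0..<m * n}) = card ({0..<m} \<times> {0..<n})"
      using inj m n by (simp add: card_image card_cartesian_product nat_mult_distrib)
  qed auto
  with inj have "bij_betw ?h {0..<m * n} ({0..<m} \<times> {0..<n})" by (simp add: bij_betw_def)
  from sum.reindex_bij_betw[OF this, of "\<lambda>(x, y). f x * g y"]
  show ?thesis by (simp add: f g sum_product sum.cartesian_product)
qed

text \<open>If every nonzero residue were a square, squaring would be a surjection of a finite set
  onto itself, hence injective; but 1 and \<open>p - 1\<close> have the same square.\<close>

lemma ex_nonresidue: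
  assumes "prime p" "2 < p"
  shows "\<exists>g. Legendre g (int p) = -1"
proof (rule ccontr)
  assume "\<not> ?thesis"
  then have r: "Legendre g (int p) \<in> {0, 1}" for g
    using Legendre_values[of g "int p"] by auto
  let ?A = "{1..<int p}" and ?s = "\<lambda>y. y\<^sup>2 mod int p"
  have pr: "prime (int p)" using assms by simp
  have "?A \<subseteq> ?s ` ?A"
  proof
    fix a assume a: "a \<in> ?A"
    then have "\<not> int p dvd a" using zdvd_not_zless by auto
    then have "QuadRes (int p) a" using r[of a] unfolding Legendre_def
      by (auto simp: cong_0_iff split: if_splits)
    then obtain y where y: "[y\<^sup>2 = a] (mod int p)" unfolding QuadRes_def by auto
    have "\<not> int p dvd y"
    proof
      assume "int p dvd y"
      then have "int p dvd y\<^sup>2" by (simp add: power2_eq_square)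
      then show False using \<open>\<not> int p dvd a\<close> cong_dvd_iff[OF y] by simp
    qed
    then have "y mod int p \<noteq> 0" by auto
    moreover have "0 \<le> y mod int p" "y mod int p < int p" using assms by simp_all
    ultimately have "y mod int p \<in> ?A" by simp
    moreover have "a = ?s (y mod int p)" using y a by (simp add: cong_def power_mod)
    ultimately show "a \<in> ?s ` ?A" by blast
  qed
  then have "card ?A \<le> card (?s ` ?A)" by (intro card_mono) auto
  then have "inj_on ?s ?A"
    by (intro eq_card_imp_inj_on antisym[OF card_image_le]) auto
  moreover have "?s 1 = ?s (int p - 1)"
  proof -
    have "(int p - 1)\<^sup>2 = 1 + (int p - 2) * int p" by (simp add: power2_eq_square algebra_simps)
    then show ?thesis by simp
  qed
  moreover have "1 \<in> ?A" "int p - 1 \<in> ?A" using assms by simp_all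
  ultimately have "1 = int p - 1" using inj_onD by metis
  then show False using assms by simp
qed

text \<open>Multiplying the residues by a nonresidue permutes them and negates every term.\<close>

lemma sum_Legendre:
  assumes "prime p" "2 < p"
  shows "(\<Sum>i=0..<int p. Legendre i (int p)) = 0"
proof -
  obtain g where g: "Legendre g (int p) = -1" using ex_nonresidue[OF assms] by blast
  have "\<not> int p dvd g" using g Legendre_eq_0_iff[of g "int p"] by simp
  then have "coprime g (int p)" using assms by (intro prime_imp_coprime[THEN coprime_commute[THEN iffD1]]) auto
  from sum_affine_residues[OF _ _ this, of "\<lambda>i. Legendre i (int p)" 0]
  have "(\<Sum>i=0..<int p. Legendre (g * i) (int p)) = (\<Sum>i=0..<int p. Legendre i (int p))"
    using assms by simp
  then show ?thesis by (simp add: Legendre_mult[OF assms] g sum_negf)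
qed

text \<open>Substituting \<open>i \<mapsto> h i\<close> shows that the correlation is the same for all \<open>h \<noteq> 0\<close>; its
  sum over all \<open>h\<close> vanishes.\<close>
lemma Legendre_correlation:
  assumes "prime p" "2 < p" "\<not> int p dvd h"
  shows "(\<Sum>i=0..<int p. Legendre i (int p) * Legendre (i + h) (int p)) = -1"
proof -
  let ?L = "\<lambda>i. Legendre i (int p)"
  define C where "C h = (\<Sum>i=0..<int p. ?L i * ?L (i + h))" for h
  have p0: "int p > 0" using assms by simp
  have Lm: "?L (x mod int p + h) = ?L (x + h)" "?L (h + x mod int p) = ?L (h + x)" for x h
    by (rule Legendre_cong, simp add: cong_def mod_simps)+
  have sq: "?L h * ?L h = 1" if "\<not> int p dvd h" for h
    using that unfolding Legendre_def by (auto simp: cong_0_iff)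
  have C1: "C h = C 1" if "\<not> int p dvd h" for h
  proof -
    have "coprime h (int p)" using assms that by (intro prime_imp_coprime[THEN coprime_commute[THEN iffD1]]) auto
    from sum_affine_residues[OF p0 _ this, of "\<lambda>i. ?L i * ?L (i + h)" 0]
    have "C h = (\<Sum>i=0..<int p. ?L (h * i) * ?L (h * i + h))"
      by (simp add: C_def Lm)
    also have "\<dots> = (\<Sum>i=0..<int p. ?L h * ?L h * (?L i * ?L (i + 1)))"
    proof (rule sum.cong[OF refl])
      fix i
      have "?L (h * i + h) = ?L h * ?L (i + 1)"
        using Legendre_mult[OF assms(1,2), of h "i + 1"] by (simp add: distrib_left)
      then show "?L (h * i) * ?L (h * i + h) = ?L h * ?L h * (?L i * ?L (i + 1))"
        by (simp add: Legendre_mult[OF assms(1,2)])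
    qed
    also have "\<dots> = C 1" using sq[OF that] by (simp add: C_def)
    finally show ?thesis .
  qed
  have "(\<Sum>h=0..<int p. C h) = (\<Sum>i=0..<int p. ?L i * (\<Sum>h=0..<int p. ?L (1 * h + i)))"
    unfolding C_def by (subst sum.swap) (simp add: sum_distrib_left add.commute)
  also have "\<dots> = 0"
  proof -
    have "(\<Sum>h=0..<int p. ?L (1 * h + i)) = 0" for i
      using sum_affine_residues[OF p0, of ?L 1 i] sum_Legendre[OF assms(1,2)] by simp
    then show ?thesis by simp
  qed
  finally have tot: "(\<Sum>h=0..<int p. C h) = 0" .
  have ins: "{0..<int p} = insert 0 {1..<int p}" using p0 by auto
  have nd: "\<not> int p dvd i" if "i \<in> {1..<int p}" for i using that zdvd_not_zless by auto
  have "C 0 = (\<Sum>i=1..<int p. ?L i * ?L i)"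
    unfolding C_def ins by (simp add: Legendre_def)
  also have "\<dots> = (\<Sum>i=1..<int p. 1)" by (intro sum.cong refl sq nd)
  finally have "C 0 = int p - 1" using p0 by simp
  moreover have "(\<Sum>h=0..<int p. C h) = C 0 + (\<Sum>h=1..<int p. C 1)"
  proof -
    have "(\<Sum>h=1..<int p. C h) = (\<Sum>h=1..<int p. C 1)"
      by (intro sum.cong refl C1 nd)
    then show ?thesis unfolding ins by simp
  qed
  ultimately have "(int p - 1) * (1 + C 1) = 0" using tot p0 by (simp add: algebra_simps)
  then have "1 + C 1 = 0" using assms(2) mult_eq_0_iff[of "int p - 1" "1 + C 1"] by linarith
  then have "C h = -1" using C1[OF assms(3)] by linarith
  then show ?thesis unfolding C_def .
qed

text \<open>The Jacobi symbol for squarefree \<open>n\<close> only: repeated prime factors are counted once.\<close>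
definition jac :: "int \<Rightarrow> nat \<Rightarrow> int" where
  "jac a n = (\<Prod>p\<in>prime_factors n. Legendre a (int p))"

lemma jac_1 [simp]: "jac a 1 = 1" "jac a (Suc 0) = 1"
  by (simp_all add: jac_def)

lemma jac_prime: "prime p \<Longrightarrow> jac a p = Legendre a (int p)"
  by (simp add: jac_def prime_factorization_prime)

lemma jac_coprime_mult:
  assumes "coprime m n" "m > 0" "n > 0"
  shows "jac a (m * n) = jac a m * jac a n"
proof -
  have "prime_factors (m * n) = prime_factors m \<union> prime_factors n"
    using assms by (intro prime_factors_product) auto
  moreover have "prime_factors m \<inter> prime_factors n = {}"
    using assms(1) by (auto simp: in_prime_factors_iff coprime_def dest!: not_prime_unit)
  ultimately show ?thesis by (simp add: jac_def prod.union_disjoint)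
qed

lemma jac_cong: "[a = b] (mod int n) \<Longrightarrow> jac a n = jac b n"
  unfolding jac_def
  by (intro prod.cong refl Legendre_cong)
     (auto simp: in_prime_factors_iff elim: cong_dvd_modulus)

lemma jac_mod [simp]: "jac (a mod int n) n = jac a n"
  by (rule jac_cong) simp

lemma jac_mult:
  assumes "odd n"
  shows "jac (a * b) n = jac a n * jac b n"
proof -
  have "2 < p" if "p \<in> prime_factors n" for p
  proof -
    have "prime p" "p dvd n" using that by (auto simp: in_prime_factors_iff)
    then show ?thesis using assms prime_ge_2_nat[of p] by (cases "p = 2") auto
  qed
  then show ?thesis unfolding jac_def prod.distrib[symmetric]
    by (intro prod.cong refl Legendre_mult) (auto simp: in_prime_factors_iff)
qed

lemma abs_jac_le_1: "\<bar>jac a n\<bar> \<le> 1"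
proof -
  have "\<bar>Legendre a (int p)\<bar> \<le> 1" for p using Legendre_values[of a "int p"] by auto
  then have "(\<Prod>p\<in>prime_factors n. \<bar>Legendre a (int p)\<bar>) \<le> 1" by (intro prod_le_1) auto
  then show ?thesis by (simp add: jac_def abs_prod)
qed

lemma jac_eq_0_iff:
  assumes "n > 0"
  shows "jac a n = 0 \<longleftrightarrow> \<not> coprime a (int n)"
proof -
  have "jac a n = 0 \<longleftrightarrow> (\<exists>p. prime p \<and> p dvd n \<and> int p dvd a)"
    using assms by (auto simp: jac_def Legendre_eq_0_iff in_prime_factors_iff)
  also have "\<dots> \<longleftrightarrow> \<not> coprime (nat \<bar>a\<bar>) n"
  proof
    assume "\<exists>p. prime p \<and> p dvd n \<and> int p dvd a"
    then obtain p where p: "prime p" "p dvd n" "p dvd nat \<bar>a\<bar>"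
      by (auto simp: dvd_nat_abs_iff)
    then have "\<not> is_unit p" using not_prime_unit by blast
    with p show "\<not> coprime (nat \<bar>a\<bar>) n" by (meson coprime_common_divisor)
  next
    assume "\<not> coprime (nat \<bar>a\<bar>) n"
    then obtain p where "prime p" "p dvd nat \<bar>a\<bar>" "p dvd n" by (rule not_coprime_prime_nat)
    then show "\<exists>p. prime p \<and> p dvd n \<and> int p dvd a"
      by (auto simp: dvd_nat_abs_iff)
  qed
  also have "\<dots> \<longleftrightarrow> \<not> coprime a (int n)"
    by (metis abs_of_nonneg coprime_abs_left_iff coprime_int_iff int_nat_eq abs_ge_zero)
  finally show ?thesis .
qed

text \<open>Squarefreeness makes the prime that is split off coprime to the cofactor, as the
  multiplicativity in the modulus requires.\<close>

lemma odd_squarefree_induct [consumes 2, case_names one prime]: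
  fixes k :: nat
  assumes "odd k" "squarefree k" and one: "P 1"
    and step: "\<And>p k. prime p \<Longrightarrow> 2 < p \<Longrightarrow> odd k \<Longrightarrow> squarefree k \<Longrightarrow> coprime p k \<Longrightarrow> P k \<Longrightarrow> P (p * k)"
  shows "P k"
  using assms(1,2)
proof (induction k rule: less_induct)
  case (less k)
  show ?case
  proof (cases "k = 1")
    case False
    then obtain p where p: "prime p" "p dvd k" using prime_factor_nat by blast
    then obtain l where l: "k = p * l" by blast
    have "k > 0" using less.prems(1) by (simp add: odd_pos)
    then have "l > 0" using l by auto
    have "l < k" using l \<open>l > 0\<close> prime_gt_1_nat[OF p(1)] by simp
    moreover have "odd l" "odd p" using less.prems l by auto
    moreover have "squarefree l" using less.prems(2) l squarefree_mono[of l k] by simp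
    moreover have "coprime p l" using less.prems(2) p(1) l by (simp add: squarefree_prime_cofactor)
    moreover have "2 < p" using \<open>odd p\<close> prime_ge_2_nat[OF p(1)] by (cases "p = 2") auto
    ultimately show ?thesis using step[OF p(1)] less.IH l by simp
  qed (use one in simp)
qed

lemma sum_jac_period:
  assumes "odd k" "squarefree k" "k > 1"
  shows "(\<Sum>i=0..<int k. jac i k) = 0"
  using assms
proof (induction k rule: odd_squarefree_induct)
  case (prime p k)
  have "k > 0" using prime by (simp add: odd_pos)
  then have "(\<Sum>i=0..<int (p * k). jac i (p * k))
      = (\<Sum>i=0..<int p * int k. Legendre i (int p) * jac i k)"
    using prime by (simp add: jac_coprime_mult jac_prime prime_gt_0_nat)
  also have "\<dots> = (\<Sum>i=0..<int p. Legendre i (int p)) * (\<Sum>i=0..<int k. jac i k)"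
    by (rule sum_mult_coprime_periods) (use prime \<open>k > 0\<close> in auto)
  finally show ?case using sum_Legendre[OF prime(1,2)] by simp
qed auto

text \<open>The correlation factors over the primes of \<open>k\<close>. A prime dividing
  \<open>h\<close> contributes at most \<open>p\<close> trivially, any other prime contributes
  exactly -1.\<close>

lemma jac_correlation:
  assumes "odd k" "squarefree k"
  shows "\<bar>\<Sum>i=0..<int k. jac i k * jac (i + h) k\<bar> \<le> gcd h (int k)"
  using assms
proof (induction k rule: odd_squarefree_induct)
  case (prime p k)
  let ?A = "\<Sum>i=0..<int p. Legendre i (int p) * Legendre (i + h) (int p)"
  let ?B = "\<Sum>i=0..<int k. jac i k * jac (i + h) k"
  let ?C = "\<Sum>i=0..<int (p * k). jac i (p * k) * jac (i + h) (p * k)"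
  have "k > 0" using prime by (simp add: odd_pos)
  then have "?C = (\<Sum>i=0..<int p * int k. (Legendre i (int p) * Legendre (i + h) (int p)) * (jac i k * jac (i + h) k))"
    using prime
    by (intro sum.cong) (simp_all add: jac_coprime_mult jac_prime prime_gt_0_nat)
  also have "\<dots> = ?A * ?B"
  proof (rule sum_mult_coprime_periods)
    show "Legendre (x mod int p) (int p) * Legendre (x mod int p + h) (int p)
        = Legendre x (int p) * Legendre (x + h) (int p)" for x
      using Legendre_cong[of "x mod int p + h" "x + h" "int p"] by (simp add: cong_def mod_simps)
    show "jac (x mod int k) k * jac (x mod int k + h) k = jac x k * jac (x + h) k" for x
      using jac_cong[of "x mod int k + h" "x + h" k] by (simp add: cong_def mod_simps)
  qed (use prime \<open>k > 0\<close> in auto)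
  finally have eq: "\<bar>?C\<bar>
     = \<bar>?A\<bar> *
      \<bar>?B\<bar>" by (simp add: abs_mult)
  have "\<bar>?A\<bar> \<le> gcd h (int p)"
  proof (cases "int p dvd h")
    case True
    have "\<bar>Legendre a (int p)\<bar> \<le> 1" for a using Legendre_values[of a "int p"] by auto
    then have "\<bar>Legendre i (int p) * Legendre (i + h) (int p)\<bar> \<le> 1" for i
      unfolding abs_mult by (intro mult_le_one) auto
    then have "\<bar>?A\<bar> \<le> (\<Sum>i=0..<int p. 1)"
      by (intro order.trans[OF sum_abs] sum_mono)
    moreover have "gcd h (int p) = int p" using True by (simp add: gcd.commute gcd_proj1_iff)
    ultimately show ?thesis by simp
  next
    case False
    have "gcd h (int p) > 0" using prime(2) by (subst gcd_pos_int) simp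
    then show ?thesis using Legendre_correlation[OF prime(1,2) False] by linarith
  qed
  then have "\<bar>?C\<bar> \<le> gcd h (int p) * gcd h (int k)"
    unfolding eq using prime by (intro mult_mono) auto
  also have "\<dots> \<le> gcd h (int (p * k))"
  proof (rule zdvd_imp_le)
    have "coprime (gcd h (int p)) (gcd h (int k))"
      using prime(5) by (meson coprime_divisors coprime_int_iff gcd_dvd2)
    then show "gcd h (int p) * gcd h (int k) dvd gcd h (int (p * k))"
      by (intro divides_mult) (auto intro!: gcd_greatest dvd_mult dvd_mult2)
    show "gcd h (int (p * k)) > 0" using \<open>k > 0\<close> prime(1) by (simp add: gcd_pos_int prime_gt_0_nat)
  qed
  finally show ?case .
qed auto

section \<open>Divisors of odd squarefree numbers\<close>

lemma prime_factors_prime_mult: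
  assumes "prime p" "k > 0" "coprime p k"
  shows "prime_factors (p * k) = insert p (prime_factors k)" "p \<notin> prime_factors k"
proof -
  show "prime_factors (p * k) = insert p (prime_factors k)"
    using assms by (subst prime_factors_product) (auto simp: prime_factorization_prime)
  show "p \<notin> prime_factors k"
    using assms by (auto simp: in_prime_factors_iff coprime_absorb_left)
qed

lemma divisor_count_squarefree:
  fixes k :: nat
  assumes "odd k" "squarefree k"
  shows "card {g. g dvd k} \<le> 2 ^ card (prime_factors k)"
  using assms
proof (induction k rule: odd_squarefree_induct)
  case (prime p k)
  have k0: "k > 0" using prime by (simp add: odd_pos)
  have fin: "finite {g. g dvd k}" using k0 by (simp add: finite_divisors_nat)
  have "{g. g dvd p * k} \<subseteq> {g. g dvd k} \<union> (*) p ` {g. g dvd k}"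
  proof
    fix g assume "g \<in> {g. g dvd p * k}"
    then have g: "g dvd p * k" by simp
    show "g \<in> {g. g dvd k} \<union> (*) p ` {g. g dvd k}"
    proof (cases "p dvd g")
      case True
      then obtain l where "g = p * l" by blast
      then show ?thesis using g prime(1) by (auto simp: prime_gt_0_nat)
    next
      case False
      then have "coprime g p" using prime(1) prime_imp_coprime coprime_commute by blast
      then show ?thesis using g coprime_dvd_mult_right_iff by auto
    qed
  qed
  then have "card {g. g dvd p * k} \<le> card ({g. g dvd k} \<union> (*) p ` {g. g dvd k})"
    using fin by (intro card_mono) auto
  also have "\<dots> \<le> card {g. g dvd k} + card ((*) p ` {g. g dvd k})" by (rule card_Un_le)
  also have "\<dots> \<le> 2 * card {g. g dvd k}" using card_image_le[OF fin, of "(*) p"] by simp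
  also have "\<dots> \<le> 2 * 2 ^ card (prime_factors k)" using prime by simp
  also have "\<dots> = 2 ^ card (prime_factors (p * k))"
    using prime_factors_prime_mult[OF prime(1) k0 prime(5)] by simp
  finally show ?case .
qed auto

lemma prod_prime_factors_squarefree:
  fixes k :: nat
  assumes "odd k" "squarefree k"
  shows "\<Prod>(prime_factors k) = k"
  using assms
proof (induction k rule: odd_squarefree_induct)
  case (prime p k)
  then have "k > 0" by (simp add: odd_pos)
  then show ?case using prime prime_factors_prime_mult[of p k] by simp
qed simp

text \<open>Each of the primes \<open>p \<ge> 8\<close> has \<open>2 \<le> p powr (1/3)\<close>; only 3, 5, 7 are exceptional.\<close>
lemma divisor_count_cubed:
  fixes k :: nat
  assumes "odd k" "squarefree k"
  shows "card {g. g dvd k} ^ 3 \<le> 512 * k"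
proof -
  let ?P = "prime_factors k"
  let ?A = "{p \<in> ?P. p < 8}" and ?B = "{p \<in> ?P. \<not> p < 8}"
  have "p \<in> {3,5,7}" if "p \<in> ?A" for p
  proof -
    have "prime p" "odd p" using that assms(1) by (auto simp: in_prime_factors_iff)
    moreover have "p < 8" using that by simp
    moreover have "p \<noteq> 1" using \<open>prime p\<close> by auto
    ultimately have "odd p" "p \<in> {0,1,2,3,4,5,6,7}" "p \<noteq> 1" by (simp_all, arith)
    then show ?thesis by auto
  qed
  then have "card ?A \<le> card {3,5,7::nat}" by (intro card_mono) auto
  \<comment> \<open>The constant \<open>512 = 8 ^ 3\<close> pays for the three exceptional primes;
    every other prime pays for its own factor 8.\<close>
  then have A: "(8::nat) ^ card ?A \<le> 8 ^ 3" by (intro power_increasing) auto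
  have B: "(8::nat) ^ card ?B \<le> \<Prod>?B"
    using prod_mono[of ?B "\<lambda>_. 8" "\<lambda>p. p"] by (auto simp: not_less)
  have "(8::nat) ^ card ?P = 8 ^ card ?A * 8 ^ card ?B"
    by (subst power_add[symmetric], subst card_Un_disjoint[symmetric]) (auto intro!: arg_cong[of _ _ card])
  also have "\<dots> \<le> 512 * \<Prod>?B" using mult_mono[OF A B] by simp
  also have "\<Prod>?B \<le> \<Prod>?P"
    by (intro dvd_imp_le prod_dvd_prod_subset) (auto simp: in_prime_factors_iff prime_gt_0_nat intro!: prod_pos)
  also have "\<dots> = k" using assms by (rule prod_prime_factors_squarefree)
  finally have "(8::nat) ^ card ?P \<le> 512 * k" by simp
  moreover have "card {g. g dvd k} ^ 3 \<le> (2 ^ card ?P) ^ 3"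
    by (intro power_mono divisor_count_squarefree assms) auto
  moreover have "((2::nat) ^ card ?P) ^ 3 = 8 ^ card ?P"
    by (simp add: power_mult[symmetric] mult.commute[of _ 3]) (simp add: power_mult)
  ultimately show ?thesis by simp
qed

section \<open>Interval sums of the Jacobi symbol\<close>

lemma card_multiples_le:
  assumes "g > 0" "J \<ge> 0"
  shows "g * int (card {h \<in> {-J..J} - {0}. g dvd h}) \<le> 2 * J"
proof -
  let ?T = "{-(J div g)..J div g} - {0}"
  have "{h \<in> {-J..J} - {0}. g dvd h} \<subseteq> (\<lambda>t. g * t) ` ?T"
  proof
    fix h assume h: "h \<in> {h \<in> {-J..J} - {0}. g dvd h}"
    then obtain t where t: "h = g * t" by auto
    have "g * t \<le> J" "g * (-t) \<le> J" using h t by auto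
    then have "t \<le> J div g" "-t \<le> J div g"
      using assms(1) by (metis mult.commute zdiv_mono1 nonzero_mult_div_cancel_left less_irrefl)+
    then show "h \<in> (\<lambda>t. g * t) ` ?T" using h t by auto
  qed
  then have "card {h \<in> {-J..J} - {0}. g dvd h} \<le> card ((\<lambda>t. g * t) ` ?T)"
    by (intro card_mono) auto
  also have "\<dots> \<le> card ?T" by (rule card_image_le) simp
  also have "int (card ?T) = 2 * (J div g)"
  proof -
    have "0 \<le> J div g" using assms by (simp add: pos_imp_zdiv_nonneg_iff)
    then show ?thesis by (subst card_Diff_subset) auto
  qed
  finally have "int (card {h \<in> {-J..J} - {0}. g dvd h}) \<le> 2 * (J div g)" by simp
  then have "g * int (card {h \<in> {-J..J} - {0}. g dvd h}) \<le> g * (2 * (J div g))"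
    using assms by (intro mult_left_mono) auto
  also have "\<dots> \<le> 2 * J" using assms by (simp add: minus_mod_eq_mult_div[symmetric])
  finally show ?thesis .
qed

text \<open>Majorize the gcd by the sum of all divisors \<open>g\<close> of \<open>k\<close> that
  divide \<open>h\<close>: each \<open>g\<close> has at most \<open>2 * J / g\<close> nonzero
  multiples in the range, so it contributes at most \<open>2 * J\<close>.\<close>

lemma sum_gcd_le:
  assumes "k > 0" "J \<ge> 0"
  shows "(\<Sum>h\<in>{-J..J} - {0}. gcd h (int k)) \<le> 2 * J * int (card {g. g dvd k})"
proof -
  let ?D = "{g. g dvd k}" and ?H = "{-J..J} - {0::int}"
  have fin: "finite ?D" using assms by (simp add: finite_divisors_nat)
  have "(\<Sum>h\<in>?H. gcd h (int k)) \<le> (\<Sum>h\<in>?H. \<Sum>g\<in>?D. if int g dvd h then int g else 0)"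
  proof (rule sum_mono)
    fix h
    let ?g = "nat (gcd h (int k))"
    have g: "int ?g = gcd h (int k)" by simp
    then have "?g \<in> ?D" by (metis gcd_dvd2 int_dvd_int_iff mem_Collect_eq)
    moreover have "int ?g dvd h" unfolding g by simp
    ultimately show "gcd h (int k) \<le> (\<Sum>g\<in>?D. if int g dvd h then int g else 0)"
      using member_le_sum[of ?g ?D "\<lambda>g. if int g dvd h then int g else 0"] fin by auto
  qed
  also have "\<dots> = (\<Sum>g\<in>?D. int g * int (card {h \<in> ?H. int g dvd h}))"
    by (subst sum.swap) (simp add: sum.If_cases Int_def mult.commute)
  also have "\<dots> \<le> (\<Sum>g\<in>?D. 2 * J)"
    using assms by (intro sum_mono card_multiples_le) (auto intro: Nat.gr0I)
  finally show ?thesis by (simp add: mult_ac)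
qed

lemma sum_shift_int: "(\<Sum>i=a + c..<b + c. f i) = (\<Sum>i=a..<b::int. f (i + c))"
  by (rule sum.reindex_bij_witness[of _ "\<lambda>i. i + c" "\<lambda>i. i - c"]) auto

lemma sum_full_period:
  fixes f :: "int \<Rightarrow> 'a::comm_monoid_add"
  assumes "m > 0" "\<And>x. f (x mod m) = f x"
  shows "(\<Sum>i=a..<a + m. f i) = (\<Sum>i=0..<m. f i)"
  using sum_affine_residues[where f = f and m = m and \<alpha> = 1 and \<beta> = a] assms sum_shift_int[of f 0 a m] by (simp add: add.commute)

text \<open>By positivity \<open>i\<close> may run over a full period. Opening the square then
  produces complete correlations, whose gcd bounds are summed over the differences
  \<open>l - j\<close>.\<close>

lemma sum_jac_bilinear:
  assumes k: "odd k" "squarefree k" and J: "J \<ge> 0" and N: "N \<le> int k"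
  shows "(\<Sum>i=a..<a + N. (\<Sum>j=0..<J. jac (i + j) k)\<^sup>2)
    \<le> J * (int k + 2 * J * int (card {g. g dvd k}))"
proof -
  let ?G = "\<lambda>i. \<Sum>j=0..<J. jac (i + j) k"
  have k0: "k > 0" using k by (simp add: odd_pos)
  have per: "jac (x mod int k + j) k = jac (x + j) k" for x j
    by (rule jac_cong) (simp add: cong_def mod_simps)
  have "(\<Sum>i=a..<a + N. (?G i)\<^sup>2) \<le> (\<Sum>i=a..<a + int k. (?G i)\<^sup>2)"
    using N by (intro sum_mono2) auto
  also have "\<dots> = (\<Sum>i=0..<int k. (?G i)\<^sup>2)"
    by (rule sum_full_period) (use k0 in \<open>simp_all add: per\<close>)
  also have "\<dots> = (\<Sum>j=0..<J. \<Sum>l=0..<J. \<Sum>i=0..<int k. jac (i + j) k * jac (i + l) k)"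
    unfolding power2_eq_square sum_product
    by (rule trans[OF sum.swap sum.cong[OF refl sum.swap]])
  also have "\<dots> \<le> (\<Sum>j=0..<J. \<Sum>l=0..<J. gcd (l - j) (int k))"
  proof (intro sum_mono)
    fix j l
    have "(\<Sum>i=0..<int k. jac (i + j) k * jac (i + l) k)
        = (\<Sum>i=0..<int k. jac i k * jac (i + (l - j)) k)"
      using sum_affine_residues[of "int k" "\<lambda>i. jac i k * jac (i + (l - j)) k" 1 j] k0 per[of _ "l - j"]
      by (simp add: add.assoc)
    then show "(\<Sum>i=0..<int k. jac (i + j) k * jac (i + l) k) \<le> gcd (l - j) (int k)"
      using jac_correlation[OF k, of "l - j"] by linarith
  qed
  also have "\<dots> \<le> (\<Sum>j=0..<J. int k + 2 * J * int (card {g. g dvd k}))"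
  proof (rule sum_mono)
    fix j assume j: "j \<in> {0..<J}"
    have "(\<Sum>l=0..<J. gcd (l - j) (int k)) = (\<Sum>h=-j..<J - j. gcd h (int k))"
      using sum_shift_int[of "\<lambda>h. gcd h (int k)" 0 "-j" J] by simp
    \<comment> \<open>The difference 0 is kept apart, since \<open>gcd 0 (int k) = int k\<close> is
      the diagonal term.\<close>
    also have "\<dots> \<le> (\<Sum>h\<in>insert 0 ({-J..J} - {0}). gcd h (int k))"
      using j by (intro sum_mono2) auto
    also have "\<dots> = int k + (\<Sum>h\<in>{-J..J} - {0}. gcd h (int k))"
      by (subst sum.insert) auto
    also have "\<dots> \<le> int k + 2 * J * int (card {g. g dvd k})"
      using sum_gcd_le[OF k0 J] by simp
    finally show "(\<Sum>l=0..<J. gcd (l - j) (int k)) \<le> int k + 2 * J * int (card {g. g dvd k})" .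
  qed
  finally show ?thesis using J by simp
qed

lemma abs_sum_shift_le:
  fixes f :: "int \<Rightarrow> int"
  assumes "\<And>i. \<bar>f i\<bar> \<le> 1" "j \<ge> 0" "N \<ge> 0"
  shows "\<bar>(\<Sum>i=a..<a + N. f i) - (\<Sum>i=a..<a + N. f (i + j))\<bar> \<le> 2 * j"
proof -
  have "(\<Sum>i=a..<a + N. f (i + j)) = (\<Sum>i=a + j..<a + N + j. f i)"
    by (rule sum_shift_int[symmetric])
  moreover have "sum f {a..<a + N} + sum f {a + N..<a + N + j} = sum f {a..<a + N + j}"
    using assms by (subst sum.union_disjoint[symmetric]) (auto intro!: sum.cong)
  moreover have "sum f {a..<a + j} + sum f {a + j..<a + N + j} = sum f {a..<a + N + j}"
    using assms by (subst sum.union_disjoint[symmetric]) (auto intro!: sum.cong)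
  moreover have s: "\<bar>sum f {b..<b + j}\<bar> \<le> j" for b
    using order.trans[OF sum_abs sum_mono[of "{b..<b + j}" "\<lambda>i. \<bar>f i\<bar>" "\<lambda>_. 1"]] assms by simp
  ultimately show ?thesis using s[of a] s[of "a + N"] by linarith
qed

text \<open>Averaging over \<open>J\<close> shifts of the interval costs \<open>2 J\<close> and makes the sum bilinear, so that
  Cauchy-Schwarz and the correlation bound apply.\<close>
lemma abs_sum_jac_short:
  assumes k: "odd k" "squarefree k" and J: "J > 0" and N: "0 \<le> N" "N \<le> int k"
  shows "of_int (\<bar>\<Sum>i=a..<a + N. jac i k\<bar>) \<le>
    2 * of_int J + sqrt (real k * (real k + 2 * of_int J * real (card {g. g dvd k})) / of_int J)"
proof -
  let ?S = "\<Sum>i=a..<a + N. jac i k" and ?G = "\<lambda>i. \<Sum>j=0..<J. jac (i + j) k"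
  let ?B = "int k + 2 * J * int (card {g. g dvd k})"
  let ?T = "\<Sum>i=a..<a + N. ?G i"
  have "\<bar>J * ?S - ?T\<bar> = \<bar>\<Sum>j=0..<J. ?S - (\<Sum>i=a..<a + N. jac (i + j) k)\<bar>"
    using J by (subst sum.swap) (simp add: sum_subtractf)
  also have "\<dots> \<le> (\<Sum>j=0..<J. 2 * J)"
    by (rule order.trans[OF sum_abs], rule sum_mono,
        rule order.trans[OF abs_sum_shift_le]) (use abs_jac_le_1 N in auto)
  finally have 1: "\<bar>J * ?S\<bar> \<le> \<bar>?T\<bar> + 2 * J * J" using J by simp
  have "real_of_int (?T\<^sup>2) \<le> real_of_int (N * (\<Sum>i=a..<a + N. (?G i)\<^sup>2))"
    using Cauchy_Schwarz_ineq_sum[of "\<lambda>_. 1" "\<lambda>i. real_of_int (?G i)" "{a..<a + N}"] N by simp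
  then have "?T\<^sup>2 \<le> N * (\<Sum>i=a..<a + N. (?G i)\<^sup>2)" by (simp only: of_int_le_iff)
  also have "\<dots> \<le> int k * (J * ?B)"
    using sum_jac_bilinear[OF k, of J N a] J N by (intro mult_mono) (auto intro: sum_nonneg)
  finally have T: "?T\<^sup>2 \<le> int k * (J * ?B)" .
  have "real_of_int \<bar>?T\<bar> = sqrt (of_int (?T\<^sup>2))" by simp
  also have "\<dots> \<le> sqrt (of_int (int k * (J * ?B)))"
    by (intro real_sqrt_le_mono) (use T in \<open>simp only: of_int_le_iff\<close>)
  finally have 2: "real_of_int \<bar>?T\<bar> \<le> sqrt (of_int (int k * (J * ?B)))" .
  have eq: "sqrt (of_int (int k * (J * ?B))) / of_int J
     = sqrt (real k * (real k + 2 * of_int J * real (card {g. g dvd k})) / of_int J)"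
  proof -
    have "of_int (int k * (J * ?B)) / (of_int J)\<^sup>2
      = real k * (real k + 2 * of_int J * real (card {g. g dvd k})) / of_int J"
      using J by (simp add: power2_eq_square)
    moreover have "sqrt (of_int (int k * (J * ?B))) / of_int J = sqrt (of_int (int k * (J * ?B)) / (of_int J)\<^sup>2)"
      using J by (subst real_sqrt_divide) simp
    ultimately show ?thesis by simp
  qed
  have "of_int J * real_of_int \<bar>?S\<bar> \<le> of_int \<bar>?T\<bar> + 2 * of_int J * of_int J"
    using 1 J by (simp only: abs_mult abs_of_pos flip: of_int_le_iff[where 'a = real] of_int_mult) (simp add: abs_mult)
  also have "\<dots> \<le> sqrt (of_int (int k * (J * ?B))) + 2 * of_int J * of_int J" using 2 by simp
  also have "\<dots> = of_int J * (2 * of_int J + sqrt (of_int (int k * (J * ?B))) / of_int J)"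
    using J by (simp add: field_simps)
  finally show ?thesis unfolding eq using J by (subst (asm) mult_le_cancel_left_pos) auto
qed

text \<open>Full periods cancel, so one incomplete period remains. The choice of \<open>J\<close>
  near \<open>k powr (2/3)\<close> balances the shift loss \<open>2 * J\<close> against
  \<open>sqrt (k^2 / J)\<close>; the divisor bound \<open>8 * k powr (1/3)\<close> keeps the gcd
  contribution of the order of \<open>k\<close>.\<close>

lemma abs_sum_jac_le:
  assumes k: "odd k" "squarefree k" "k > 1"
  shows "of_int \<bar>\<Sum>i=a..<b. jac i k\<bar> \<le> 8 * real k powr (2/3)"
proof (cases "a \<le> b")
  case True
  let ?S = "\<lambda>a b. \<Sum>i=a..<b. jac i k"
  have split: "?S a (a + u + w) = ?S a (a + u) + ?S (a + u) (a + u + w)" if "u \<ge> 0" "w \<ge> 0" for u w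
    using that by (subst sum.union_disjoint[symmetric]) (auto intro!: sum.cong)
  have zero: "?S a (a + int t * int k) = 0" for t
  proof (induction t)
    case (Suc t)
    have "?S a (a + int (Suc t) * int k) = ?S a (a + int t * int k + int k)"
      by (simp add: algebra_simps)
    also have "\<dots> = ?S a (a + int t * int k) + ?S (a + int t * int k) (a + int t * int k + int k)"
      by (rule split) simp_all
    also have "\<dots> = 0" using Suc sum_jac_period[OF k] k by (subst sum_full_period) auto
    finally show ?case .
  qed simp
  define t where "t = (b - a) div int k"
  define N where "N = (b - a) mod int k"
  have t: "t \<ge> 0" "b = a + t * int k + N" "0 \<le> N" "N \<le> int k"
    using True k by (auto simp: t_def N_def pos_imp_zdiv_nonneg_iff less_imp_le)
  have "?S a b = ?S a (a + t * int k) + ?S (a + t * int k) (a + t * int k + N)"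
    using t by (simp add: split)
  then have eq: "?S a b = ?S (a + t * int k) (a + t * int k + N)" using zero[of "nat t"] t by simp
  define x where "x = real k powr (1/3)"
  have x1: "x \<ge> 1" unfolding x_def using k by (intro ge_one_powr_ge_zero) auto
  have x3: "x ^ 3 = real k" unfolding x_def using k by (simp flip: powr_realpow add: powr_powr)
  have x2: "x ^ 2 = real k powr (2/3)" unfolding x_def using k by (simp flip: powr_realpow add: powr_powr)
  define J where "J = \<lfloor>x\<^sup>2\<rfloor>"
  have "1 \<le> x\<^sup>2" using x1 by (simp add: one_le_power)
  then have "1 \<le> J" unfolding J_def by (simp add: le_floor_iff)
  moreover have "of_int J \<le> x\<^sup>2" "x\<^sup>2 < of_int J + 1" unfolding J_def by linarith+
  ultimately have J: "J > 0" "of_int J \<le> x\<^sup>2" "x\<^sup>2 \<le> 2 * of_int J" by linarith+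
  have tau: "real (card {g. g dvd k}) \<le> 8 * x"
  proof -
    have "real (card {g. g dvd k}) ^ 3 \<le> 512 * real k"
      using divisor_count_cubed[OF k(1,2)] by (metis of_nat_le_iff of_nat_mult of_nat_numeral of_nat_power)
    then have "real (card {g. g dvd k}) ^ 3 \<le> (8 * x) ^ 3" by (simp add: power_mult_distrib x3)
    then show ?thesis using x1 power_le_imp_le_base[of _ 2 "8 * x"] by (simp add: numeral_eq_Suc)
  qed
  have "2 * of_int J * real (card {g. g dvd k}) \<le> 2 * x\<^sup>2 * (8 * x)"
    using J tau x1 by (intro mult_mono) auto
  also have "\<dots> = 16 * x ^ 3" by (simp add: power2_eq_square power3_eq_cube)
  finally have "real k + 2 * of_int J * real (card {g. g dvd k}) \<le> 17 * x ^ 3" using x3 by simp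
  then have "real k * (real k + 2 * of_int J * real (card {g. g dvd k})) / of_int J \<le> x ^ 3 * (17 * x ^ 3) / (x\<^sup>2 / 2)"
    using x1 J unfolding x3[symmetric] by (intro frac_le mult_left_mono) auto
  also have "\<dots> = 34 * x ^ 4" using x1 by (simp add: field_simps power2_eq_square numeral_eq_Suc)
  also have "\<dots> \<le> (6 * x\<^sup>2)\<^sup>2" using x1 by (simp add: power_mult_distrib power_mult[symmetric])
  finally have "sqrt (real k * (real k + 2 * of_int J * real (card {g. g dvd k})) / of_int J) \<le> 6 * x\<^sup>2"
    by (intro real_le_lsqrt) auto
  then show ?thesis
    using abs_sum_jac_short[OF k(1,2) J(1) t(3,4), of "a + t * int k"] J(2)
    unfolding eq x2[symmetric] by linarith
qed simp

text \<open>Dividing by \<open>\<alpha>\<close> modulo \<open>k\<close> turns the progression into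
  an interval, at the cost of a factor of absolute value at most 1.\<close>

lemma abs_sum_jac_affine_le:
  assumes k: "odd k" "squarefree k" "k > 1" and c: "coprime \<alpha> (int k)"
  shows "of_int \<bar>\<Sum>i=a..<b. jac (\<alpha> * i + \<beta>) k\<bar> \<le> 8 * real k powr (2/3)"
proof -
  obtain \<gamma> where g: "[\<alpha> * \<gamma> = 1] (mod int k)" using cong_solve_coprime_int[OF c] by blast
  have "jac (\<alpha> * i + \<beta>) k = jac \<alpha> k * jac (i + \<gamma> * \<beta>) k" for i
  proof -
    have "[\<alpha> * i + 1 * \<beta> = \<alpha> * i + (\<alpha> * \<gamma>) * \<beta>] (mod int k)"
      using g by (intro cong_add cong_mult) (auto simp: cong_sym)
    then have "jac (\<alpha> * i + \<beta>) k = jac (\<alpha> * (i + \<gamma> * \<beta>)) k"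
      by (intro jac_cong) (simp add: algebra_simps)
    then show ?thesis by (simp add: jac_mult[OF k(1)])
  qed
  then have "(\<Sum>i=a..<b. jac (\<alpha> * i + \<beta>) k) = jac \<alpha> k * (\<Sum>i\<in>{a + \<gamma> * \<beta>..<b + \<gamma> * \<beta>}. jac i k)"
    by (simp add: sum_distrib_left sum_shift_int)
  then have "\<bar>\<Sum>i=a..<b. jac (\<alpha> * i + \<beta>) k\<bar> \<le> 1 * \<bar>\<Sum>i\<in>{a + \<gamma> * \<beta>..<b + \<gamma> * \<beta>}. jac i k\<bar>"
    by (simp only: abs_mult) (rule mult_right_mono[OF abs_jac_le_1 abs_ge_zero])
  then have "real_of_int \<bar>\<Sum>i=a..<b. jac (\<alpha> * i + \<beta>) k\<bar> \<le> of_int \<bar>\<Sum>i\<in>{a + \<gamma> * \<beta>..<b + \<gamma> * \<beta>}. jac i k\<bar>"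
    by (simp only: of_int_le_iff mult_1)
  then show ?thesis using abs_sum_jac_le[OF k] order.trans by blast
qed

section \<open>Reciprocity\<close>

text \<open>For odd \<open>m\<close> and \<open>n\<close> this is the reciprocity sign
  \<open>(-1) ^ ((m - 1) div 2 * ((n - 1) div 2))\<close>, in a form that displays its dependence on
  the residues modulo 4.\<close>

definition rsign :: "nat \<Rightarrow> nat \<Rightarrow> int" where
  "rsign m n = (if m mod 4 = 3 \<and> n mod 4 = 3 then -1 else 1)"

lemma odd_mod_4: "odd (a::nat) \<Longrightarrow> a mod 4 = 1 \<or> a mod 4 = 3"
  by presburger

lemma rsign_commute: "rsign m n = rsign n m"
  by (auto simp: rsign_def)

lemma rsign_mult_left:
  assumes "odd a" "odd b"
  shows "rsign (a * b) n = rsign a n * rsign b n"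
proof -
  have "a * b mod 4 = (a mod 4) * (b mod 4) mod 4" by (simp add: mod_mult_eq)
  then show ?thesis using odd_mod_4[OF assms(1)] odd_mod_4[OF assms(2)] by (auto simp: rsign_def)
qed

lemma Legendre_reciprocity:
  assumes "prime p" "2 < p" "prime q" "2 < q"
  shows "Legendre (int p) (int q) = rsign p q * Legendre (int q) (int p)"
proof (cases "p = q")
  case False
  have od: "odd p" "odd q" using assms prime_odd_nat by blast+
  have par: "even ((r - 1) div 2) \<longleftrightarrow> r mod 4 = 1" if "odd r" for r :: nat
    using that by presburger
  have "(-1::int) ^ ((p - 1) div 2 * ((q - 1) div 2)) = rsign p q"
    using odd_mod_4[OF od(1)] odd_mod_4[OF od(2)] par[OF od(1)] par[OF od(2)]
    by (auto simp: rsign_def minus_one_power_iff)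
  then have e: "Legendre (int p) (int q) * Legendre (int q) (int p) = rsign p q"
    using Quadratic_Reciprocity[OF assms False] by simp
  have "\<not> int p dvd int q" using False assms primes_dvd_imp_eq by auto
  then have "Legendre (int q) (int p) * Legendre (int q) (int p) = 1"
    by (auto simp: Legendre_def cong_0_iff)
  then show ?thesis unfolding e[symmetric] by (simp add: mult.assoc)
qed (simp add: Legendre_def cong_0_iff)

lemma jac_prime_reciprocity:
  assumes n: "odd n" "squarefree n" and p: "prime p" "2 < p"
  shows "jac (int p) n = rsign p n * Legendre (int n) (int p)"
  using n
proof (induction n rule: odd_squarefree_induct)
  case one
  have "\<not> [1 = 0] (mod int p)" using p by (simp add: cong_0_iff zdvd1_eq)
  moreover have "QuadRes (int p) 1" unfolding QuadRes_def by (rule exI[of _ 1]) simp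
  ultimately show ?case using p by (simp add: rsign_def Legendre_def)
next
  case (prime q l)
  have "odd q" using prime prime_odd_nat by blast
  have "l > 0" using prime by (simp add: odd_pos)
  then have "jac (int p) (q * l) = Legendre (int p) (int q) * jac (int p) l"
    using prime by (simp add: jac_coprime_mult jac_prime prime_gt_0_nat)
  also have "\<dots> = rsign p q * rsign p l * (Legendre (int q) (int p) * Legendre (int l) (int p))"
    using Legendre_reciprocity[OF p prime(1,2)] prime by simp
  also have "\<dots> = rsign p (q * l) * Legendre (int (q * l)) (int p)"
    using rsign_mult_left[OF \<open>odd q\<close> prime(3), of p] by (simp add: Legendre_mult[OF p] rsign_commute[of p])
  finally show ?case .
qed

text \<open>If \<open>m\<close> and \<open>n\<close> have a common factor, both symbols are 0; hence
  a sum over \<open>n\<close> can be flipped term by term.\<close>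

lemma jac_reciprocity:
  assumes m: "odd m" "squarefree m" and n: "odd n" "squarefree n"
  shows "jac (int m) n = rsign m n * jac (int n) m"
  using m
proof (induction m rule: odd_squarefree_induct)
  case one
  have "n > 0" using n by (simp add: odd_pos)
  have "jac (1 * 1) n = jac 1 n * jac 1 n" by (rule jac_mult[OF n(1)])
  moreover have "jac 1 n \<noteq> 0" using \<open>n > 0\<close> by (simp add: jac_eq_0_iff)
  ultimately show ?case by (simp add: rsign_def)
next
  case (prime p l)
  have "odd p" using prime prime_odd_nat by blast
  have "l > 0" using prime by (simp add: odd_pos)
  have "jac (int (p * l)) n = jac (int p) n * jac (int l) n"
    using jac_mult[OF n(1)] by simp
  also have "\<dots> = rsign p n * rsign l n * (Legendre (int n) (int p) * jac (int n) l)"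
    using prime jac_prime_reciprocity[OF n prime(1,2)] by simp
  also have "\<dots> = rsign (p * l) n * jac (int n) (p * l)"
    using rsign_mult_left[OF \<open>odd p\<close> prime(3), of n] prime \<open>l > 0\<close>
    by (simp add: jac_coprime_mult jac_prime prime_gt_0_nat)
  finally show ?case .
qed

section \<open>Sums over integers without prime factors in a given set\<close>

text \<open>For \<open>S = {}\<close> these are the partial sums of the L-series at 1. In general
  the Euler factors at the primes in \<open>S\<close> have been removed.\<close>

definition hsum :: "(nat \<Rightarrow> real) \<Rightarrow> nat set \<Rightarrow> nat \<Rightarrow> real" where
  "hsum g S x = (\<Sum>n | n \<in> {1..x} \<and> (\<forall>p\<in>S. \<not> p dvd n). g n / real n)"

lemma abel_identity:
  fixes g :: "nat \<Rightarrow> real"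
  assumes "z \<le> x"
  shows "(\<Sum>n\<in>{z<..x}. g n / n) = sum g {1..x} / (real x + 1) - sum g {1..z} / (real z + 1)
    + (\<Sum>n\<in>{z<..x}. sum g {1..n} * (1 / n - 1 / (real n + 1)))"
  using assms
proof (induction x rule: dec_induct)
  case (step x)
  have "{z<..Suc x} = insert (Suc x) {z<..x}" using step by auto
  then have "(\<Sum>n\<in>{z<..Suc x}. g n / n) = g (Suc x) / (real x + 1) + (\<Sum>n\<in>{z<..x}. g n / n)"
    and "(\<Sum>n\<in>{z<..Suc x}. sum g {1..n} * (1 / n - 1 / (real n + 1))) =
      (sum g {1..x} + g (Suc x)) * (1 / (real x + 1) - 1 / (real x + 2)) +
      (\<Sum>n\<in>{z<..x}. sum g {1..n} * (1 / n - 1 / (real n + 1)))"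
    by (simp_all add: add.commute)
  moreover have "(sum g {1..x} + g (Suc x)) * (1 / (real x + 1) - 1 / (real x + 2)) =
      sum g {1..x} / (real x + 1) + g (Suc x) / (real x + 1) - sum g {1..Suc x} / (real (Suc x) + 1)"
    by (simp add: right_diff_distrib add_divide_distrib add.commute)
  ultimately show ?case using step.IH by linarith
qed simp

text \<open>The weights telescope to \<open>1 / (z + 1) - 1 / (x + 1)\<close>. The negative part
  cancels the boundary term at \<open>x\<close>, so twice the boundary term at \<open>z\<close> is
  left.\<close>

lemma abel_bound:
  fixes g :: "nat \<Rightarrow> real"
  assumes B: "\<And>x. \<bar>sum g {1..x}\<bar> \<le> B" and "z \<le> x"
  shows "\<bar>\<Sum>n\<in>{z<..x}. g n / n\<bar> \<le> 2 * B / (real z + 1)"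
proof -
  have B0: "B \<ge> 0" using B[of 0] by simp
  have tele: "(\<Sum>n\<in>{z<..x}. 1 / real n - 1 / (real n + 1)) = 1 / (real z + 1) - 1 / (real x + 1)"
    using assms(2)
  proof (induction x rule: dec_induct)
    case (step x)
    have "{z<..Suc x} = insert (Suc x) {z<..x}" using step by auto
    then show ?case using step.IH by simp
  qed simp
  have "\<bar>\<Sum>n\<in>{z<..x}. sum g {1..n} * (1 / n - 1 / (real n + 1))\<bar> \<le> (\<Sum>n\<in>{z<..x}. B * (1 / n - 1 / (real n + 1)))"
  proof (intro order.trans[OF sum_abs] sum_mono)
    fix n assume "n \<in> {z<..x}"
    then have nn: "0 \<le> 1 / real n - 1 / (real n + 1)" by (simp add: field_simps)
    show "\<bar>sum g {1..n} * (1 / n - 1 / (real n + 1))\<bar> \<le> B * (1 / n - 1 / (real n + 1))"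
      unfolding abs_mult abs_of_nonneg[OF nn] by (rule mult_right_mono[OF B nn])
  qed
  also have "\<dots> = B * (1 / (real z + 1) - 1 / (real x + 1))" by (simp add: sum_distrib_left[symmetric] tele)
  finally have 1: "\<bar>\<Sum>n\<in>{z<..x}. sum g {1..n} * (1 / n - 1 / (real n + 1))\<bar> \<le> B / (real z + 1) - B / (real x + 1)"
    by (simp add: algebra_simps)
  have 2: "\<bar>sum g {1..w} / (real w + 1)\<bar> \<le> B / (real w + 1)" for w :: nat
    using B[of w] by (simp add: abs_divide divide_right_mono)
  have "2 * B / (real z + 1) = B / (real z + 1) + B / (real z + 1)" by simp
  then show ?thesis using 1 2[of x] 2[of z] unfolding abel_identity[OF assms(2)] by linarith
qed

section \<open>Convergence at 1 and removal of Euler factors\<close>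

lemma hsum_empty: "hsum g {} x = (\<Sum>n=1..x. g n / n)"
  by (auto simp: hsum_def intro!: sum.cong)

lemma hsum_empty_diff:
  assumes "z \<le> x"
  shows "hsum g {} x - hsum g {} z = (\<Sum>n\<in>{z<..x}. g n / n)"
proof -
  have "{1..x} = {1..z} \<union> {z<..x}" using assms by auto
  then have "(\<Sum>n=1..x. g n / n) = (\<Sum>n=1..z. g n / n) + (\<Sum>n\<in>{z<..x}. g n / n)"
    by (simp only:) (subst sum.union_disjoint, auto)
  then show ?thesis unfolding hsum_empty by linarith
qed

lemma bounded_sums_imp_hsum_convergent:
  assumes B: "\<And>x. \<bar>sum g {1..x}\<bar> \<le> B"
  obtains L where "hsum g {} \<longlonglongrightarrow> L" "\<And>z. \<bar>L - hsum g {} z\<bar> \<le> 2 * B / (real z + 1)"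
proof -
  have d: "\<bar>hsum g {} x - hsum g {} z\<bar> \<le> 2 * B / (real z + 1)" if "z \<le> x" for x z
    using abel_bound[OF B that] hsum_empty_diff[OF that, of g] by simp
  have "(\<lambda>z. 2 * B / (real z + 1)) \<longlonglongrightarrow> 0" by real_asymp
  then have "Cauchy (hsum g {})"
  proof (intro CauchyI)
    fix e :: real assume "e > 0"
    with \<open>(\<lambda>z. 2 * B / (real z + 1)) \<longlonglongrightarrow> 0\<close>
    have "\<forall>\<^sub>F z in sequentially. 2 * B / (real z + 1) < e / 2"
      by (intro order_tendstoD) auto
    then obtain M where M: "2 * B / (real M + 1) < e / 2" by (auto simp: eventually_sequentially)
    have "norm (hsum g {} m - hsum g {} n) < e" if "m \<ge> M" "n \<ge> M" for m n
      using d[OF that(1)] d[OF that(2)] M unfolding real_norm_def by linarith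
    then show "\<exists>M. \<forall>m\<ge>M. \<forall>n\<ge>M. norm (hsum g {} m - hsum g {} n) < e" by blast
  qed
  then obtain L where L: "hsum g {} \<longlonglongrightarrow> L" using Cauchy_convergent_iff convergent_def by blast
  moreover have "\<bar>L - hsum g {} z\<bar> \<le> 2 * B / (real z + 1)" for z
  proof (rule tendsto_upperbound[OF _ _ sequentially_bot])
    show "(\<lambda>x. \<bar>hsum g {} x - hsum g {} z\<bar>) \<longlonglongrightarrow> \<bar>L - hsum g {} z\<bar>" by (intro tendsto_intros L)
    show "\<forall>\<^sub>F x in sequentially. \<bar>hsum g {} x - hsum g {} z\<bar> \<le> 2 * B / (real z + 1)"
      by (intro eventually_mono[OF eventually_ge_at_top[of z]] d)
  qed
  ultimately show ?thesis using that by blast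
qed

text \<open>The terms to be removed are those at \<open>p * m\<close>, where \<open>m\<close> may
  again be divisible by \<open>p\<close>; complete multiplicativity extracts
  \<open>g p / p\<close>.\<close>

lemma hsum_insert:
  assumes mult: "\<And>m n. g (m * n) = g m * g n" and p: "prime p" "p \<notin> S" and S: "\<And>q. q \<in> S \<Longrightarrow> prime q"
  shows "hsum g (insert p S) x = hsum g S x - g p / p * hsum g S (x div p)"
proof -
  let ?A = "{n. n \<in> {1..x} \<and> (\<forall>q\<in>S. \<not> q dvd n)}"
  have p0: "p > 0" using p(1) by (rule prime_gt_0_nat)
  let ?A' = "{n. n \<in> {1..x} \<and> (\<forall>q\<in>insert p S. \<not> q dvd n)}"
  have "hsum g S x = (\<Sum>n\<in>?A' \<union> {n. n \<in> ?A \<and> p dvd n}. g n / n)"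
    unfolding hsum_def by (rule sum.cong) auto
  also have "\<dots> = hsum g (insert p S) x + (\<Sum>n | n \<in> ?A \<and> p dvd n. g n / n)"
    unfolding hsum_def by (rule sum.union_disjoint) auto
  also have "(\<Sum>n | n \<in> ?A \<and> p dvd n. g n / n)
      =  (\<Sum>m | m \<in> {1..x div p} \<and> (\<forall>q\<in>S. \<not> q dvd m). g (p * m) / (p * m))"
  proof (rule sum.reindex_bij_witness[of _ "\<lambda>m. p * m" "\<lambda>n. n div p"])
    fix n assume n: "n \<in> {n. n \<in> ?A \<and> p dvd n}"
    then obtain m where m: "n = p * m" by auto
    then have "m = n div p" "m > 0" "m \<le> x div p"
      using n p0 by (auto simp: less_eq_div_iff_mult_less_eq mult.commute)
    then show "n div p \<in> {m. m \<in> {1..x div p} \<and> (\<forall>q\<in>S. \<not> q dvd m)}" using n m by auto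
  next
    fix m assume m: "m \<in> {m. m \<in> {1..x div p} \<and> (\<forall>q\<in>S. \<not> q dvd m)}"
    then have "p * m \<le> x" using p0 by (simp add: less_eq_div_iff_mult_less_eq mult.commute)
    moreover have "\<not> q dvd p * m" if "q \<in> S" for q
    proof
      assume "q dvd p * m"
      moreover have "\<not> q dvd m" using m that by simp
      ultimately have "q dvd p" using S[OF that] prime_dvd_mult_nat by blast
      then have "q = p" using S[OF that] p(1) primes_dvd_imp_eq by blast
      then show False using that p(2) by simp
    qed
    ultimately show "p * m \<in> {n. n \<in> ?A \<and> p dvd n}" using m p0 by auto
  qed (use p0 in auto)
  also have "\<dots> = g p / p * hsum g S (x div p)"
    by (simp add: hsum_def sum_distrib_left mult)
  finally show ?thesis by simp
qed

lemma tendsto_hsum: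
  assumes mult: "\<And>m n. g (m * n) = g m * g n" and S: "finite S" "\<And>q. q \<in> S \<Longrightarrow> prime q"
    and L: "hsum g {} \<longlonglongrightarrow> L"
  shows "hsum g S \<longlonglongrightarrow> L * (\<Prod>p\<in>S. 1 - g p / p)"
  using S
proof (induction S rule: finite_induct)
  case (insert p S)
  have "p > 0" using insert.prems[of p] prime_gt_0_nat by blast
  then have "filterlim (\<lambda>x. x div p) sequentially sequentially"
    by (intro filterlim_at_top_div_const_nat)
  moreover have IH: "hsum g S \<longlonglongrightarrow> L * (\<Prod>p\<in>S. 1 - g p / p)" using insert by auto
  ultimately have "(\<lambda>x. hsum g S (x div p)) \<longlonglongrightarrow> L * (\<Prod>p\<in>S. 1 - g p / p)"
    by (rule filterlim_compose[rotated])
  then have "(\<lambda>x. hsum g S x - g p / p * hsum g S (x div p)) \<longlonglongrightarrow>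
      L * (\<Prod>p\<in>S. 1 - g p / p) - g p / p * (L * (\<Prod>p\<in>S. 1 - g p / p))"
    by (intro tendsto_intros IH)
  moreover have "hsum g (insert p S) = (\<lambda>x. hsum g S x - g p / p * hsum g S (x div p))"
    using insert by (intro ext hsum_insert mult) auto
  moreover have "L * (\<Prod>p\<in>S. 1 - g p / p) - g p / p * (L * (\<Prod>p\<in>S. 1 - g p / p))
    = L * (\<Prod>p\<in>insert p S. 1 - g p / p)" using insert by (simp add: algebra_simps)
  ultimately show ?case by simp
qed (use L in simp)

text \<open>Rankin's trick: the power \<open>\<sigma>\<close> of the error bound passes through the inclusion-exclusion
  over the primes in \<open>S\<close>, where each prime costs a factor \<open>1 + p powr (\<sigma> - 1)\<close>.\<close>
lemma hsum_tail:
  assumes mult: "\<And>m n. g (m * n) = g m * g n" and S: "finite S" "\<And>q. q \<in> S \<Longrightarrow> prime q"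
    and g1: "\<And>n. \<bar>g n\<bar> \<le> 1" and \<sigma>: "\<sigma> \<ge> 0"
    and E: "\<And>z. \<bar>L - hsum g {} z\<bar> \<le> Q * (real z + 1) powr (-\<sigma>)"
  shows "\<bar>L * (\<Prod>p\<in>S. 1 - g p / p) - hsum g S x\<bar>
    \<le> Q * (real x + 1) powr (-\<sigma>) * (\<Prod>p\<in>S. 1 + real p powr (\<sigma> - 1))"
  using S
proof (induction S arbitrary: x rule: finite_induct)
  case (insert p S)
  let ?P = "\<lambda>S. \<Prod>p\<in>S. 1 + real p powr (\<sigma> - 1)" and ?R = "L * (\<Prod>p\<in>S. 1 - g p / p)"
  have p0: "p > 0" using insert.prems[of p] prime_gt_0_nat by blast
  have Q0: "Q \<ge> 0" using order.trans[OF abs_ge_zero E[of 0]] by simp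
  have P0: "?P S \<ge> 0" by (intro prod_nonneg) (simp add: add_nonneg_nonneg)
  have IH: "\<bar>?R - hsum g S x\<bar> \<le> Q * (real x + 1) powr (-\<sigma>) * ?P S" for x
    using insert by auto
  have "real x + 1 \<le> p * (real (x div p) + 1)"
  proof -
    have "x < p * (x div p + 1)" using p0 dividend_less_times_div[of p x] by simp
    then have "real (Suc x) \<le> real (p * (x div p + 1))" by (simp only: of_nat_le_iff Suc_le_eq)
    then show ?thesis by (simp add: algebra_simps)
  qed
  then have "(real (x div p) + 1) powr (-\<sigma>) \<le> ((real x + 1) / p) powr (-\<sigma>)"
    using p0 \<sigma> by (intro powr_mono2') (auto simp: field_simps)
  also have "\<dots> = real p powr \<sigma> * (real x + 1) powr (-\<sigma>)"
    using p0 by (simp add: powr_divide powr_minus field_simps)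
  finally have pw: "(real (x div p) + 1) powr (-\<sigma>) \<le> real p powr \<sigma> * (real x + 1) powr (-\<sigma>)" .
  have "\<bar>g p / p * (?R - hsum g S (x div p))\<bar> \<le> 1 / p * (Q * (real p powr \<sigma> * (real x + 1) powr (-\<sigma>)) * ?P S)"
    unfolding abs_mult
  proof (rule mult_mono)
    show "\<bar>g p / p\<bar> \<le> 1 / p" using g1[of p] p0 by (simp add: abs_divide divide_right_mono)
    show "\<bar>?R - hsum g S (x div p)\<bar> \<le> Q * (real p powr \<sigma> * (real x + 1) powr (-\<sigma>)) * ?P S"
      by (rule order.trans[OF IH]) (intro mult_right_mono mult_left_mono pw Q0 P0)
  qed auto
  also have "\<dots> = Q * (real x + 1) powr (-\<sigma>) * ?P S * real p powr (\<sigma> - 1)"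
    using p0 by (simp add: powr_diff)
  finally have 2: "\<bar>g p / p * (?R - hsum g S (x div p))\<bar> \<le> Q * (real x + 1) powr (-\<sigma>) * ?P S * real p powr (\<sigma> - 1)" .
  have "L * (\<Prod>p\<in>insert p S. 1 - g p / p) - hsum g (insert p S) x
    = (?R - hsum g S x) - g p / p * (?R - hsum g S (x div p))"
    using insert by (subst hsum_insert[OF mult]) (auto simp: algebra_simps)
  then have "\<bar>L * (\<Prod>p\<in>insert p S. 1 - g p / p) - hsum g (insert p S) x\<bar>
    \<le> Q * (real x + 1) powr (-\<sigma>) * ?P S + Q * (real x + 1) powr (-\<sigma>) * ?P S * real p powr (\<sigma> - 1)"
    using order.trans[OF abs_triangle_ineq4 add_mono[OF IH[of x] 2]] by simp
  also have "\<dots> = Q * (real x + 1) powr (-\<sigma>) * ?P (insert p S)"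
    using insert by (simp add: algebra_simps)
  finally show ?case .
qed (use E in simp)

section \<open>Characters modulo 8 twisted by a Jacobi symbol\<close>

text \<open>Real characters modulo 1 and 4 are also of this kind once they are set to 0 at even
  numbers, so one family serves the three possible 2-parts of a discriminant.\<close>

definition char8 :: "(nat \<Rightarrow> int) \<Rightarrow> bool" where
  "char8 \<xi> \<longleftrightarrow> (\<forall>n. \<xi> (n + 8) = \<xi> n) \<and> (\<forall>m n. \<xi> (m * n) = \<xi> m * \<xi> n) \<and>
     (\<forall>n. \<xi> n \<in> {-1, 0, 1}) \<and> (\<forall>n. \<xi> n = 0 \<longleftrightarrow> even n)"

lemma char8_abs: "char8 \<xi> \<Longrightarrow> \<bar>\<xi> n\<bar> \<le> 1"
  unfolding char8_def by (metis abs_0 abs_1 abs_minus_cancel empty_iff insert_iff order_refl zero_le_one)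

lemma char8_mod: "char8 \<xi> \<Longrightarrow> \<xi> (n mod 8) = \<xi> n"
proof -
  assume "char8 \<xi>"
  then have step: "\<xi> (m + 8) = \<xi> m" for m by (simp add: char8_def)
  have "\<xi> (m + 8 * k) = \<xi> m" for m k
  proof (induction k)
    case (Suc k)
    have "m + 8 * Suc k = m + 8 * k + 8" by simp
    then show ?case using step[of "m + 8 * k"] Suc by (simp only:)
  qed simp
  from this[of "n mod 8" "n div 8"] show ?thesis by simp
qed

lemma abs_char8_jac_le_1: "char8 \<xi> \<Longrightarrow> \<bar>real_of_int (\<xi> n * jac a d)\<bar> \<le> 1"
  using mult_mono[OF char8_abs[of \<xi> n] abs_jac_le_1[of a d]]
  by (simp flip: abs_mult of_int_abs of_int_mult)

text \<open>On a residue class modulo 8 the factor \<open>\<xi>\<close> is constant and the symbol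
  runs along a progression; \<open>64 = 8 * 8\<close> collects the classes.\<close>

lemma abs_sum_char8_jac_le:
  assumes \<xi>: "char8 \<xi>" and d: "odd d" "squarefree d" "d > 1"
  shows "\<bar>\<Sum>n=1..x. real_of_int (\<xi> n * jac (int n) d)\<bar> \<le> 64 * real d powr (2/3)"
proof -
  let ?C = "\<lambda>b. {n \<in> {1..x}. n mod 8 = b}"
  have cls: "\<bar>\<Sum>n\<in>?C b. real_of_int (\<xi> n * jac (int n) d)\<bar> \<le> 8 * real d powr (2/3)" if b: "b < 8" for b
  proof (cases "odd b")
    case False
    then have "\<xi> b = 0" using \<xi> by (simp add: char8_def)
    then have "\<xi> n = 0" if "n \<in> ?C b" for n
      using that char8_mod[OF \<xi>, of n] by simp
    then show ?thesis by simp
  next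
    case True
    then have b1: "b \<ge> 1" by (simp add: odd_pos Suc_le_eq)
    \<comment> \<open>The number of \<open>i\<close> with \<open>8 * i + b \<le> x\<close>. Adding 8
      before subtracting keeps the natural subtraction from being cut off when
      \<open>b > x\<close>.\<close>
    let ?T = "\<Sum>i=0..<int ((x + 8 - b) div 8). jac (8 * i + int b) d"
    have "(\<Sum>n\<in>?C b. jac (int n) d) = ?T"
    proof (rule sum.reindex_bij_witness[of _ "\<lambda>i. nat (8 * i + int b)" "\<lambda>n. int (n div 8)"])
      fix n assume n: "n \<in> ?C b"
      then have e: "n = 8 * (n div 8) + b" by (metis (mono_tags) mem_Collect_eq mult_div_mod_eq)
      then show "nat (8 * int (n div 8) + int b) = n" by linarith
      have "n \<le> x" using n by simp
      moreover have "8 * (n div 8 + 1) + b = 8 * (n div 8) + b + 8" by simp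
      ultimately have "8 * (n div 8 + 1) + b \<le> x + 8" by (simp only: e[symmetric])
      then have "8 * (n div 8 + 1) \<le> x + 8 - b" by (rule add_le_imp_le_diff)
      then have "n div 8 < (x + 8 - b) div 8"
        by (simp add: less_eq_div_iff_mult_less_eq mult.commute flip: Suc_le_eq)
      then show "int (n div 8) \<in> {0..<int ((x + 8 - b) div 8)}" by simp
      have "8 * int (n div 8) + int b = int n" using e by linarith
      then show "jac (8 * int (n div 8) + int b) d = jac (int n) d" by simp
    next
      fix i assume i: "i \<in> {0..<int ((x + 8 - b) div 8)}"
      then obtain k where k: "i = int k" by (metis atLeastLessThan_iff nonneg_int_cases)
      have e: "nat (8 * i + int b) = 8 * k + b" using k by simp
      have "k < (x + 8 - b) div 8" using i k by simp
      then have "8 * k + b \<le> x" by linarith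
      then show "nat (8 * i + int b) \<in> ?C b" unfolding e using b b1 by auto
      show "int (nat (8 * i + int b) div 8) = i" unfolding e using b k by simp
    qed
    moreover have "(\<Sum>n\<in>?C b. \<xi> n * jac (int n) d) = \<xi> b * (\<Sum>n\<in>?C b. jac (int n) d)"
      unfolding sum_distrib_left by (rule sum.cong) (use char8_mod[OF \<xi>] in auto)
    ultimately have "\<bar>\<Sum>n\<in>?C b. \<xi> n * jac (int n) d\<bar> \<le> 1 * \<bar>?T\<bar>"
      by (simp only: abs_mult) (rule mult_right_mono[OF char8_abs[OF \<xi>] abs_ge_zero])
    then have "real_of_int \<bar>\<Sum>n\<in>?C b. \<xi> n * jac (int n) d\<bar> \<le> of_int \<bar>?T\<bar>"
      by (simp only: of_int_le_iff mult_1)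
    also have "\<dots> \<le> 8 * real d powr (2/3)"
    proof (rule abs_sum_jac_affine_le[OF d])
      have "coprime (2 ^ 3) (int d)" using d(1) by (subst coprime_power_left_iff) (simp add: coprime_left_2_iff_odd)
      then show "coprime 8 (int d)" by simp
    qed
    finally show ?thesis by simp
  qed
  have "(\<Sum>n=1..x. real_of_int (\<xi> n * jac (int n) d)) = (\<Sum>b<8. \<Sum>n\<in>?C b. real_of_int (\<xi> n * jac (int n) d))"
    by (rule sum.group[symmetric]) auto
  also have "\<bar>\<dots>\<bar> \<le> (\<Sum>b<(8::nat). 8 * real d powr (2/3))"
    by (rule order.trans[OF sum_abs], rule sum_mono) (use cls in auto)
  finally show ?thesis by simp
qed

lemma sum_inverse_le: "x \<ge> 1 \<Longrightarrow> (\<Sum>n=1..x. 1 / real n) \<le> 1 + ln (real x)"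
proof (induction x rule: dec_induct)
  case (step x)
  have "1 / (real x + 1) \<le> ln (real x + 1) - ln (real x)"
  proof -
    have "ln (real x / (real x + 1)) \<le> real x / (real x + 1) - 1" using step by (intro ln_le_minus_one) auto
    also have "\<dots> = - (1 / (real x + 1))" by (simp add: field_simps)
    finally show ?thesis using step by (simp add: ln_div)
  qed
  then show ?case using step.IH by (simp add: add.commute)
qed simp

lemma le_powr_interpolate:
  fixes t u v \<sigma> :: real
  assumes "0 \<le> t" "t \<le> u" "t \<le> v" "0 \<le> \<sigma>" "\<sigma> \<le> 1"
  shows "t \<le> u powr \<sigma> * v powr (1 - \<sigma>)"
proof -
  have "t = t powr \<sigma> * t powr (1 - \<sigma>)" using assms by (simp flip: powr_add)
  also have "\<dots> \<le> u powr \<sigma> * v powr (1 - \<sigma>)" using assms by (intro mult_mono powr_mono2) auto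
  finally show ?thesis .
qed

text \<open>Rankin's trick wants an error decaying like a small power \<open>\<sigma>\<close> of
  \<open>1 / z\<close>. The tail bound from Abel summation is strong for large \<open>z\<close>,
  while a bound of logarithmic size holds for every \<open>z\<close>; interpolating between the two
  with weights \<open>\<sigma>\<close> and \<open>1 - \<sigma>\<close> gives the required
  shape.\<close>

lemma char8_jac_tail:
  assumes \<xi>: "char8 \<xi>" and d: "odd d" "squarefree d" "d > 1"
    and S: "finite S" "\<And>q. q \<in> S \<Longrightarrow> prime q" and \<sigma>: "0 \<le> \<sigma>" "\<sigma> \<le> 1"
  defines "g \<equiv> \<lambda>n. real_of_int (\<xi> n * jac (int n) d)"
  obtains L where "hsum g {} \<longlonglongrightarrow> L"
    "\<And>x. \<bar>L * (\<Prod>p\<in>S. 1 - g p / p) - hsum g S x\<bar> \<le>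
       (128 * real d powr (2/3) / (real x + 1)) powr \<sigma> * (129 + ln (real d)) *
       (\<Prod>p\<in>S. 1 + real p powr (\<sigma> - 1))"
proof -
  have g1: "\<bar>g n\<bar> \<le> 1" for n
    unfolding g_def by (rule abs_char8_jac_le_1[OF \<xi>])
  have mult: "g (m * n) = g m * g n" for m n
    using \<xi> by (simp add: g_def char8_def jac_mult[OF d(1)])
  define v where "v = 129 + ln (real d)"
  have "\<bar>sum g {1..x}\<bar> \<le> 64 * real d powr (2/3)" for x
    unfolding g_def by (rule abs_sum_char8_jac_le[OF \<xi> d])
  then obtain L where L: "hsum g {} \<longlonglongrightarrow> L"
    "\<And>z. \<bar>L - hsum g {} z\<bar> \<le> 2 * (64 * real d powr (2/3)) / (real z + 1)"
    using bounded_sums_imp_hsum_convergent[of g "64 * real d powr (2/3)"] by auto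
  have big: "\<bar>L - hsum g {} z\<bar> \<le> 128" if "d \<le> z" for z
  proof -
    have "real d powr (2/3) \<le> real d powr 1" using d by (intro powr_mono) auto
    also have "\<dots> \<le> real z + 1" using that d by simp
    finally have "128 * real d powr (2/3) / (real z + 1) \<le> 128" by (simp add: divide_le_eq)
    then show ?thesis using L(2)[of z] by simp
  qed
  \<comment> \<open>From \<open>d\<close> on the tail is at most 128; before \<open>d\<close> a
    harmonic sum up to \<open>d\<close> is added, which costs \<open>1 + ln d\<close>.\<close>
  have v: "\<bar>L - hsum g {} z\<bar> \<le> v" for z
  proof (cases "d \<le> z")
    case True
    moreover have "0 \<le> ln (real d)" using d by simp
    ultimately show ?thesis using big[of z] unfolding v_def by linarith
  next
    case False
    then have "\<bar>hsum g {} d - hsum g {} z\<bar> \<le> (\<Sum>n\<in>{z<..d}. 1 / real n)"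
      by (subst hsum_empty_diff) (auto intro!: order.trans[OF sum_abs] sum_mono divide_right_mono g1 simp: abs_divide)
    also have "\<dots> \<le> (\<Sum>n=1..d. 1 / real n)" by (rule sum_mono2) auto
    also have "\<dots> \<le> 1 + ln (real d)" using d by (intro sum_inverse_le) auto
    finally show ?thesis using big[of d] unfolding v_def by linarith
  qed
  have v1: "v \<ge> 1" using d by (simp add: v_def)
  have E: "\<bar>L - hsum g {} z\<bar> \<le> ((128 * real d powr (2/3)) powr \<sigma> * v) * (real z + 1) powr (-\<sigma>)" for z
  proof -
    have "\<bar>L - hsum g {} z\<bar> \<le> (128 * real d powr (2/3) / (real z + 1)) powr \<sigma> * v powr (1 - \<sigma>)"
      using L(2)[of z] v[of z] \<sigma> by (intro le_powr_interpolate) auto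
    also have "\<dots> \<le> (128 * real d powr (2/3) / (real z + 1)) powr \<sigma> * v powr 1"
      using v1 \<sigma> by (intro mult_left_mono powr_mono) auto
    also have "\<dots> = ((128 * real d powr (2/3)) powr \<sigma> * v) * (real z + 1) powr (-\<sigma>)"
      using v1 by (simp add: powr_divide powr_minus_divide)
    finally show ?thesis .
  qed
  show ?thesis
  proof (rule that[OF L(1)])
    fix x
    have "\<bar>L * (\<Prod>p\<in>S. 1 - g p / p) - hsum g S x\<bar>
      \<le> ((128 * real d powr (2/3)) powr \<sigma> * v) * (real x + 1) powr (-\<sigma>) * (\<Prod>p\<in>S. 1 + real p powr (\<sigma> - 1))"
      by (rule hsum_tail[OF mult S g1 \<sigma>(1) E])
    also have "((128 * real d powr (2/3)) powr \<sigma> * v) * (real x + 1) powr (-\<sigma>)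
       = (128 * real d powr (2/3) / (real x + 1)) powr \<sigma> * (129 + ln (real d))"
      using v1 by (simp add: powr_divide powr_minus_divide v_def)
    finally show "\<bar>L * (\<Prod>p\<in>S. 1 - g p / p) - hsum g S x\<bar> \<le>
       (128 * real d powr (2/3) / (real x + 1)) powr \<sigma> * (129 + ln (real d)) *
       (\<Prod>p\<in>S. 1 + real p powr (\<sigma> - 1))" .
  qed
qed

lemma prod_one_minus_ge:
  fixes a :: "'b \<Rightarrow> real"
  assumes "finite Q" "\<And>p. p \<in> Q \<Longrightarrow> 0 \<le> a p" "\<And>p. p \<in> Q \<Longrightarrow> a p \<le> 1"
  shows "1 - sum a Q \<le> (\<Prod>p\<in>Q. 1 - a p)"
  using assms
proof (induction Q rule: finite_induct)
  case (insert q Q)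
  have "0 \<le> a q * sum a Q" using insert by (intro mult_nonneg_nonneg sum_nonneg) auto
  then have "1 - sum a (insert q Q) \<le> (1 - a q) * (1 - sum a Q)"
    using insert by (simp add: algebra_simps)
  also have "\<dots> \<le> (1 - a q) * (\<Prod>p\<in>Q. 1 - a p)"
    using insert by (intro mult_left_mono insert.IH) auto
  finally show ?case using insert by simp
qed simp

text \<open>\<open>f\<close> is the given character and \<open>g\<close> a character of smaller modulus inducing it away from the
  primes in \<open>S\<close>; the primes in \<open>Q\<close> are those at which the induced character vanishes.\<close>
lemma L_lower_bound:
  fixes f g :: "nat \<Rightarrow> real"
  assumes f: "\<And>m n. f (m * n) = f m * f n" "\<And>n. \<bar>f n\<bar> \<le> 1" "hsum f {} \<longlonglongrightarrow> Lf"
    and g: "\<And>m n. g (m * n) = g m * g n" "\<And>n. \<bar>g n\<bar> \<le> 1" "hsum g {} \<longlonglongrightarrow> Lg"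
    and S: "finite S" "\<And>q. q \<in> S \<Longrightarrow> prime q" and Q: "finite Q" "\<And>q. q \<in> Q \<Longrightarrow> prime q"
    and SQ: "S \<inter> Q = {}"
    and fg: "\<And>n. n > 0 \<Longrightarrow> (\<And>p. p \<in> S \<Longrightarrow> \<not> p dvd n) \<Longrightarrow> f n = (if \<exists>p\<in>Q. p dvd n then 0 else g n)"
    and R: "Lg * (\<Prod>p\<in>S. 1 - g p / p) \<ge> 1/2" and sumQ: "(\<Sum>p\<in>Q. 1 / real p) \<le> 1/2"
  shows "Lf \<ge> 1/4 / (\<Prod>p\<in>S. 1 + 1 / real p)"
proof -
  \<comment> \<open>Without the primes in \<open>S\<close>, the functions differ only in that
    \<open>f\<close> vanishes at multiples of primes in \<open>Q\<close>. So the two sieved sums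
    agree term by term, and their limits give an identity between the Euler products.\<close>
  have "hsum f S = hsum g (S \<union> Q)"
  proof
    fix x
    have "hsum f S x = (\<Sum>n | n \<in> {1..x} \<and> (\<forall>p\<in>S. \<not> p dvd n). if \<exists>p\<in>Q. p dvd n then 0 else g n / n)"
      unfolding hsum_def by (rule sum.cong) (auto simp: fg)
    also have "\<dots> = hsum g (S \<union> Q) x"
      unfolding hsum_def by (rule sum.mono_neutral_cong_right) auto
    finally show "hsum f S x = hsum g (S \<union> Q) x" .
  qed
  moreover have "hsum f S \<longlonglongrightarrow> Lf * (\<Prod>p\<in>S. 1 - f p / p)"
    by (rule tendsto_hsum[OF f(1) S f(3)])
  moreover have "hsum g (S \<union> Q) \<longlonglongrightarrow> Lg * (\<Prod>p\<in>S \<union> Q. 1 - g p / p)"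
    by (rule tendsto_hsum[OF g(1) _ _ g(3)]) (use S Q in auto)
  ultimately have "Lf * (\<Prod>p\<in>S. 1 - f p / p) = Lg * (\<Prod>p\<in>S \<union> Q. 1 - g p / p)"
    using LIMSEQ_unique by metis
  also have "\<dots> = Lg * (\<Prod>p\<in>S. 1 - g p / p) * (\<Prod>p\<in>Q. 1 - g p / p)"
    using S Q SQ by (simp add: prod.union_disjoint)
  finally have eq: "Lf * (\<Prod>p\<in>S. 1 - f p / p) = Lg * (\<Prod>p\<in>S. 1 - g p / p) * (\<Prod>p\<in>Q. 1 - g p / p)" .
  have p2: "real p \<ge> 2" if "prime p" for p using prime_ge_2_nat[OF that] by simp
  have "1/2 \<le> 1 - (\<Sum>p\<in>Q. 1 / real p)" using sumQ by simp
  also have "\<dots> \<le> (\<Prod>p\<in>Q. 1 - 1 / real p)"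
    by (rule prod_one_minus_ge) (use Q p2 in \<open>auto simp: divide_le_eq intro: order.trans[of _ 2]\<close>)
  also have "\<dots> \<le> (\<Prod>p\<in>Q. 1 - g p / p)"
  proof (rule prod_mono)
    fix p assume "p \<in> Q"
    then have "real p \<ge> 2" using p2 Q by auto
    moreover have "g p \<le> 1" using g(2)[of p] by simp
    ultimately show "0 \<le> 1 - 1 / real p \<and> 1 - 1 / real p \<le> 1 - g p / p"
      by (simp add: divide_right_mono)
  qed
  finally have "1/2 * (1/2) \<le> Lg * (\<Prod>p\<in>S. 1 - g p / p) * (\<Prod>p\<in>Q. 1 - g p / p)"
    using R by (intro mult_mono) auto
  then have 1: "1/4 \<le> Lf * (\<Prod>p\<in>S. 1 - f p / p)" unfolding eq by simp
  have fb: "0 < 1 - f p / p \<and> 1 - f p / p \<le> 1 + 1 / real p" if "p \<in> S" for p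
  proof -
    have "real p \<ge> 2" using that p2 S by auto
    moreover have "\<bar>f p / p\<bar> \<le> 1 / p" using f(2)[of p] by (simp add: abs_divide divide_right_mono)
    moreover have "1 / real p \<le> 1/2" using \<open>real p \<ge> 2\<close> by (simp add: field_simps)
    ultimately show ?thesis by linarith
  qed
  then have P: "0 < (\<Prod>p\<in>S. 1 - f p / p)" by (intro prod_pos) auto
  have "Lf > 0" by (rule zero_less_mult_pos2[OF _ P]) (use 1 in linarith)
  moreover have "(\<Prod>p\<in>S. 1 - f p / p) \<le> (\<Prod>p\<in>S. 1 + 1 / real p)"
    using fb by (intro prod_mono) (auto intro: less_imp_le)
  ultimately have "1/4 \<le> Lf * (\<Prod>p\<in>S. 1 + 1 / real p)"
    using 1 by (meson less_imp_le mult_left_mono order.trans)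
  moreover have "0 < (\<Prod>p\<in>S. 1 + 1 / real p)" by (intro prod_pos) (simp add: add_pos_nonneg)
  ultimately show ?thesis by (simp add: divide_le_eq)
qed

section \<open>The second moment over the modulus\<close>

definition rough :: "nat \<Rightarrow> nat \<Rightarrow> bool" where
  "rough Y n \<longleftrightarrow> (\<forall>p. prime p \<longrightarrow> p dvd n \<longrightarrow> Y < p)"

lemma sum_powr_third_le: "(\<Sum>n=1..N. real n powr (-1/3)) \<le> 2 * real N powr (2/3)"
proof (induction N)
  case (Suc N)
  define a where "a = real (Suc N) powr (1/3)"
  define b where "b = real N powr (1/3)"
  have ab: "0 \<le> b" "b \<le> a" "0 < a" by (auto simp: a_def b_def intro: powr_mono2)
  have cube: "a ^ 3 = real (Suc N)" "b ^ 3 = real N"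
    using ab by (auto simp: a_def b_def powr_powr simp flip: powr_realpow powr_numeral)
  have sq: "real (Suc N) powr (2/3) = a\<^sup>2" "real N powr (2/3) = b\<^sup>2"
    by (auto simp: a_def b_def powr_powr simp flip: powr_numeral)
  have inv: "real (Suc N) powr (-1/3) = 1 / a" by (simp add: a_def powr_minus_divide[symmetric])
  \<comment> \<open>As \<open>a ^ 3 - b ^ 3 = 1\<close>, this product equals
    \<open>2 * (a^2 - b^2) * a - 1\<close>.\<close>
  have "0 \<le> (a - b) * (a * b + (a - b) * (a + b))"
    using ab by (intro mult_nonneg_nonneg add_nonneg_nonneg) auto
  then have "1 \<le> 2 * (a\<^sup>2 - b\<^sup>2) * a"
    using cube by (simp add: algebra_simps power2_eq_square power3_eq_cube)
  then have le: "1 / a \<le> 2 * (a\<^sup>2 - b\<^sup>2)" using ab by (simp add: divide_le_eq)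
  have "(\<Sum>n=1..Suc N. real n powr (-1/3)) = (\<Sum>n=1..N. real n powr (-1/3)) + 1 / a"
    unfolding inv[symmetric] by simp
  also have "\<dots> \<le> 2 * b\<^sup>2 + 2 * (a\<^sup>2 - b\<^sup>2)" by (rule add_mono[OF Suc.IH[unfolded sq] le])
  also have "\<dots> = 2 * real (Suc N) powr (2/3)" unfolding sq by simp
  finally show ?case .
qed simp

lemma sum_inverse_squares_le:
  assumes "Y \<ge> 1"
  shows "(\<Sum>n\<in>{Y<..N}. 1 / (real n)\<^sup>2) \<le> 1 / real Y"
proof (cases "Y \<le> N")
  case True
  then have "(\<Sum>n\<in>{Y<..N}. 1 / (real n)\<^sup>2) \<le> 1 / real Y - 1 / real N"
  proof (induction N rule: dec_induct)
    case (step N)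
    have "{Y<..Suc N} = insert (Suc N) {Y<..N}" using step by auto
    moreover have "1 / (real (Suc N))\<^sup>2 \<le> 1 / real N - 1 / real (Suc N)"
    proof -
      have N0: "real N > 0" using step(1) assms by simp
      have "1 / (real (Suc N))\<^sup>2 \<le> 1 / (real N * real (Suc N))"
        using N0 by (intro divide_left_mono) (auto simp: power2_eq_square intro!: mult_pos_pos)
      also have "\<dots> = 1 / real N - 1 / real (Suc N)" using N0 by (simp add: field_simps)
      finally show ?thesis .
    qed
    ultimately show ?case using step.IH by simp
  qed simp
  then show ?thesis using True by (smt (verit) divide_nonneg_nonneg of_nat_0_le_iff)
qed simp

lemma sum_multiples_inverse_le:
  assumes "k > 0" "A \<subseteq> {n \<in> {1..N}. k dvd n}" "N \<ge> 1"
  shows "(\<Sum>n\<in>A. 1 / real n) \<le> (1 + ln (real N)) / real k"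
proof -
  have "(\<Sum>n\<in>A. 1 / real n) \<le> (\<Sum>n\<in>(*) k ` {1..N}. 1 / real n)"
  proof (rule sum_mono2)
    show "A \<subseteq> (*) k ` {1..N}"
    proof
      fix n assume "n \<in> A"
      then have n: "1 \<le> n" "n \<le> N" "k dvd n" using assms(2) by auto
      then obtain m where m: "n = k * m" by (elim dvdE)
      then have "m \<le> k * m" "1 \<le> m" using assms(1) n by (auto simp: Suc_le_eq)
      moreover from this have "m \<le> N" using m n by linarith
      ultimately show "n \<in> (*) k ` {1..N}" using m by auto
    qed
  qed auto
  also have "\<dots> = (\<Sum>m=1..N. 1 / real m) / real k"
    using assms(1) by (subst sum.reindex) (auto simp: inj_on_def sum_divide_distrib mult.commute)
  also have "\<dots> \<le> (1 + ln (real N)) / real k"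
    using sum_inverse_le[OF assms(3)] by (intro divide_right_mono) auto
  finally show ?thesis .
qed

lemma sum_UNION_le:
  fixes f :: "'b \<Rightarrow> real"
  assumes "finite I" "\<And>i. i \<in> I \<Longrightarrow> finite (A i)" "\<And>x. f x \<ge> 0"
  shows "sum f (\<Union>i\<in>I. A i) \<le> (\<Sum>i\<in>I. sum f (A i))"
  using assms
proof (induction I rule: finite_induct)
  case (insert i I)
  have "sum f (A i \<union> (\<Union>i\<in>I. A i)) + sum f (A i \<inter> (\<Union>i\<in>I. A i)) = sum f (A i) + sum f (\<Union>i\<in>I. A i)"
    using insert by (intro sum.union_inter) auto
  moreover have "0 \<le> sum f (A i \<inter> (\<Union>i\<in>I. A i))" using insert by (intro sum_nonneg) auto
  ultimately show ?case using insert by simp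
qed simp

text \<open>The square of a prime \<open>p > Y\<close> divides \<open>n\<close>, and the multiples
  of \<open>p^2\<close> carry a share \<open>1 / p^2\<close> of the harmonic sum. These
  \<open>n\<close> are set aside because reciprocity is available for squarefree
  \<open>n\<close>.\<close>

lemma sum_rough_nonsquarefree_le:
  assumes "Y \<ge> 1" "N \<ge> 1"
  shows "(\<Sum>n | n \<in> {1..N} \<and> rough Y n \<and> \<not> squarefree n. 1 / real n) \<le> (1 + ln (real N)) / real Y"
proof -
  let ?C = "\<lambda>p. {n \<in> {1..N}. p\<^sup>2 dvd n}"
  have "(\<Sum>n | n \<in> {1..N} \<and> rough Y n \<and> \<not> squarefree n. 1 / real n) \<le> (\<Sum>n\<in>(\<Union>p\<in>{Y<..N}. ?C p). 1 / real n)"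
  proof (rule sum_mono2)
    show "{n. n \<in> {1..N} \<and> rough Y n \<and> \<not> squarefree n} \<subseteq> (\<Union>p\<in>{Y<..N}. ?C p)"
    proof
      fix n assume n: "n \<in> {n. n \<in> {1..N} \<and> rough Y n \<and> \<not> squarefree n}"
      then obtain p where p: "prime p" "p\<^sup>2 dvd n" using squarefree_factorial_semiring[of n] by auto
      have "p dvd p\<^sup>2" by (simp add: power2_eq_square)
      then have "p dvd n" using p(2) dvd_trans by blast
      moreover have "Y < p" using n p(1) \<open>p dvd n\<close> by (auto simp: rough_def)
      moreover have "p \<le> N" using dvd_imp_le[OF \<open>p dvd n\<close>] n by auto
      ultimately show "n \<in> (\<Union>p\<in>{Y<..N}. ?C p)" using n p by auto
    qed
  qed auto
  also have "\<dots> \<le> (\<Sum>p\<in>{Y<..N}. \<Sum>n\<in>?C p. 1 / real n)" by (rule sum_UNION_le) auto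
  also have "\<dots> \<le> (\<Sum>p\<in>{Y<..N}. (1 + ln (real N)) * (1 / (real p)\<^sup>2))"
  proof (rule sum_mono)
    fix p assume "p \<in> {Y<..N}"
    then show "(\<Sum>n\<in>?C p. 1 / real n) \<le> (1 + ln (real N)) * (1 / (real p)\<^sup>2)"
      using sum_multiples_inverse_le[of "p\<^sup>2" "?C p" N] assms by simp
  qed
  also have "\<dots> \<le> (1 + ln (real N)) * (1 / real Y)"
    unfolding sum_distrib_left[symmetric]
    using assms by (intro mult_left_mono sum_inverse_squares_le) (auto intro: add_nonneg_nonneg)
  finally show ?thesis by simp
qed

text \<open>A common prime \<open>p\<close> exceeds \<open>Y\<close>, and the pairs of multiples of
  \<open>p\<close> contribute at most the square of \<open>(1 + ln N) / p\<close>.\<close>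

lemma sum_noncoprime_le:
  assumes "Y \<ge> 1" "N \<ge> 1" and A: "A \<subseteq> {1..N}" "\<And>n. n \<in> A \<Longrightarrow> rough Y n"
  shows "(\<Sum>(m, n) | m \<in> A \<and> n \<in> A \<and> \<not> coprime m n. 1 / (real m * real n)) \<le> (1 + ln (real N))\<^sup>2 / real Y"
proof -
  have fin: "finite A" using A(1) finite_subset by blast
  let ?C = "\<lambda>p. {n \<in> A. p dvd n}"
  have "(\<Sum>(m, n) | m \<in> A \<and> n \<in> A \<and> \<not> coprime m n. 1 / (real m * real n)) \<le>
     (\<Sum>(m, n)\<in>(\<Union>p\<in>{Y<..N}. ?C p \<times> ?C p). 1 / (real m * real n))"
  proof (rule sum_mono2)
    show "{(m, n). m \<in> A \<and> n \<in> A \<and> \<not> coprime m n} \<subseteq> (\<Union>p\<in>{Y<..N}. ?C p \<times> ?C p)"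
    proof clarify
      fix m n assume mn: "m \<in> A" "n \<in> A" "\<not> coprime m n"
      from not_coprime_prime_nat[OF mn(3)] obtain p where p: "prime p" and d: "p dvd m" "p dvd n" .
      have "Y < p" using A(2)[OF mn(1)] p d by (auto simp: rough_def)
      moreover have "p \<le> N" using dvd_imp_le[OF d(1)] mn A by fastforce
      ultimately show "(m, n) \<in> (\<Union>p\<in>{Y<..N}. ?C p \<times> ?C p)" using mn d by auto
    qed
  qed (use fin in auto)
  also have "\<dots> \<le> (\<Sum>p\<in>{Y<..N}. \<Sum>(m, n)\<in>?C p \<times> ?C p. 1 / (real m * real n))"
    by (rule sum_UNION_le) (use fin in auto)
  also have "\<dots> \<le> (\<Sum>p\<in>{Y<..N}. (1 + ln (real N))\<^sup>2 * (1 / (real p)\<^sup>2))"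
  proof (rule sum_mono)
    fix p assume p: "p \<in> {Y<..N}"
    have "(\<Sum>(m, n)\<in>?C p \<times> ?C p. 1 / (real m * real n)) = (\<Sum>n\<in>?C p. 1 / real n)\<^sup>2"
      unfolding power2_eq_square sum_product sum.cartesian_product by simp
    also have "\<dots> \<le> ((1 + ln (real N)) / real p)\<^sup>2"
      using p A assms(2) by (intro power_mono sum_multiples_inverse_le sum_nonneg) auto
    finally show "(\<Sum>(m, n)\<in>?C p \<times> ?C p. 1 / (real m * real n)) \<le> (1 + ln (real N))\<^sup>2 * (1 / (real p)\<^sup>2)"
      by (simp add: power_divide)
  qed
  also have "\<dots> \<le> (1 + ln (real N))\<^sup>2 * (1 / real Y)"
    unfolding sum_distrib_left[symmetric]
    using assms by (intro mult_left_mono sum_inverse_squares_le) auto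
  finally show ?thesis by simp
qed

text \<open>Pairs \<open>m, n\<close> with a common factor are estimated trivially, since that factor is large.
  For coprime \<open>m, n\<close> the function \<open>d \<mapsto> jac d m * jac d n\<close> is a nonprincipal character.\<close>
lemma second_moment:
  assumes Y: "Y \<ge> 1" and N: "N \<ge> 1" and A: "A \<subseteq> {2..N}"
    "\<And>n. n \<in> A \<Longrightarrow> rough Y n" "\<And>n. n \<in> A \<Longrightarrow> odd n" "\<And>n. n \<in> A \<Longrightarrow> squarefree n"
  shows "(\<Sum>d=1..<M. (\<Sum>n\<in>A. real_of_int (jac (int d) n) / real n)\<^sup>2)
    \<le> 32 * real N powr (4/3) + real M * ((1 + ln (real N))\<^sup>2 / real Y)"
proof -
  have fin: "finite A" using A(1) finite_subset by blast
  let ?c = "\<lambda>m n. \<Sum>d=1..<M. real_of_int (jac (int d) m * jac (int d) n)"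
  have pos: "n > 0" if "n \<in> A" for n using A(1) that by fastforce
  have cop: "\<bar>?c m n\<bar> \<le> 8 * (real m * real n) powr (2/3)" if "m \<in> A" "n \<in> A" "coprime m n" for m n
  proof -
    have "?c m n = of_int (\<Sum>d=1..<int M. jac d (m * n))"
      using jac_coprime_mult[OF that(3) pos[OF that(1)] pos[OF that(2)]]
      by (simp del: of_int_mult) (rule sum.reindex_bij_witness[of _ nat int], auto)
    moreover have "real_of_int \<bar>\<Sum>d=1..<int M. jac d (m * n)\<bar> \<le> 8 * real (m * n) powr (2/3)"
    proof (rule abs_sum_jac_le)
      show "odd (m * n)" using A(3) that by auto
      show "squarefree (m * n)" using A(4) that by (simp add: squarefree_mult_coprime)
      \<comment> \<open>Since 1 is excluded from \<open>A\<close>, the modulus \<open>m * n\<close>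
        exceeds 1 and the symbol modulo \<open>m * n\<close> has vanishing complete sums.\<close>
      have "m \<ge> 2" "n \<ge> 2" using A(1) that by auto
      then show "m * n > 1" by (metis one_less_numeral_iff less_le_trans less_1_mult semiring_norm(76))
    qed
    ultimately show ?thesis by simp
  qed
  have triv: "\<bar>?c m n\<bar> \<le> real M" for m n
  proof -
    have "\<bar>?c m n\<bar> \<le> (\<Sum>d=1..<M. 1)"
    proof (rule order.trans[OF sum_abs], rule sum_mono)
      fix d
      have "\<bar>jac (int d) m * jac (int d) n\<bar> \<le> 1"
        unfolding abs_mult by (intro mult_le_one abs_jac_le_1) auto
      then show "\<bar>real_of_int (jac (int d) m * jac (int d) n)\<bar> \<le> 1"
        by (simp only: of_int_abs[symmetric] of_int_le_1_iff)
    qed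
    then show ?thesis by simp
  qed
  have "(\<Sum>d=1..<M. (\<Sum>n\<in>A. real_of_int (jac (int d) n) / real n)\<^sup>2)
     = (\<Sum>(m, n)\<in>A \<times> A. ?c m n / (real m * real n))"
  proof -
    have "(\<Sum>d=1..<M. (\<Sum>n\<in>A. real_of_int (jac (int d) n) / real n)\<^sup>2)
      = (\<Sum>d=1..<M. \<Sum>(m, n)\<in>A \<times> A. real_of_int (jac (int d) m * jac (int d) n) / (real m * real n))"
      unfolding power2_eq_square sum_product sum.cartesian_product by simp
    also have "\<dots> = (\<Sum>(m, n)\<in>A \<times> A. \<Sum>d=1..<M. real_of_int (jac (int d) m * jac (int d) n) / (real m * real n))"
      unfolding case_prod_unfold by (rule sum.swap)
    finally show ?thesis by (simp only: sum_divide_distrib)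
  qed
  also have "\<dots> \<le> (\<Sum>(m, n)\<in>A \<times> A. 8 * (real m powr (-1/3) * real n powr (-1/3)) +
      (if coprime m n then 0 else real M * (1 / (real m * real n))))"
  proof (rule sum_mono, clarify)
    fix m n assume mn: "m \<in> A" "n \<in> A"
    then have p: "real m > 0" "real n > 0" using pos by auto
    have pw: "real k powr (-1/3) = real k powr (2/3) / real k" if "real k > 0" for k
      using that powr_diff[of "real k" "2/3" 1] by simp
    show "?c m n / (real m * real n) \<le> 8 * (real m powr (-1/3) * real n powr (-1/3)) +
      (if coprime m n then 0 else real M * (1 / (real m * real n)))"
    proof (cases "coprime m n")
      case True
      have "?c m n / (real m * real n) \<le> 8 * (real m * real n) powr (2/3) / (real m * real n)"
        using cop[OF mn True] p by (intro divide_right_mono) auto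
      also have "\<dots> = 8 * (real m powr (-1/3) * real n powr (-1/3))"
        unfolding pw[OF p(1)] pw[OF p(2)] using p by (simp add: powr_mult)
      finally show ?thesis using True by simp
    next
      case False
      have "?c m n / (real m * real n) \<le> real M / (real m * real n)"
        using triv[of m n] p by (intro divide_right_mono) auto
      also have "\<dots> \<le> 8 * (real m powr (-1/3) * real n powr (-1/3)) + real M / (real m * real n)" by simp
      finally show ?thesis using False by simp
    qed
  qed
  also have "\<dots> = 8 * (\<Sum>n\<in>A. real n powr (-1/3))\<^sup>2 +
      real M * (\<Sum>(m, n) | m \<in> A \<and> n \<in> A \<and> \<not> coprime m n. 1 / (real m * real n))"
  proof -
    have "(\<Sum>(m, n)\<in>A \<times> A. if coprime m n then 0 else real M * (1 / (real m * real n)))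
      = (\<Sum>(m, n) | m \<in> A \<and> n \<in> A \<and> \<not> coprime m n. real M * (1 / (real m * real n)))"
      by (rule sum.mono_neutral_cong_right) (use fin in auto)
    then show ?thesis
      unfolding case_prod_unfold power2_eq_square sum_product sum.cartesian_product
      by (simp add: sum.distrib sum_distrib_left case_prod_unfold)
  qed
  also have "\<dots> \<le> 8 * (2 * real N powr (2/3))\<^sup>2 + real M * ((1 + ln (real N))\<^sup>2 / real Y)"
  proof (intro add_mono mult_left_mono power_mono)
    have "(\<Sum>n\<in>A. real n powr (-1/3)) \<le> (\<Sum>n=1..N. real n powr (-1/3))"
      using A(1) by (intro sum_mono2) auto
    then show "(\<Sum>n\<in>A. real n powr (-1/3)) \<le> 2 * real N powr (2/3)"
      using sum_powr_third_le[of N] by simp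
    show "(\<Sum>(m, n) | m \<in> A \<and> n \<in> A \<and> \<not> coprime m n. 1 / (real m * real n)) \<le> (1 + ln (real N))\<^sup>2 / real Y"
      using A(1,2) by (intro sum_noncoprime_le Y N) auto
  qed (auto intro: sum_nonneg)
  also have "8 * (2 * real N powr (2/3))\<^sup>2 = 32 * real N powr (4/3)"
    by (simp add: power_mult_distrib powr_powr flip: powr_numeral)
  finally show ?thesis .
qed

section \<open>Good moduli and the sieved L-series\<close>

text \<open>Fixing \<open>n\<close> modulo 8 fixes \<open>\<xi> n\<close> for every
  \<open>\<xi>\<close> as well as the reciprocity sign. Eight sums thus control all
  \<open>\<xi>\<close> at once, and flipping the symbol does not change their absolute
  values.\<close>

definition rough_class :: "nat \<Rightarrow> nat \<Rightarrow> nat \<Rightarrow> nat set" where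
  "rough_class Y N b = {n \<in> {2..N}. odd n \<and> squarefree n \<and> rough Y n \<and> n mod 8 = b}"

definition rough_class_sum :: "nat \<Rightarrow> nat \<Rightarrow> nat \<Rightarrow> nat \<Rightarrow> real" where
  "rough_class_sum Y N b d = (\<Sum>n\<in>rough_class Y N b. jac (int n) d / real n)"

definition good_modulus :: "nat \<Rightarrow> nat \<Rightarrow> nat \<Rightarrow> bool" where
  "good_modulus Y N d \<longleftrightarrow>
     (\<forall>b<8. \<bar>rough_class_sum Y N b d\<bar> \<le> 1/32)"

definition primes_upto :: "nat \<Rightarrow> nat set" where
  "primes_upto Y = {p. prime p \<and> p \<le> Y}"

lemma finite_primes_upto [simp]: "finite (primes_upto Y)"
  by (rule finite_subset[of _ "{..Y}"]) (auto simp: primes_upto_def)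

lemma abs_sum_rough_class_flip:
  assumes "odd d" "squarefree d"
  shows "\<bar>rough_class_sum Y N b d\<bar> = \<bar>\<Sum>n\<in>rough_class Y N b. real_of_int (jac (int d) n) / real n\<bar>"
proof -
  have "jac (int n) d = rsign b d * jac (int d) n" if "n \<in> rough_class Y N b" for n
  proof -
    have n: "odd n" "squarefree n" "n mod 8 = b" using that by (auto simp: rough_class_def)
    have "n mod 4 = b mod 4" unfolding n(3)[symmetric] by (simp add: mod_mod_cancel)
    then have "rsign n d = rsign b d" by (simp add: rsign_def)
    then show ?thesis using jac_reciprocity[OF n(1,2) assms] by simp
  qed
  then have "rough_class_sum Y N b d = rsign b d * (\<Sum>n\<in>rough_class Y N b. real_of_int (jac (int d) n) / real n)"
    by (simp add: rough_class_sum_def sum_distrib_left)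
  moreover have "\<bar>real_of_int (rsign b d)\<bar> = 1" by (simp add: rsign_def)
  ultimately show ?thesis by (simp add: abs_mult)
qed

text \<open>Chebyshev's inequality: the threshold 1/32 costs \<open>32^2 = 1024\<close>, and the
  eight classes make it 8192.\<close>

lemma bad_modulus_count:
  assumes Y: "Y \<ge> 1" and N: "N \<ge> 1"
  shows "real (card {d \<in> {1..<M}. odd d \<and> squarefree d \<and> \<not> good_modulus Y N d})
    \<le> 8192 * (32 * real N powr (4/3) + real M * ((1 + ln (real N))\<^sup>2 / real Y))"
proof -
  let ?K = "32 * real N powr (4/3) + real M * ((1 + ln (real N))\<^sup>2 / real Y)"
  let ?V = "\<lambda>b d. \<Sum>n\<in>rough_class Y N b. real_of_int (jac (int d) n) / real n"
  let ?Bad = "{d \<in> {1..<M}. odd d \<and> squarefree d \<and> \<not> good_modulus Y N d}"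
  have "real (card ?Bad) = (\<Sum>d\<in>?Bad. 1)" by simp
  also have "\<dots> \<le> (\<Sum>d\<in>?Bad. \<Sum>b<8. 1024 * (?V b d)\<^sup>2)"
  proof (rule sum_mono)
    fix d assume "d \<in> ?Bad"
    then obtain b where b: "b < 8" "1/32 < \<bar>?V b d\<bar>"
      unfolding good_modulus_def using abs_sum_rough_class_flip by fastforce
    have "(1/32)\<^sup>2 \<le> \<bar>?V b d\<bar>\<^sup>2" using b by (intro power_mono) auto
    then have "1 \<le> 1024 * (?V b d)\<^sup>2" by (simp add: power2_eq_square)
    also have "\<dots> \<le> (\<Sum>b<8. 1024 * (?V b d)\<^sup>2)" using b by (intro member_le_sum) auto
    finally show "1 \<le> (\<Sum>b<8. 1024 * (?V b d)\<^sup>2)" .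
  qed
  also have "\<dots> \<le> (\<Sum>d=1..<M. \<Sum>b<8. 1024 * (?V b d)\<^sup>2)"
    by (intro sum_mono2 sum_nonneg) auto
  also have "\<dots> = (\<Sum>b<8. 1024 * (\<Sum>d=1..<M. (?V b d)\<^sup>2))"
    by (subst sum.swap) (simp add: sum_distrib_left)
  also have "\<dots> \<le> (\<Sum>b<(8::nat). 1024 * ?K)"
    by (intro sum_mono mult_left_mono second_moment Y N) (auto simp: rough_class_def)
  finally show ?thesis by simp
qed

text \<open>The term at 1 equals 1. The other squarefree \<open>n\<close> regroup into the eight
  class sums, worth at most \<open>8/32 = 1/4\<close>; the nonsquarefree \<open>n\<close> are
  bounded trivially.\<close>

lemma hsum_good_modulus:
  assumes \<xi>: "char8 \<xi>" and d: "odd d" and good: "good_modulus Y N d" and Y: "Y \<ge> 2" and N: "N \<ge> 1"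
  defines "g \<equiv> \<lambda>n. real_of_int (\<xi> n * jac (int n) d)"
  shows "\<bar>hsum g (primes_upto Y) N - 1\<bar> \<le> 1/4 + (1 + ln (real N)) / real Y"
proof -
  have g1: "\<bar>g n\<bar> \<le> 1" for n
    unfolding g_def by (rule abs_char8_jac_le_1[OF \<xi>])
  have "\<xi> (1 * 1) = \<xi> 1 * \<xi> 1" "\<xi> 1 \<noteq> 0" using \<xi> unfolding char8_def by (metis, simp)
  then have x1: "\<xi> 1 = 1" by simp
  have "jac (1 * 1) d = jac 1 d * jac 1 d" by (rule jac_mult[OF d])
  moreover have "d > 0" using d by (simp add: odd_pos)
  then have "jac 1 d \<noteq> 0" by (simp add: jac_eq_0_iff)
  ultimately have j1: "jac 1 d = 1" by simp
  have ro: "odd n" if "rough Y n" for n using that Y by (auto simp: rough_def dest: spec[of _ 2])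
  let ?U = "{n \<in> {2..N}. squarefree n \<and> rough Y n}"
  let ?W = "{n. n \<in> {1..N} \<and> rough Y n \<and> \<not> squarefree n}"
  have "hsum g (primes_upto Y) N = (\<Sum>n\<in>insert 1 (?U \<union> ?W). g n / n)"
    unfolding hsum_def
  proof (rule sum.cong)
    have "(\<forall>p\<in>primes_upto Y. \<not> p dvd n) \<longleftrightarrow> rough Y n" for n
      by (auto simp: primes_upto_def rough_def not_less)
    moreover have "rough Y 1" by (auto simp: rough_def)
    ultimately show "{n. n \<in> {1..N} \<and> (\<forall>p\<in>primes_upto Y. \<not> p dvd n)} = insert 1 (?U \<union> ?W)"
      using N by (auto simp: le_Suc_eq)
  qed simp
  also have "\<dots> = g 1 + (\<Sum>n\<in>?U \<union> ?W. g n / n)"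
    by (subst sum.insert) auto
  also have "(\<Sum>n\<in>?U \<union> ?W. g n / n) = (\<Sum>n\<in>?U. g n / n) + (\<Sum>n\<in>?W. g n / n)"
    by (rule sum.union_disjoint) auto
  also have "(\<Sum>n\<in>?U. g n / n) = (\<Sum>b<8. \<Sum>n\<in>{n\<in>?U. n mod 8 = b}. g n / n)"
    by (rule sum.group[symmetric]) auto
  also have "\<dots> = (\<Sum>b<8. \<xi> b * rough_class_sum Y N b d)"
  proof (rule sum.cong[OF refl])
    fix b
    have e: "{n\<in>?U. n mod 8 = b} = rough_class Y N b" using ro by (auto simp: rough_class_def)
    have x: "\<xi> n = \<xi> b" if "n \<in> rough_class Y N b" for n
      using that char8_mod[OF \<xi>, of n] by (simp add: rough_class_def)
    show "(\<Sum>n\<in>{n\<in>?U. n mod 8 = b}. g n / n) = \<xi> b * rough_class_sum Y N b d"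
      unfolding rough_class_sum_def sum_distrib_left e by (rule sum.cong) (simp_all add: g_def x)
  qed
  finally have "hsum g (primes_upto Y) N - 1 =
     (\<Sum>b<8. \<xi> b * rough_class_sum Y N b d) + (\<Sum>n\<in>?W. g n / n)"
    using x1 j1 by (simp add: g_def)
  moreover have "\<bar>\<Sum>b<8. \<xi> b * rough_class_sum Y N b d\<bar> \<le> (\<Sum>b<(8::nat). 1 * (1/32))"
  proof (intro order.trans[OF sum_abs] sum_mono)
    fix b :: nat assume "b \<in> {..<8}"
    moreover have "\<bar>real_of_int (\<xi> b)\<bar> \<le> 1" using char8_abs[OF \<xi>, of b] by simp
    ultimately show "\<bar>\<xi> b * rough_class_sum Y N b d\<bar> \<le> 1 * (1/32)"
      using good unfolding abs_mult good_modulus_def by (intro mult_mono) auto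
  qed
  moreover have "\<bar>\<Sum>n\<in>?W. g n / n\<bar> \<le> (1 + ln (real N)) / real Y"
  proof -
    have "\<bar>\<Sum>n\<in>?W. g n / n\<bar> \<le> (\<Sum>n\<in>?W. 1 / real n)"
      by (intro order.trans[OF sum_abs] sum_mono) (auto simp: abs_divide intro: divide_right_mono g1)
    also have "\<dots> \<le> (1 + ln (real N)) / real Y"
      by (rule sum_rough_nonsquarefree_le) (use Y N in auto)
    finally show ?thesis .
  qed
  ultimately show ?thesis by simp
qed

text \<open>Extended over all integers from 2 to \<open>Y\<close>, the product telescopes. Such a
  crude power of \<open>Y\<close> is affordable because the tail saving beats every power of
  \<open>ln Z\<close>.\<close>

lemma prod_primes_upto_le:
  assumes "Y \<ge> 2"
  shows "(\<Prod>p\<in>primes_upto Y. 1 + 1 / real p) \<le> real Y"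
proof -
  have "(\<Prod>p\<in>primes_upto Y. 1 + 1 / real p) \<le> (\<Prod>n=2..Y. 1 + 1 / real n)"
    by (rule prod_mono2) (auto simp: primes_upto_def prime_ge_2_nat)
  also have "\<dots> = (real Y + 1) / 2"
    using assms
  proof (induction Y rule: dec_induct)
    case (step Y)
    then show ?case by (simp add: field_simps)
  qed simp
  also have "\<dots> \<le> real Y" using assms by simp
  finally show ?thesis .
qed

text \<open>The exponent \<open>1 / ln Y\<close> is chosen so that its power of any
  \<open>p \<le> Y\<close> is at most \<open>exp 1 \<le> 3\<close>; Bernoulli's inequality turns
  this 3 into a cube.\<close>

lemma prod_rankin_le:
  assumes "Y \<ge> 3"
  shows "(\<Prod>p\<in>primes_upto Y. 1 + real p powr (1 / ln (real Y) - 1)) \<le> real Y ^ 3"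
proof -
  have lnY: "ln (real Y) > 0" using assms by simp
  have "(\<Prod>p\<in>primes_upto Y. 1 + real p powr (1 / ln (real Y) - 1)) \<le> (\<Prod>p\<in>primes_upto Y. (1 + 1 / real p) ^ 3)"
  proof (intro prod_mono conjI)
    fix p assume "p \<in> primes_upto Y"
    then have p: "real p \<ge> 2" "p \<le> Y" using prime_ge_2_nat[of p] by (auto simp: primes_upto_def)
    have "real p powr (1 / ln (real Y)) \<le> real Y powr (1 / ln (real Y))"
      using p lnY by (intro powr_mono2) auto
    also have "\<dots> = exp 1" using assms lnY by (simp add: powr_def)
    also have "\<dots> \<le> 3" by (rule exp_le)
    finally have "real p powr (1 / ln (real Y) - 1) \<le> 3 / real p"
      using p by (simp add: powr_diff divide_right_mono)
    moreover have "1 + 3 * (1 / real p) \<le> (1 + 1 / real p) ^ 3"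
      using Bernoulli_inequality[of "1 / real p" 3] order.trans[of "-1" 0 "1 / real p"] by simp
    ultimately show "1 + real p powr (1 / ln (real Y) - 1) \<le> (1 + 1 / real p) ^ 3" by simp
  qed (simp add: add_nonneg_nonneg)
  also have "\<dots> = (\<Prod>p\<in>primes_upto Y. 1 + 1 / real p) ^ 3" by (rule prod_power_distrib[symmetric])
  also have "\<dots> \<le> real Y ^ 3"
    using assms by (intro power_mono prod_primes_upto_le prod_nonneg) (auto intro: add_nonneg_nonneg)
  finally show ?thesis .
qed

text \<open>The sieved series differs from 1 by at most \<open>1/4 + 1/8 + 1/8\<close>: the class
  sums, the nonsquarefree \<open>n\<close> by \<open>c1\<close>, and the \<open>n\<close> beyond
  \<open>N\<close> by \<open>c2\<close>.\<close>

lemma good_modulus_L: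
  assumes \<xi>: "char8 \<xi>" and d: "odd d" "squarefree d" "d > 1" and good: "good_modulus Y N d"
    and Y: "Y \<ge> 3" and N: "N \<ge> 1" and c1: "(1 + ln (real N)) / real Y \<le> 1/8"
    and c2: "(128 * real d powr (2/3) / (real N + 1)) powr (1 / ln (real Y)) * (129 + ln (real d)) * real Y ^ 3 \<le> 1/8"
  defines "g \<equiv> \<lambda>n. real_of_int (\<xi> n * jac (int n) d)"
  obtains L where "hsum g {} \<longlonglongrightarrow> L" "L * (\<Prod>p\<in>primes_upto Y. 1 - g p / p) \<ge> 1/2"
proof -
  have Yr: "real Y \<ge> 3" using Y by simp
  have "exp 1 \<le> real Y" using exp_le Yr by linarith
  then have lnY: "ln (real Y) \<ge> 1" using Yr by (subst ln_ge_iff) auto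
  have pr: "prime q" if "q \<in> primes_upto Y" for q using that by (simp add: primes_upto_def)
  obtain L where L: "hsum g {} \<longlonglongrightarrow> L"
    "\<And>x. \<bar>L * (\<Prod>p\<in>primes_upto Y. 1 - g p / p) - hsum g (primes_upto Y) x\<bar> \<le>
       (128 * real d powr (2/3) / (real x + 1)) powr (1 / ln (real Y)) * (129 + ln (real d)) *
       (\<Prod>p\<in>primes_upto Y. 1 + real p powr (1 / ln (real Y) - 1))"
    using char8_jac_tail[OF \<xi> d finite_primes_upto, of Y "1 / ln (real Y)"] lnY pr unfolding g_def
    by (auto simp: field_simps)
  note L(2)[of N]
  also have "(128 * real d powr (2/3) / (real N + 1)) powr (1 / ln (real Y)) * (129 + ln (real d)) *
       (\<Prod>p\<in>primes_upto Y. 1 + real p powr (1 / ln (real Y) - 1)) \<le> 1/8"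
    by (rule order.trans[OF mult_left_mono[OF prod_rankin_le[OF Y]] c2]) (use d in auto)
  finally have "\<bar>L * (\<Prod>p\<in>primes_upto Y. 1 - g p / p) - hsum g (primes_upto Y) N\<bar> \<le> 1/8" .
  moreover have "\<bar>hsum g (primes_upto Y) N - 1\<bar> \<le> 1/4 + (1 + ln (real N)) / real Y"
    unfolding g_def by (rule hsum_good_modulus[OF \<xi> d(1) good]) (use Y N in auto)
  ultimately have "L * (\<Prod>p\<in>primes_upto Y. 1 - g p / p) \<ge> 1/2" using c1 by linarith
  then show ?thesis using that L(1) by blast
qed

section \<open>Classification of the quadratic characters\<close>

definition realchar :: "nat \<Rightarrow> (nat \<Rightarrow> int) \<Rightarrow> bool" where
  "realchar q f \<longleftrightarrow> q > 0 \<and> (\<forall>n. f (n + q) = f n) \<and> (\<forall>m n. f (m * n) = f m * f n) \<and>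
     (\<forall>n. f n \<in> {-1, 0, 1}) \<and> (\<forall>n. f n = 0 \<longleftrightarrow> \<not> coprime n q)"

lemma realchar_mod:
  assumes "realchar q f"
  shows "f (n mod q) = f n"
proof -
  have step: "f (m + q) = f m" for m using assms by (simp add: realchar_def)
  have "f (m + q * k) = f m" for m k
  proof (induction k)
    case (Suc k)
    have "m + q * Suc k = m + q * k + q" by simp
    then show ?case using step[of "m + q * k"] Suc by (simp only:)
  qed simp
  from this[of "n mod q" "n div q"] show ?thesis by simp
qed

lemma realchar_cong: "realchar q f \<Longrightarrow> [m = n] (mod q) \<Longrightarrow> f m = f n"
  by (metis cong_def realchar_mod)

lemma abs_realchar_le_1: "realchar q f \<Longrightarrow> \<bar>f n\<bar> \<le> 1"
proof -
  assume "realchar q f"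
  then have "f n \<in> {-1, 0, 1}" unfolding realchar_def by blast
  then show ?thesis by auto
qed

lemma realchar_square:
  assumes "realchar q f" "coprime n q"
  shows "f n * f n = 1"
proof -
  have "f n \<noteq> 0" "f n \<in> {-1, 0, 1}" using assms by (auto simp: realchar_def)
  then show ?thesis by auto
qed

lemma quadratic_character_realchar:
  assumes "\<psi> \<in> quadratic_characters q"
  obtains f where "realchar q f" "\<psi> = (\<lambda>n. of_int (f n))"
proof -
  define f where "f n = (if \<psi> n = 1 then 1 else if \<psi> n = -1 then -1 else 0 :: int)" for n
  have \<psi>: "q > 0" "\<psi> (n + q) = \<psi> n" "\<psi> (m * n) = \<psi> m * \<psi> n" "\<psi> n \<noteq> 0 \<longleftrightarrow> coprime n q" for m n
    using assms by (auto simp: quadratic_characters_def dirichlet_character_def)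
  have sq: "\<psi> n ^ 2 = (if coprime n q then 1 else 0)" for n
    using assms by (auto simp: quadratic_characters_def principal_character_def dest: fun_cong[of _ _ n])
  have v: "\<psi> n = 1 \<or> \<psi> n = -1" if "coprime n q" for n
    using sq[of n] that power2_eq_1_iff by auto
  have e: "\<psi> n = of_int (f n)" for n
    using v[of n] \<psi>(4)[of n] by (auto simp: f_def)
  have "realchar q f"
    unfolding realchar_def
  proof (intro conjI allI)
    fix m n
    have "(of_int (f (m * n)) :: complex) = of_int (f m * f n)" using \<psi>(3)[of m n] by (simp add: e)
    then show "f (m * n) = f m * f n" by (simp only: of_int_eq_iff)
    have "(of_int (f (n + q)) :: complex) = of_int (f n)" using \<psi>(2)[of n] by (simp add: e)
    then show "f (n + q) = f n" by (simp only: of_int_eq_iff)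
    show "f n = 0 \<longleftrightarrow> \<not> coprime n q" using \<psi>(4)[of n] e[of n] by auto
    show "f n \<in> {-1, 0, 1}" by (simp add: f_def)
  qed (rule \<psi>(1))
  then show ?thesis using that e by blast
qed

text \<open>A real character modulo \<open>p r\<close> is trivial on the squares in the kernel of the reduction
  modulo \<open>r\<close>, so on this kernel it is a power of the Legendre symbol.\<close>
lemma realchar_split_prime:
  assumes f: "realchar (p * r) f" and p: "prime p" "2 < p" and pr: "coprime p r"
  obtains g e where "realchar r g"
    "\<And>n. coprime n (p * r) \<Longrightarrow> f n = g n * (if e then Legendre (int n) (int p) else 1)"
proof -
  have r0: "r > 0" using f by (auto simp: realchar_def intro: Nat.gr0I)
  have "\<exists>x. [x = a] (mod p) \<and> [x = b] (mod r)" for a b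
    using binary_chinese_remainder_nat[OF pr] by blast
  then obtain crt where crt: "\<And>a b. [crt a b = a] (mod p)" "\<And>a b. [crt a b = b] (mod r)" by metis
  have feq: "f a = f b" if "[a = b] (mod p)" "[a = b] (mod r)" for a b
    using realchar_cong[OF f coprime_cong_mult_nat[OF that pr]] .
  have mult: "f (a * b) = f a * f b" for a b using f by (simp add: realchar_def)
  have val: "f a = 1 \<or> f a = -1" if "coprime a (p * r)" for a using f that by (auto simp: realchar_def)
  have zero: "f a = 0 \<longleftrightarrow> \<not> coprime a (p * r)" for a using f by (auto simp: realchar_def)
  have cop_crt: "coprime (crt a b) (p * r) \<longleftrightarrow> coprime a p \<and> coprime b r" for a b
  proof -
    have "coprime (crt a b) p \<longleftrightarrow> coprime a p" using crt(1)[of a b] cong_imp_coprime cong_sym by blast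
    moreover have "coprime (crt a b) r \<longleftrightarrow> coprime b r" using crt(2)[of a b] cong_imp_coprime cong_sym by blast
    ultimately show ?thesis by simp
  qed
  \<comment> \<open>The component of \<open>f\<close> modulo \<open>r\<close>: the argument is made
    1 modulo \<open>p\<close>.\<close>
  define g where "g n = f (crt 1 n)" for n
  have g: "realchar r g" unfolding realchar_def
  proof (intro conjI allI)
    fix m n
    show "g (n + r) = g n" unfolding g_def
    proof (rule feq)
      show "[crt 1 (n + r) = crt 1 n] (mod p)" using crt(1) cong_sym cong_trans by blast
      have "[n + r = n] (mod r)" by (simp add: cong_def)
      then show "[crt 1 (n + r) = crt 1 n] (mod r)" using crt(2) cong_sym cong_trans by meson
    qed
    show "g (m * n) = g m * g n" unfolding g_def mult[symmetric]
    proof (rule feq)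
      have "[crt 1 m * crt 1 n = 1 * 1] (mod p)" by (intro cong_mult crt)
      then show "[crt 1 (m * n) = crt 1 m * crt 1 n] (mod p)" using cong_trans[OF crt(1)[of 1 "m * n"] cong_sym] by simp
      have "[crt 1 m * crt 1 n = m * n] (mod r)" by (intro cong_mult crt)
      then show "[crt 1 (m * n) = crt 1 m * crt 1 n] (mod r)" using crt(2)[of 1 "m * n"] cong_sym cong_trans by blast
    qed
    show "g n \<in> {-1, 0, 1}" unfolding g_def using f unfolding realchar_def by blast
    show "g n = 0 \<longleftrightarrow> \<not> coprime n r" by (simp add: g_def zero cop_crt del: coprime_mult_right_iff)
  qed (rule r0)
  \<comment> \<open>Such a \<open>u\<close> is congruent to the square of a unit modulo
    \<open>p * r\<close>, namely of the number that is a square root of \<open>u\<close> modulo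
    \<open>p\<close> and 1 modulo \<open>r\<close>.\<close>
  have L1: "f u = 1" if u: "[u = 1] (mod r)" "Legendre (int u) (int p) = 1" for u
  proof -
    have "QuadRes (int p) (int u)" using u(2) by (auto simp: Legendre_def split: if_splits)
    then obtain y where y: "[y\<^sup>2 = int u] (mod int p)" by (auto simp: QuadRes_def)
    define w where "w = nat (y mod int p)"
    have w: "int w = y mod int p" using p by (simp add: w_def)
    have "[int (w\<^sup>2) = int u] (mod int p)" using y by (simp add: w cong_def power_mod)
    then have w2: "[w\<^sup>2 = u] (mod p)" by (simp only: cong_int_iff)
    let ?v = "crt w 1"
    have "[?v * ?v = w * w] (mod p)" by (intro cong_mult crt)
    then have 1: "[?v * ?v = u] (mod p)" using w2 cong_trans by (simp only: power2_eq_square) blast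
    have "[?v * ?v = 1 * 1] (mod r)" by (intro cong_mult crt)
    then have 2: "[?v * ?v = u] (mod r)" using cong_trans[OF _ cong_sym[OF u(1)]] by simp
    have "f u = f ?v * f ?v" using feq[OF 1 2] mult by simp
    moreover have "coprime ?v (p * r)"
    proof -
      have "\<not> int p dvd int u" using u(2) Legendre_eq_0_iff[of "int u" "int p"] by auto
      then have "\<not> p dvd u" by simp
      then have "\<not> p dvd w" using cong_dvd_iff[OF w2] by (auto simp: power2_eq_square)
      then have "coprime w p" using p(1) prime_imp_coprime coprime_commute by blast
      then show ?thesis unfolding cop_crt by simp
    qed
    ultimately show ?thesis using realchar_square[OF f] by simp
  qed
  obtain g0 where "Legendre g0 (int p) = -1" using ex_nonresidue[OF p] by blast
  \<comment> \<open>A nonresidue modulo \<open>p\<close> that is 1 modulo \<open>r\<close>. The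
    value \<open>f t\<close> decides whether the Legendre symbol occurs in \<open>f\<close>: every
    nonresidue times \<open>t\<close> is a residue.\<close>
  define t where "t = crt (nat (g0 mod int p)) 1"
  have "int (nat (g0 mod int p)) = g0 mod int p" using p by simp
  moreover have "Legendre (int t) (int p) = Legendre (int (nat (g0 mod int p))) (int p)"
    unfolding t_def by (rule Legendre_cong) (simp only: cong_int_iff crt)
  ultimately have Lt: "Legendre (int t) (int p) = -1" using \<open>Legendre g0 (int p) = -1\<close> by simp
  have tr: "[t = 1] (mod r)" by (simp add: t_def crt)
  have LL: "f u = (if f t = -1 then Legendre (int u) (int p) else 1)"
    if u: "[u = 1] (mod r)" "coprime u p" for u
  proof -
    have "\<not> p dvd u" using u(2) p(1) by (metis coprime_absorb_right not_prime_unit)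
    then have "Legendre (int u) (int p) \<noteq> 0" by (simp add: Legendre_eq_0_iff)
    then consider "Legendre (int u) (int p) = 1" | "Legendre (int u) (int p) = -1"
      using Legendre_values[of "int u" "int p"] by auto
    then show ?thesis
    proof cases
      case 2
      have "[u * t = 1 * 1] (mod r)" by (intro cong_mult u tr)
      moreover have "Legendre (int (u * t)) (int p) = 1" using 2 Lt by (simp add: Legendre_mult[OF p])
      ultimately have "f u * f t = 1" using L1[of "u * t"] mult by simp
      then have "f u = f t" "f t = 1 \<or> f t = -1" by (auto simp: zmult_eq_1_iff)
      then show ?thesis using 2 by auto
    qed (use L1[OF u(1)] in simp)
  qed
  have "f n = g n * (if f t = -1 then Legendre (int n) (int p) else 1)" if n: "coprime n (p * r)" for n
  proof -
    \<comment> \<open>Modulo \<open>p * r\<close>, \<open>n\<close> is the product of its parts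
      \<open>(1, n)\<close> and \<open>(n, 1)\<close>; the second one lies in the kernel treated by
      \<open>LL\<close>.\<close>
    let ?u = "crt n 1"
    have "[crt 1 n * ?u = 1 * n] (mod p)" "[crt 1 n * ?u = n * 1] (mod r)" by (intro cong_mult crt)+
    then have "f n = f (crt 1 n * ?u)" by (intro feq) (simp_all add: cong_sym)
    also have "\<dots> = g n * f ?u" by (simp add: mult g_def)
    also have "coprime ?u p" using n cop_crt[of n 1] by simp
    then have "f ?u = (if f t = -1 then Legendre (int ?u) (int p) else 1)" by (rule LL[OF crt(2)])
    also have "Legendre (int ?u) (int p) = Legendre (int n) (int p)"
      by (rule Legendre_cong) (simp only: cong_int_iff crt)
    finally show ?thesis .
  qed
  then show ?thesis using that[OF g] by blast
qed

text \<open>The primes of \<open>m\<close> are split off one at a time; \<open>d\<close> collects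
  those at which the Legendre symbol occurs.\<close>

lemma realchar_factor:
  assumes "odd m" "squarefree m" "realchar (r * m) f" "coprime r m"
  shows "\<exists>\<xi> d. realchar r \<xi> \<and> d dvd m \<and> (\<forall>n. coprime n (r * m) \<longrightarrow> f n = \<xi> n * jac (int n) d)"
  using assms
proof (induction m arbitrary: f rule: odd_squarefree_induct)
  case one
  then show ?case by (intro exI[of _ f] exI[of _ 1]) simp
next
  case (prime p m)
  have m0: "m > 0" using prime.hyps by (simp add: odd_pos)
  have "coprime p (r * m)" "coprime r m" using prime by (auto simp: coprime_commute)
  moreover have "realchar (p * (r * m)) f" using prime.prems(1) by (simp add: mult_ac)
  ultimately obtain g e where g: "realchar (r * m) g"
    "\<And>n. coprime n (p * (r * m)) \<Longrightarrow> f n = g n * (if e then Legendre (int n) (int p) else 1)"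
    using realchar_split_prime[of p "r * m" f] prime.hyps by metis
  from prime.IH[OF g(1) \<open>coprime r m\<close>] obtain \<xi> d where
    xd: "realchar r \<xi>" "d dvd m" "\<And>n. coprime n (r * m) \<Longrightarrow> g n = \<xi> n * jac (int n) d" by blast
  have d0: "d > 0" using xd(2) m0 by (auto intro: Nat.gr0I)
  have "coprime p d" using xd(2) prime.hyps(5) coprime_divisors[of p p d m] by simp
  then have pd: "jac a (p * d) = Legendre a (int p) * jac a d" for a
    using prime.hyps(1) d0 by (simp add: jac_coprime_mult jac_prime prime_gt_0_nat)
  show ?case
  proof (intro exI conjI allI impI)
    show "realchar r \<xi>" by (rule xd(1))
    show "(if e then p * d else d) dvd p * m" using xd(2) by auto
    fix n assume "coprime n (r * (p * m))"
    then have "coprime n (p * (r * m))" "coprime n (r * m)" by auto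
    then show "f n = \<xi> n * jac (int n) (if e then p * d else d)"
      using g(2)[of n] xd(3)[of n] by (auto simp: pd)
  qed
qed

lemma coprime_odd_two_power: "r \<in> {1, 4, 8} \<Longrightarrow> odd n \<Longrightarrow> coprime n (r::nat)"
  using coprime_power_right_iff[of n 2 2] coprime_power_right_iff[of n 2 3]
  by (auto simp: coprime_right_2_iff_odd)

text \<open>For \<open>r = 1\<close> the component modulo \<open>r\<close> equals 1 even at even
  numbers, where \<open>char8\<close> demands 0. It is therefore cut off there, and the
  factorization is claimed at odd \<open>n\<close>.\<close>

lemma quadratic_character_factor:
  assumes \<psi>: "\<psi> \<in> quadratic_characters (r * m)" and m: "odd m" "squarefree m" and r: "r \<in> {1, 4, 8}"
  obtains f \<xi> d where "realchar (r * m) f" "\<psi> = (\<lambda>n. of_int (f n))" "char8 \<xi>" "d dvd m"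
    "\<And>n. odd n \<Longrightarrow> coprime n (r * m) \<Longrightarrow> f n = \<xi> n * jac (int n) d"
proof -
  obtain f where f: "realchar (r * m) f" "\<psi> = (\<lambda>n. of_int (f n))"
    by (rule quadratic_character_realchar[OF \<psi>])
  have "coprime r m" using coprime_odd_two_power[OF r m(1)] by (simp add: coprime_commute)
  from realchar_factor[OF m f(1) this] obtain \<xi> d where
    x: "realchar r \<xi>" "d dvd m" "\<And>n. coprime n (r * m) \<Longrightarrow> f n = \<xi> n * jac (int n) d" by blast
  define \<xi>' where "\<xi>' n = (if odd n then \<xi> n else 0)" for n
  have "char8 \<xi>'" unfolding char8_def
  proof (intro conjI allI)
    fix m n
    have "r dvd 8" using r by auto
    then have "[n + 8 = n] (mod r)" by (simp add: cong_def mod_add_right_eq[symmetric] dvd_eq_mod_eq_0)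
    then show "\<xi>' (n + 8) = \<xi>' n" using realchar_cong[OF x(1)] by (auto simp: \<xi>'_def)
    show "\<xi>' (m * n) = \<xi>' m * \<xi>' n" "\<xi>' n \<in> {-1, 0, 1}" using x(1) by (auto simp: \<xi>'_def realchar_def)
    have "odd n \<Longrightarrow> coprime n r" by (rule coprime_odd_two_power[OF r])
    then show "\<xi>' n = 0 \<longleftrightarrow> even n" using x(1) by (auto simp: \<xi>'_def realchar_def)
  qed
  then show ?thesis using that[OF f _ x(2)] x(3) by (simp add: \<xi>'_def)
qed

lemma finite_char8: "finite {\<xi>. char8 \<xi>}"
proof (rule finite_subset)
  show "{\<xi>. char8 \<xi>} \<subseteq> (\<lambda>h n. h (n mod 8)) ` ({..<8} \<rightarrow>\<^sub>E {-1, 0, 1})"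
  proof
    fix \<xi> assume "\<xi> \<in> {\<xi>. char8 \<xi>}"
    then have x: "char8 \<xi>" by simp
    then have "\<xi> = (\<lambda>n. restrict \<xi> {..<8} (n mod 8))" by (auto simp: char8_mod)
    moreover have "restrict \<xi> {..<8} \<in> {..<8} \<rightarrow>\<^sub>E {-1, 0, 1}" using x by (auto simp: char8_def)
    ultimately show "\<xi> \<in> (\<lambda>h n. h (n mod 8)) ` ({..<8} \<rightarrow>\<^sub>E {-1, 0, 1})" by (rule image_eqI)
  qed
  show "finite ((\<lambda>h n. h (n mod 8)) ` ({..<8::nat} \<rightarrow>\<^sub>E {-1, 0, 1::int}))"
    by (intro finite_imageI finite_PiE) auto
qed

section \<open>L-values of quadratic characters\<close>

text \<open>Multiplying the residues by \<open>a\<close> negates the sum over a period, which is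
  therefore 0, so less than one period matters. The extra 1 accounts for the term at 0.\<close>

lemma realchar_sum_bounded:
  assumes f: "realchar q f" and a: "f a = -1"
  shows "\<bar>\<Sum>n=1..x. real_of_int (f n)\<bar> \<le> real q + 1"
proof -
  have q0: "q > 0" using f by (simp add: realchar_def)
  have f1: "\<bar>f n\<bar> \<le> 1" for n by (rule abs_realchar_le_1[OF f])
  define F where "F i = f (nat (i mod int q))" for i
  have Fn: "F (int n) = f n" for n
    by (simp add: F_def nat_mod_distrib realchar_mod[OF f])
  have "f a \<noteq> 0" using a by simp
  then have "coprime a q" using f unfolding realchar_def by blast
  then have "(\<Sum>i=0..<int q. F (int a * i + 0)) = (\<Sum>i=0..<int q. F i)"
    using q0 by (intro sum_affine_residues) (auto simp: F_def)
  moreover have "(\<Sum>i=0..<int q. F (int a * i + 0)) = (\<Sum>i=0..<int q. - F i)"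
  proof (rule sum.cong[OF refl])
    fix i assume "i \<in> {0..<int q}"
    then obtain n where i: "i = int n" by (metis atLeastLessThan_iff nonneg_int_cases)
    have "F (int a * i + 0) = f (a * n)" using Fn[of "a * n"] by (simp add: i)
    then show "F (int a * i + 0) = - F i" using f a by (simp add: i Fn realchar_def)
  qed
  ultimately have "(\<Sum>i=0..<int q. F i) = 0" by (simp add: sum_negf)
  also have "(\<Sum>i=0..<int q. F i) = (\<Sum>n<q. f n)"
    by (rule sum.reindex_bij_witness[of _ int nat]) (auto simp: Fn[symmetric])
  finally have zero: "(\<Sum>n<q. f n) = 0" .
  have per: "(\<Sum>n<q + x. f n) = (\<Sum>n<x. f n)" for x
  proof (induction x)
    case (Suc x)
    have "f (x + q) = f x" using f by (simp add: realchar_def)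
    then have "f (q + x) = f x" by (simp only: add.commute)
    then show ?case using Suc by simp
  qed (simp add: zero)
  have bd: "\<bar>\<Sum>n<x. f n\<bar> \<le> int q" for x
  proof (induction x rule: less_induct)
    case (less x)
    show ?case
    proof (cases "x < q")
      case True
      have "\<bar>\<Sum>n<x. f n\<bar> \<le> (\<Sum>n<x. 1)"
        by (intro order.trans[OF sum_abs] sum_mono f1)
      then show ?thesis using True by simp
    next
      case False
      then show ?thesis using less[of "x - q"] per[of "x - q"] q0 by simp
    qed
  qed
  have "{..<Suc x} = insert 0 {1..x}" by auto
  then have "(\<Sum>n<Suc x. f n) = f 0 + (\<Sum>n=1..x. f n)" by (simp only:) simp
  then have "\<bar>\<Sum>n=1..x. f n\<bar> \<le> int q + 1" using bd[of "Suc x"] f1[of 0] by linarith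
  then have "real_of_int \<bar>\<Sum>n=1..x. f n\<bar> \<le> real_of_int (int q + 1)" by (simp only: of_int_le_iff)
  then show ?thesis by simp
qed

text \<open>A nonprincipal real character takes the value -1, which bounds its partial sums. The
  limit is real, so \<open>Re\<close> in the theorem is the L-value itself.\<close>

lemma quadratic_character_L:
  assumes \<psi>: "\<psi> \<in> quadratic_characters q" and f: "realchar q f" "\<psi> = (\<lambda>n. of_int (f n))"
  obtains L where "hsum (\<lambda>n. real_of_int (f n)) {} \<longlonglongrightarrow> L" "dirichlet_L 1 \<psi> = of_real L"
proof -
  have "\<psi> \<noteq> principal_character q" using \<psi> by (simp add: quadratic_characters_def)
  then obtain a where "\<psi> a \<noteq> principal_character q a" by blast
  moreover have "f a \<in> {-1, 0, 1}" "f a = 0 \<longleftrightarrow> \<not> coprime a q" using f unfolding realchar_def by blast+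
  ultimately have "f a = -1" by (auto simp: f(2) principal_character_def split: if_splits)
  from realchar_sum_bounded[OF f(1) this]
  obtain L where L: "hsum (\<lambda>n. real_of_int (f n)) {} \<longlonglongrightarrow> L"
    using bounded_sums_imp_hsum_convergent[of "\<lambda>n. real_of_int (f n)" "real q + 1"] by blast
  have "(\<Sum>n<N. \<psi> (Suc n) / of_nat (Suc n) powr 1) = complex_of_real (hsum (\<lambda>n. real_of_int (f n)) {} N)" for N
  proof -
    have "(\<Sum>n<N. \<psi> (Suc n) / of_nat (Suc n) powr 1) = (\<Sum>n=1..N. of_int (f n) / of_nat n)"
      by (rule sum.reindex_bij_witness[of _ "\<lambda>n. n - 1" Suc]) (auto simp: f(2) simp del: of_nat_Suc)
    then show ?thesis by (simp add: hsum_empty)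
  qed
  moreover have "(\<lambda>N. complex_of_real (hsum (\<lambda>n. real_of_int (f n)) {} N)) \<longlonglongrightarrow> of_real L"
    by (intro tendsto_of_real L)
  ultimately have "(\<lambda>n. \<psi> (Suc n) / of_nat (Suc n) powr 1) sums of_real L" by (simp add: sums_def)
  then show ?thesis using that L by (simp add: dirichlet_L_def sums_iff)
qed

section \<open>Counting quadratic characters\<close>

lemma coprime_add_modulus: "coprime (n + q) q \<longleftrightarrow> coprime n (q :: nat)"
  by (simp only: coprime_iff_gcd_eq_1 gcd_add1)

text \<open>A character can be recovered from \<open>d\<close> and \<open>\<xi>\<close>, so each
  exceptional \<open>d\<close> accounts for boundedly many characters. Taking all divisors for
  \<open>D\<close> and an unsatisfiable \<open>P\<close> also yields the finiteness of the set of
  characters.\<close>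

lemma quadratic_exceptional_card:
  assumes m: "odd m" "squarefree m" and r: "r \<in> {1, 4, 8}" and D: "finite D"
    and P: "\<And>\<psi> f \<xi> d. \<psi> \<in> quadratic_characters (r * m) \<Longrightarrow> realchar (r * m) f \<Longrightarrow> \<psi> = (\<lambda>n. of_int (f n)) \<Longrightarrow>
      char8 \<xi> \<Longrightarrow> d dvd m \<Longrightarrow> (\<And>n. odd n \<Longrightarrow> coprime n (r * m) \<Longrightarrow> f n = \<xi> n * jac (int n) d) \<Longrightarrow>
      d \<notin> D \<Longrightarrow> P \<psi>"
  shows "finite {\<psi> \<in> quadratic_characters (r * m). \<not> P \<psi>}"
    "card {\<psi> \<in> quadratic_characters (r * m). \<not> P \<psi>} \<le> card D * card {\<xi>. char8 \<xi>}"
proof -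
  let ?q = "r * m"
  let ?E = "{\<psi> \<in> quadratic_characters ?q. \<not> P \<psi>}"
  \<comment> \<open>The factorization is known at odd arguments. An even \<open>n\<close> coprime to
    \<open>?q\<close> forces \<open>?q\<close> to be odd, and then \<open>n + ?q\<close> is an odd
    representative of its class.\<close>
  define \<Phi> where "\<Phi> = (\<lambda>(d, \<xi>) n. if coprime n ?q
      then (of_int (\<xi> (if odd n then n else n + ?q) * jac (int (if odd n then n else n + ?q)) d) :: complex) else 0)"
  have sub: "?E \<subseteq> \<Phi> ` (D \<times> {\<xi>. char8 \<xi>})"
  proof
    fix \<psi> assume \<psi>: "\<psi> \<in> ?E"
    then obtain f \<xi> d where *: "realchar ?q f" "\<psi> = (\<lambda>n. of_int (f n))" "char8 \<xi>" "d dvd m"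
      "\<And>n. odd n \<Longrightarrow> coprime n ?q \<Longrightarrow> f n = \<xi> n * jac (int n) d"
      using quadratic_character_factor[OF _ m r] by blast
    have "d \<in> D" using P[OF _ * ] \<psi> by blast
    moreover have "\<psi> = \<Phi> (d, \<xi>)"
    proof
      fix n
      show "\<psi> n = \<Phi> (d, \<xi>) n"
      proof (cases "coprime n ?q")
        case False
        then have "f n = 0" using *(1) unfolding realchar_def by blast
        then show ?thesis using False by (simp add: \<Phi>_def *(2) del: coprime_mult_right_iff)
      next
        case True
        let ?n = "if odd n then n else n + ?q"
        have "odd ?n"
        proof (cases "odd n")
          case False
          then have "odd ?q" using coprime_common_divisor[OF True, of 2] by auto
          then show ?thesis using False by simp
        qed simp
        moreover have "coprime ?n ?q" using True coprime_add_modulus[of n ?q] by (auto simp del: coprime_mult_right_iff)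
        moreover have "f ?n = f n" using *(1) by (simp add: realchar_def)
        ultimately have "f n = \<xi> ?n * jac (int ?n) d" using *(5)[of ?n] by simp
        then show ?thesis using True by (simp add: \<Phi>_def *(2))
      qed
    qed
    ultimately show "\<psi> \<in> \<Phi> ` (D \<times> {\<xi>. char8 \<xi>})" using *(3) by blast
  qed
  have fin: "finite (D \<times> {\<xi>. char8 \<xi>})" using D finite_char8 by simp
  then show "finite ?E" using sub finite_subset by blast
  have "card ?E \<le> card (\<Phi> ` (D \<times> {\<xi>. char8 \<xi>}))" using sub fin by (intro card_mono) auto
  also have "\<dots> \<le> card (D \<times> {\<xi>. char8 \<xi>})" by (rule card_image_le[OF fin])
  finally show "card ?E \<le> card D * card {\<xi>. char8 \<xi>}" by (simp add: card_cartesian_product)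
qed

lemma finite_quadratic_characters:
  assumes "odd m" "squarefree m" "r \<in> {1, 4, 8}"
  shows "finite (quadratic_characters (r * m))"
proof -
  have "m > 0" using assms(1) by (simp add: odd_pos)
  then have "finite {d. d dvd m}" by (rule finite_divisors_nat)
  from quadratic_exceptional_card(1)[OF assms this, of "\<lambda>_. False"] show ?thesis by simp
qed

text \<open>Each nonempty set of primes of \<open>m\<close> gives a product of Legendre symbols. The
  numbers that are a nonresidue at one prime and 1 at the others show that these products are
  nonprincipal and distinct.\<close>

lemma quadratic_characters_card_ge:
  assumes m: "odd m" "squarefree m" and r: "r \<in> {1, 4, 8}"
  shows "2 ^ card (prime_factors m) - 1 \<le> card (quadratic_characters (r * m))"
proof -
  let ?q = "r * m" and ?P = "prime_factors m"
  have m0: "m > 0" using m(1) by (simp add: odd_pos)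
  have q0: "?q > 0" using m0 r by auto
  have pP: "prime p" "2 < p" "p dvd ?q" if "p \<in> ?P" for p
  proof -
    show "prime p" "p dvd ?q" using that by (auto simp: in_prime_factors_iff)
    have "odd p" using that m(1) by (auto simp: in_prime_factors_iff)
    then show "2 < p" using prime_ge_2_nat[OF \<open>prime p\<close>] by (cases "p = 2") auto
  qed
  define X where "X T n = (if coprime n ?q then of_int (\<Prod>p\<in>T. Legendre (int n) (int p)) else 0 :: complex)" for T n
  have sep: "\<exists>n. coprime n ?q \<and> Legendre (int n) (int p) = -1 \<and> (\<forall>s\<in>?P - {p}. Legendre (int n) (int s) = 1)"
    if p: "p \<in> ?P" for p
  proof -
    obtain l where l: "m = p * l" using p by (auto simp: in_prime_factors_iff)
    have "coprime p l" using m(2) pP(1)[OF p] unfolding l by (rule squarefree_prime_cofactor)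
    moreover have "coprime p r"
      using p m(1) by (intro coprime_odd_two_power[OF r]) (auto simp: in_prime_factors_iff)
    ultimately have cop: "coprime p (r * l)" by simp
    obtain g where g: "Legendre g (int p) = -1" using ex_nonresidue[OF pP(1,2)[OF p]] by blast
    obtain n where n: "[n = nat (g mod int p)] (mod p)" "[n = 1] (mod r * l)"
      using binary_chinese_remainder_nat[OF cop] by blast
    have "Legendre (int n) (int p) = Legendre (int (nat (g mod int p))) (int p)"
      by (rule Legendre_cong) (use n(1) in \<open>simp only: cong_int_iff\<close>)
    then have Ln: "Legendre (int n) (int p) = -1" using g pP(2)[OF p] by simp
    have "coprime n p"
    proof -
      have "\<not> p dvd n" using Ln Legendre_eq_0_iff[of "int n" "int p"] by auto
      then show ?thesis using pP(1)[OF p] prime_imp_coprime coprime_commute by blast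
    qed
    moreover have "coprime n (r * l)" using n(2) cong_imp_coprime[OF cong_sym] by fastforce
    ultimately have "coprime n ?q" unfolding l by simp
    moreover have "Legendre (int n) (int s) = 1" if s: "s \<in> ?P - {p}" for s
    proof -
      have "s dvd m" "prime s" using s by (auto simp: in_prime_factors_iff)
      moreover have "\<not> s dvd p" using s pP(1)[OF p] \<open>prime s\<close> primes_dvd_imp_eq by blast
      ultimately have "s dvd r * l" unfolding l by (simp add: prime_dvd_mult_iff)
      then have "[n = 1] (mod s)" using n(2) cong_dvd_modulus_nat by blast
      then have "[int n = int 1] (mod int s)" by (simp only: cong_int_iff)
      then have "Legendre (int n) (int s) = Legendre 1 (int s)" using Legendre_cong by fastforce
      also have "\<dots> = 1"
      proof -
        have "QuadRes (int s) 1" unfolding QuadRes_def by (rule exI[of _ 1]) simp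
        moreover have "\<not> [1 = 0] (mod int s)" using \<open>prime s\<close> by (auto simp: cong_0_iff zdvd1_eq)
        ultimately show ?thesis by (simp add: Legendre_def)
      qed
      finally show ?thesis .
    qed
    ultimately show ?thesis using Ln by blast
  qed
  have XP: "\<exists>n. coprime n ?q \<and> (\<forall>T\<subseteq>?P. X T n = (if p \<in> T then -1 else 1))" if p: "p \<in> ?P" for p
  proof -
    obtain n where n: "coprime n ?q" "Legendre (int n) (int p) = -1" "\<forall>s\<in>?P - {p}. Legendre (int n) (int s) = 1"
      using sep[OF p] by blast
    have "X T n = (if p \<in> T then -1 else 1)" if T: "T \<subseteq> ?P" for T
    proof -
      have fT: "finite T" using T finite_subset by blast
      have "(\<Prod>s\<in>T. Legendre (int n) (int s)) = (\<Prod>s\<in>T. if s = p then -1 else 1)"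
        using n T by (intro prod.cong) auto
      also have "\<dots> = (if p \<in> T then -1 else 1)" using fT by (simp add: prod.delta)
      finally show ?thesis using n(1) by (simp add: X_def)
    qed
    then show ?thesis using n(1) by blast
  qed
  have "X ` (Pow ?P - {{}}) \<subseteq> quadratic_characters ?q"
  proof
    fix \<psi> assume "\<psi> \<in> X ` (Pow ?P - {{}})"
    then obtain T where T: "T \<subseteq> ?P" "T \<noteq> {}" "\<psi> = X T" by auto
    have Lsq: "Legendre (int n) (int p) * Legendre (int n) (int p) = 1" if "coprime n ?q" "p \<in> T" for n p
    proof -
      have p: "prime p" "p dvd ?q" using that T pP by auto
      have "\<not> p dvd n" using that(1) p by (meson coprime_common_divisor not_prime_unit)
      then show ?thesis by (auto simp: Legendre_def cong_0_iff)
    qed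
    then have PiSq: "(\<Prod>p\<in>T. Legendre (int n) (int p)) * (\<Prod>p\<in>T. Legendre (int n) (int p)) = 1" if "coprime n ?q" for n
      unfolding prod.distrib[symmetric] using that by (intro prod.neutral) auto
    have sq: "(X T n) ^ 2 = principal_character ?q n" for n
    proof (cases "coprime n ?q")
      case True
      have "(X T n) ^ 2 = of_int ((\<Prod>p\<in>T. Legendre (int n) (int p)) * (\<Prod>p\<in>T. Legendre (int n) (int p)))"
        using True by (simp add: X_def power2_eq_square)
      then show ?thesis using True by (simp only: PiSq) (simp add: principal_character_def)
    qed (simp add: X_def principal_character_def del: coprime_mult_right_iff)
    have "dirichlet_character ?q (X T)"
      unfolding dirichlet_character_def
    proof (intro conjI allI)
      fix a b
      have "Legendre (int (a + ?q)) (int p) = Legendre (int a) (int p)" if "p \<in> T" for p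
      proof (rule Legendre_cong)
        have "p dvd ?q" using that T pP by auto
        then have "[a + ?q = a] (mod p)" by (simp add: cong_def mod_add_right_eq[symmetric] dvd_eq_mod_eq_0)
        then show "[int (a + ?q) = int a] (mod int p)" by (simp only: cong_int_iff)
      qed
      then have "(\<Prod>p\<in>T. Legendre (int (a + ?q)) (int p)) = (\<Prod>p\<in>T. Legendre (int a) (int p))"
        by (intro prod.cong refl)
      then show "X T (a + ?q) = X T a" unfolding X_def coprime_add_modulus by (simp only:)
      have "(\<Prod>p\<in>T. Legendre (int (a * b)) (int p)) = (\<Prod>p\<in>T. Legendre (int a) (int p)) * (\<Prod>p\<in>T. Legendre (int b) (int p))"
        unfolding prod.distrib[symmetric] using T pP
        by (intro prod.cong refl) (auto simp: Legendre_mult subset_iff)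
      then show "X T (a * b) = X T a * X T b" by (simp add: X_def del: of_int_prod)
      show "X T a \<noteq> 0 \<longleftrightarrow> coprime a ?q"
        using sq[of a] by (auto simp: principal_character_def X_def simp del: of_int_prod coprime_mult_right_iff split: if_splits)
    qed (rule q0)
    moreover have "X T \<noteq> principal_character ?q"
    proof
      assume eq: "X T = principal_character ?q"
      obtain p where p: "p \<in> T" using T(2) by blast
      then have "p \<in> ?P" using T(1) by blast
      from XP[OF this] obtain n where n: "coprime n ?q" "\<forall>T\<subseteq>?P. X T n = (if p \<in> T then -1 else 1)" by blast
      then have "coprime n ?q" "X T n = -1" using T(1) p by auto
      then show False unfolding eq by (simp add: principal_character_def)
    qed
    moreover have "(\<lambda>n. (X T n) ^ 2) = principal_character ?q" using sq by blast
    ultimately show "\<psi> \<in> quadratic_characters ?q" unfolding T(3) quadratic_characters_def by simp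
  qed
  then have "card (X ` (Pow ?P - {{}})) \<le> card (quadratic_characters ?q)"
    by (intro card_mono finite_quadratic_characters m r)
  moreover have "inj_on X (Pow ?P - {{}})"
  proof (rule inj_onI)
    fix T U assume TU: "T \<in> Pow ?P - {{}}" "U \<in> Pow ?P - {{}}" "X T = X U"
    have "p \<in> T \<longleftrightarrow> p \<in> U" if p: "p \<in> ?P" for p
    proof -
      obtain n where "\<forall>T\<subseteq>?P. X T n = (if p \<in> T then -1 else 1)" using XP[OF p] by blast
      then have "X T n = (if p \<in> T then -1 else 1)" "X U n = (if p \<in> U then -1 else 1)"
        using TU(1,2) by blast+
      then show ?thesis using TU(3) by (auto split: if_splits)
    qed
    then show "T = U" using TU(1,2) by auto
  qed
  moreover have "card (Pow ?P - {{}}) = 2 ^ card ?P - 1" by (simp add: card_Pow)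
  ultimately show ?thesis by (simp add: card_image)
qed

section \<open>Primes and prime factors\<close>

lemma prod_primes_dvd:
  assumes "finite P" "\<And>p. p \<in> P \<Longrightarrow> prime (p::nat)" "\<And>p. p \<in> P \<Longrightarrow> p dvd N"
  shows "\<Prod>P dvd N"
  using assms
proof (induction P rule: finite_induct)
  case (insert p P)
  have "\<not> p dvd q" if "q \<in> P" for q using that insert primes_dvd_imp_eq[of p q] by auto
  then have "coprime p q" if "q \<in> P" for q using that insert by (intro prime_imp_coprime) auto
  then have "coprime p (\<Prod>P)" by (intro prod_coprime_right)
  then show ?case using insert by (simp add: divides_mult)
qed simp

text \<open>Chebyshev's argument: with \<open>n = 2 ^ k\<close>, the primes between \<open>n\<close>
  and \<open>2 * n\<close> divide the central binomial coefficient, which is at most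
  \<open>2 ^ (2 * n)\<close>, and each of them exceeds \<open>2 ^ k\<close>.\<close>

lemma card_primes_dyadic_le: "k * card {p::nat. prime p \<and> 2 ^ k < p \<and> p \<le> 2 * 2 ^ k} \<le> 2 * 2 ^ k"
proof -
  define n where "n = (2::nat) ^ k"
  let ?P = "{p::nat. prime p \<and> n < p \<and> p \<le> 2 * n}"
  have fin: "finite ?P" by (rule finite_subset[of _ "{..2 * n}"]) auto
  have "p dvd (2 * n choose n)" if "p \<in> ?P" for p
  proof -
    have p: "prime p" "n < p" "p \<le> 2 * n" using that by auto
    have "fact n * fact n * (2 * n choose n) = (fact (2 * n) :: nat)"
      using binomial_fact_lemma[of n "2 * n"] by simp
    moreover have "p dvd fact (2 * n)" using p by (simp add: prime_dvd_fact_iff)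
    moreover have "\<not> p dvd fact n" using p by (simp add: prime_dvd_fact_iff)
    ultimately show ?thesis using p(1) by (metis prime_dvd_mult_iff)
  qed
  then have "\<Prod>?P dvd (2 * n choose n)" using fin by (intro prod_primes_dvd) auto
  then have "\<Prod>?P \<le> (2 * n choose n)" by (intro dvd_imp_le) (simp_all add: zero_less_binomial)
  also have "\<dots> \<le> 2 ^ (2 * n)" by (rule binomial_le_pow2)
  finally have "\<Prod>?P \<le> 2 ^ (2 * n)" .
  moreover have "n ^ card ?P \<le> \<Prod>?P" using prod_mono[of ?P "\<lambda>_. n" "\<lambda>p. p"] by auto
  ultimately have "(2::nat) ^ (k * card ?P) \<le> 2 ^ (2 * n)" by (simp add: n_def power_mult)
  then have "k * card ?P \<le> 2 * n" by (simp only: power_increasing_iff one_less_numeral_iff semiring_norm)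
  then show ?thesis by (simp add: n_def)
qed

lemma sum_inverse_primes_pow2_le:
  "K \<ge> 1 \<Longrightarrow> (\<Sum>p\<in>primes_upto (2 ^ K). 1 / real p) \<le> 1/2 + 2 * (\<Sum>k=1..<K. 1 / real k)"
proof (induction K rule: dec_induct)
  case base
  have "primes_upto (2 ^ 1) = {2}" by (auto simp: primes_upto_def dest: prime_ge_2_nat)
  then show ?case by simp
next
  case (step K)
  let ?P = "{p::nat. prime p \<and> 2 ^ K < p \<and> p \<le> 2 * 2 ^ K}"
  have fin: "finite ?P" by (rule finite_subset[of _ "{..2 * 2 ^ K}"]) auto
  have "primes_upto (2 ^ Suc K) = primes_upto (2 ^ K) \<union> ?P" by (auto simp: primes_upto_def)
  then have "(\<Sum>p\<in>primes_upto (2 ^ Suc K). 1 / real p) = (\<Sum>p\<in>primes_upto (2 ^ K). 1 / real p) + (\<Sum>p\<in>?P. 1 / real p)"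
    using fin by (simp only:) (subst sum.union_disjoint, auto simp: primes_upto_def)
  also have "(\<Sum>p\<in>?P. 1 / real p) \<le> (\<Sum>p\<in>?P. 1 / 2 ^ K)"
  proof (rule sum_mono)
    fix p assume "p \<in> ?P"
    then have "2 ^ K \<le> p" by simp
    then have "(2::real) ^ K \<le> real p" by (metis of_nat_le_iff of_nat_numeral of_nat_power)
    then show "1 / real p \<le> 1 / 2 ^ K" by (intro divide_left_mono) (auto intro!: mult_pos_pos intro: less_le_trans[of _ "2 ^ K"])
  qed
  also have "(\<Sum>p\<in>?P. 1 / 2 ^ K) \<le> 2 * (1 / real K)"
  proof -
    have "real (K * card ?P) \<le> real (2 * 2 ^ K)" using card_primes_dyadic_le[of K] by (simp only: of_nat_le_iff)
    then show ?thesis using step by (simp add: field_simps)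
  qed
  finally show ?case using step by simp
qed

lemma ln_two_ge_half: "1/2 \<le> ln (2::real)"
  using ln_ge_iff[of 2 "1/2"] exp_half_le2 by simp

lemma sum_inverse_primes_le:
  assumes "x \<ge> 2"
  shows "(\<Sum>p\<in>primes_upto x. 1 / real p) \<le> 6 + 2 * ln (ln (real x))"
proof -
  define K where "K = nat \<lceil>log 2 (real x)\<rceil>"
  have l2: "log 2 (real x) \<ge> 1" using assms by simp
  have K1: "real K \<ge> log 2 (real x)" "real K \<le> log 2 (real x) + 1" using l2 by (auto simp: K_def)
  then have K: "K \<ge> 1" using l2 by linarith
  have "real x = 2 powr (log 2 (real x))" using assms by simp
  also have "\<dots> \<le> 2 powr (real K)" using K1 by (intro powr_mono) auto
  finally have "real x \<le> real (2 ^ K)" by (simp add: powr_realpow)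
  then have "x \<le> 2 ^ K" by (simp only: of_nat_le_iff)
  then have "(\<Sum>p\<in>primes_upto x. 1 / real p) \<le> (\<Sum>p\<in>primes_upto (2 ^ K). 1 / real p)"
    by (intro sum_mono2) (auto simp: primes_upto_def)
  also have "\<dots> \<le> 1/2 + 2 * (\<Sum>k=1..<K. 1 / real k)" by (rule sum_inverse_primes_pow2_le[OF K])
  also have "\<dots> \<le> 1/2 + 2 * (\<Sum>k=1..K. 1 / real k)"
    by (intro add_left_mono mult_left_mono sum_mono2) auto
  also have "\<dots> \<le> 1/2 + 2 * (1 + ln (real K))" using sum_inverse_le[OF K] by simp
  \<comment> \<open>Since \<open>4 \<le> exp (3/2)\<close>, the logarithm of the constant is at most
    3/2, and altogether \<open>1/2 + 2 + 3 \<le> 6\<close>.\<close>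
  also have "ln (real K) \<le> ln (exp 1 * ln (real x) * exp (1/2))"
  proof (rule ln_mono)
    have "real K \<le> 2 * log 2 (real x)" using K1 l2 by simp
    also have "\<dots> \<le> 2 * (ln (real x) / (1/2))"
      unfolding log_def using assms ln_two_ge_half by (intro mult_left_mono divide_left_mono) auto
    also have "\<dots> = 4 * ln (real x)" by simp
    also have "\<dots> \<le> (exp 1 * exp (1/2)) * ln (real x)"
    proof (rule mult_right_mono)
      have "(4::real) \<le> (1 + 1 + 1\<^sup>2/2) * (1 + 1/2 + (1/2)\<^sup>2/2)" by (simp add: power2_eq_square)
      also have "\<dots> \<le> exp 1 * exp (1/2)"
        using exp_lower_Taylor_quadratic[of 1] exp_lower_Taylor_quadratic[of "1/2"] by (intro mult_mono) auto
      finally show "4 \<le> exp 1 * exp (1/2 :: real)" .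
    qed (use assms in simp)
    finally show "real K \<le> exp 1 * ln (real x) * exp (1/2)" by (simp add: mult_ac)
  qed (use K in simp)
  also have "ln (exp 1 * ln (real x) * exp (1/2)) = 3/2 + ln (ln (real x))"
    using assms by (simp add: ln_mult)
  finally show ?thesis by simp
qed

text \<open>A truncated Euler product without infinite series: such a number is free of
  \<open>p\<close> or is \<open>p\<close> times another such number. Writing \<open>G\<close> for
  the sum, \<open>G(S + p) \<le> G(S) + G(S + p) / p\<close>, which is solved for
  \<open>G(S + p)\<close>.\<close>

lemma sum_smooth_inverse_le:
  assumes "finite S" "\<And>p. p \<in> S \<Longrightarrow> prime (p::nat)"
  shows "(\<Sum>n | n \<in> {1..N} \<and> (\<forall>q. prime q \<longrightarrow> q dvd n \<longrightarrow> q \<in> S). 1 / real n) \<le> (\<Prod>p\<in>S. 1 / (1 - 1 / real p))"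
  using assms
proof (induction S rule: finite_induct)
  case empty
  have "{n. n \<in> {1..N} \<and> (\<forall>q. prime q \<longrightarrow> q dvd n \<longrightarrow> q \<in> {})} \<subseteq> {1}"
    using prime_factor_nat by auto
  then have "(\<Sum>n | n \<in> {1..N} \<and> (\<forall>q. prime q \<longrightarrow> q dvd n \<longrightarrow> q \<in> {}). 1 / real n) \<le> (\<Sum>n\<in>{1::nat}. 1 / real n)"
    by (intro sum_mono2) auto
  then show ?case by simp
next
  case (insert p S)
  let ?A = "\<lambda>S. {n. n \<in> {1..N} \<and> (\<forall>q. prime q \<longrightarrow> q dvd n \<longrightarrow> q \<in> S)}"
  let ?G = "\<lambda>S. \<Sum>n\<in>?A S. 1 / real n"
  have fin: "finite (?A S)" for S by (rule finite_subset[of _ "{1..N}"]) auto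
  have p2: "real p \<ge> 2" using insert.prems[of p] prime_ge_2_nat[of p] by simp
  have "?A (insert p S) \<subseteq> ?A S \<union> (*) p ` ?A (insert p S)"
  proof
    fix n assume n: "n \<in> ?A (insert p S)"
    show "n \<in> ?A S \<union> (*) p ` ?A (insert p S)"
    proof (cases "p dvd n")
      case True
      then obtain m where m: "n = p * m" by (elim dvdE)
      then have "m \<ge> 1" using n by (cases m) auto
      have "m \<le> p * m" using p2 by simp
      moreover have "p * m \<le> N" using n m by simp
      ultimately have "m \<le> N" by linarith
      with \<open>m \<ge> 1\<close> have "m \<in> ?A (insert p S)" using n m by auto
      then show ?thesis using m by blast
    qed (use n in auto)
  qed
  then have "?G (insert p S) \<le> (\<Sum>n\<in>?A S \<union> (*) p ` ?A (insert p S). 1 / real n)"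
    by (intro sum_mono2) (use fin in auto)
  also have "\<dots> \<le> ?G S + (\<Sum>n\<in>(*) p ` ?A (insert p S). 1 / real n)"
  proof -
    have "(\<Sum>n\<in>?A S \<union> (*) p ` ?A (insert p S). 1 / real n) + (\<Sum>n\<in>?A S \<inter> (*) p ` ?A (insert p S). 1 / real n)
      = ?G S + (\<Sum>n\<in>(*) p ` ?A (insert p S). 1 / real n)"
      by (rule sum.union_inter) (use fin in auto)
    moreover have "0 \<le> (\<Sum>n\<in>?A S \<inter> (*) p ` ?A (insert p S). 1 / real n)" by (rule sum_nonneg) simp
    ultimately show ?thesis by linarith
  qed
  also have "(\<Sum>n\<in>(*) p ` ?A (insert p S). 1 / real n) = ?G (insert p S) / real p"
    using p2 by (subst sum.reindex) (auto simp: inj_on_def sum_divide_distrib mult.commute)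
  finally have "?G (insert p S) * (1 - 1 / real p) \<le> ?G S" by (simp add: algebra_simps)
  then have "?G (insert p S) \<le> ?G S * (1 / (1 - 1 / real p))" using p2 by (simp add: field_simps)
  also have "\<dots> \<le> (\<Prod>p\<in>S. 1 / (1 - 1 / real p)) * (1 / (1 - 1 / real p))"
    using insert p2 by (intro mult_right_mono) auto
  also have "\<dots> = (\<Prod>p\<in>insert p S. 1 / (1 - 1 / real p))" using insert by simp
  finally show ?case .
qed

text \<open>Euler's proof: the harmonic sum is at most the Euler product, and each factor is at most
  \<open>exp (2 / p)\<close> because \<open>p \<ge> 2\<close>. This 2 becomes the factor
  1/2.\<close>

lemma sum_inverse_primes_ge:
  assumes "x \<ge> 2"
  shows "ln (ln (real x)) / 2 \<le> (\<Sum>p\<in>primes_upto x. 1 / real p)"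
proof -
  have "ln (real x) \<le> (\<Sum>n=1..x. 1 / real n)"
  proof -
    have "ln (real x) \<le> ln (real x + 1)" using assms by simp
    also have "\<dots> \<le> harm x" by (rule ln_le_harm)
    finally show ?thesis by (simp add: harm_def inverse_eq_divide)
  qed
  also have "\<dots> = (\<Sum>n | n \<in> {1..x} \<and> (\<forall>q. prime q \<longrightarrow> q dvd n \<longrightarrow> q \<in> primes_upto x). 1 / real n)"
  proof (rule sum.cong)
    show "{1..x} = {n. n \<in> {1..x} \<and> (\<forall>q. prime q \<longrightarrow> q dvd n \<longrightarrow> q \<in> primes_upto x)}"
      by (auto simp: primes_upto_def dest!: dvd_imp_le)
  qed simp
  also have "\<dots> \<le> (\<Prod>p\<in>primes_upto x. 1 / (1 - 1 / real p))"
    by (rule sum_smooth_inverse_le) (auto simp: primes_upto_def)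
  also have "\<dots> \<le> (\<Prod>p\<in>primes_upto x. exp (2 * (1 / real p)))"
  proof (intro prod_mono conjI)
    fix p assume "p \<in> primes_upto x"
    then have p: "real p \<ge> 2" using prime_ge_2_nat[of p] by (simp add: primes_upto_def)
    then show "0 \<le> 1 / (1 - 1 / real p)" by simp
    have "1 / (1 - 1 / real p) \<le> 1 + 2 * (1 / real p)" using p by (simp add: field_simps)
    also have "\<dots> \<le> exp (2 * (1 / real p))" by (rule exp_ge_add_one_self)
    finally show "1 / (1 - 1 / real p) \<le> exp (2 * (1 / real p))" .
  qed
  also have "\<dots> = exp (2 * (\<Sum>p\<in>primes_upto x. 1 / real p))" by (simp add: exp_sum sum_distrib_left)
  finally have "ln (real x) \<le> exp (2 * (\<Sum>p\<in>primes_upto x. 1 / real p))" .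
  then have "ln (ln (real x)) \<le> 2 * (\<Sum>p\<in>primes_upto x. 1 / real p)"
    using assms ln_mono[of "ln (real x)" "exp (2 * (\<Sum>p\<in>primes_upto x. 1 / real p))"] by simp
  then show ?thesis by simp
qed

section \<open>Turan's variance bound\<close>

lemma card_multiples_nat: "k > 0 \<Longrightarrow> card {n \<in> {1..M}. k dvd n} = M div k"
proof -
  assume k: "k > 0"
  have "bij_betw (\<lambda>t. k * t) {1..M div k} {n \<in> {1..M}. k dvd n}"
    by (rule bij_betw_byWitness[of _ "\<lambda>n. n div k"])
       (use k in \<open>auto simp: less_eq_div_iff_mult_less_eq mult.commute elim!: dvdE\<close>)
  then show ?thesis using bij_betw_same_card by fastforce
qed

text \<open>In the second moment the floors are simply dropped. The linear term needs a lower bound,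
  where each floor costs at most 1; this is the source of \<open>2 * \<mu> * card T\<close>.\<close>

lemma turan_variance:
  assumes T: "finite T" "\<And>p. p \<in> T \<Longrightarrow> prime (p::nat)"
  defines "\<mu> \<equiv> \<Sum>p\<in>T. 1 / real p"
  shows "(\<Sum>n=1..M. (real (card {p \<in> T. p dvd n}) - \<mu>)\<^sup>2) \<le> real M * \<mu> + 2 * \<mu> * real (card T)"
proof -
  let ?i = "\<lambda>p n. if p dvd n then 1 else (0::real)"
  have w: "real (card {p \<in> T. p dvd n}) = (\<Sum>p\<in>T. ?i p n)" for n
    using T(1) by (simp add: sum.If_cases Int_def)
  have cnt: "(\<Sum>n=1..M. ?i k n) = real (M div k)" if "k > 0" for k
    using card_multiples_nat[OF that, of M] by (simp add: sum.If_cases Int_def conj_commute)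
  have \<mu>0: "\<mu> \<ge> 0" unfolding \<mu>_def by (intro sum_nonneg) simp
  have pos: "p > 0" if "p \<in> T" for p using T(2)[OF that] by (rule prime_gt_0_nat)
  have sq: "(\<Sum>n=1..M. (\<Sum>p\<in>T. ?i p n)\<^sup>2) \<le> real M * \<mu>\<^sup>2 + real M * \<mu>"
  proof -
    have "(\<Sum>n=1..M. (\<Sum>p\<in>T. ?i p n)\<^sup>2) = (\<Sum>p\<in>T. \<Sum>q\<in>T. \<Sum>n=1..M. ?i p n * ?i q n)"
      unfolding power2_eq_square sum_product by (rule trans[OF sum.swap sum.cong[OF refl sum.swap]])
    also have "\<dots> \<le> (\<Sum>p\<in>T. \<Sum>q\<in>T. real M * (1 / p * (1 / q)) + (if p = q then real M / p else 0))"
    proof (intro sum_mono)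
      fix p q assume pq: "p \<in> T" "q \<in> T"
      show "(\<Sum>n=1..M. ?i p n * ?i q n) \<le> real M * (1 / p * (1 / q)) + (if p = q then real M / p else 0)"
      proof (cases "p = q")
        case True
        have "(\<Sum>n=1..M. ?i p n * ?i q n) = (\<Sum>n=1..M. ?i p n)" unfolding True by (intro sum.cong) auto
        also have "\<dots> \<le> real M / real p" unfolding cnt[OF pos[OF pq(1)]] by (rule of_nat_div_le_of_nat)
        finally show ?thesis using True by (simp add: add_increasing)
      next
        case False
        have "coprime p q" using False T pq primes_coprime by blast
        then have "?i p n * ?i q n = ?i (p * q) n" for n by (auto intro: divides_mult dest: dvd_mult_left dvd_mult_right)
        then have "(\<Sum>n=1..M. ?i p n * ?i q n) = real (M div (p * q))"
          using cnt[of "p * q"] pos pq by simp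
        also have "\<dots> \<le> real M / real (p * q)" by (rule of_nat_div_le_of_nat)
        finally show ?thesis using False by simp
      qed
    qed
    also have "\<dots> = real M * \<mu>\<^sup>2 + real M * \<mu>"
      using T(1) unfolding \<mu>_def power2_eq_square sum_product
      by (simp add: sum.distrib sum_distrib_left)
    finally show ?thesis .
  qed
  have lin: "real M * \<mu> - real (card T) \<le> (\<Sum>n=1..M. \<Sum>p\<in>T. ?i p n)"
  proof -
    have "real M * \<mu> - real (card T) = (\<Sum>p\<in>T. real M / p - 1)"
      by (simp add: \<mu>_def sum_subtractf sum_distrib_left)
    also have "\<dots> \<le> (\<Sum>p\<in>T. real (M div p))"
    proof (rule sum_mono)
      fix p assume "p \<in> T"
      have "real M / real p < real (M div p) + 1"
        using floor_divide_of_nat_eq[of M p, where 'a = real] by linarith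
      then show "real M / p - 1 \<le> real (M div p)" by simp
    qed
    also have "\<dots> = (\<Sum>p\<in>T. \<Sum>n=1..M. ?i p n)" by (intro sum.cong refl cnt[symmetric] pos)
    also have "\<dots> = (\<Sum>n=1..M. \<Sum>p\<in>T. ?i p n)" by (rule sum.swap)
    finally show ?thesis .
  qed
  have "(\<Sum>n=1..M. (real (card {p \<in> T. p dvd n}) - \<mu>)\<^sup>2)
     = (\<Sum>n=1..M. (\<Sum>p\<in>T. ?i p n)\<^sup>2) - 2 * \<mu> * (\<Sum>n=1..M. \<Sum>p\<in>T. ?i p n) + real M * \<mu>\<^sup>2"
    unfolding w power2_diff sum.distrib sum_subtractf by (simp add: sum_distrib_left mult_ac)
  also have "\<dots> \<le> (real M * \<mu>\<^sup>2 + real M * \<mu>) - 2 * \<mu> * (real M * \<mu> - real (card T)) + real M * \<mu>\<^sup>2"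
    using sq lin \<mu>0 by (intro add_mono diff_mono mult_left_mono) auto
  also have "\<dots> = real M * \<mu> + 2 * \<mu> * real (card T)" by (simp add: algebra_simps power2_eq_square)
  finally show ?thesis .
qed

text \<open>The counted \<open>n\<close> deviate from the mean \<open>\<mu>\<close> by at least
  \<open>\<mu> / 2\<close>, and the total variance is at most \<open>3 * M * \<mu>\<close>, whence
  \<open>12 = 3 * 4\<close>.\<close>

lemma turan_few_prime_factors:
  assumes T: "finite T" "\<And>p. p \<in> T \<Longrightarrow> prime (p::nat)" "card T \<le> M"
    and k: "2 * real k \<le> (\<Sum>p\<in>T. 1 / real p)" "(\<Sum>p\<in>T. 1 / real p) > 0"
  shows "real (card {n \<in> {1..M}. card {p \<in> T. p dvd n} < k}) \<le> 12 * real M / (\<Sum>p\<in>T. 1 / real p)"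
proof -
  define \<mu> where "\<mu> = (\<Sum>p\<in>T. 1 / real p)"
  let ?B = "{n \<in> {1..M}. card {p \<in> T. p dvd n} < k}"
  have "real (card ?B) * (\<mu> / 2)\<^sup>2 = (\<Sum>n\<in>?B. (\<mu> / 2)\<^sup>2)" by simp
  also have "\<dots> \<le> (\<Sum>n\<in>?B. (real (card {p \<in> T. p dvd n}) - \<mu>)\<^sup>2)"
  proof (rule sum_mono)
    fix n assume "n \<in> ?B"
    then have "real (card {p \<in> T. p dvd n}) \<le> \<mu> / 2" using k(1) unfolding \<mu>_def by simp
    then have "(\<mu> / 2)\<^sup>2 \<le> (\<mu> - real (card {p \<in> T. p dvd n}))\<^sup>2" using k(2) unfolding \<mu>_def[symmetric] by (intro power_mono) auto
    then show "(\<mu> / 2)\<^sup>2 \<le> (real (card {p \<in> T. p dvd n}) - \<mu>)\<^sup>2" by (simp add: power2_commute)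
  qed
  also have "\<dots> \<le> (\<Sum>n=1..M. (real (card {p \<in> T. p dvd n}) - \<mu>)\<^sup>2)" by (rule sum_mono2) auto
  also have "\<dots> \<le> real M * \<mu> + 2 * \<mu> * real (card T)" unfolding \<mu>_def by (rule turan_variance[OF T(1,2)])
  also have "\<dots> \<le> 3 * real M * \<mu>" using T(3) k(2) by (simp add: \<mu>_def mult_right_mono algebra_simps)
  finally have "real (card ?B) * \<mu> * \<mu> \<le> 12 * real M * \<mu>" by (simp add: power2_eq_square)
  then have "real (card ?B) * \<mu> \<le> 12 * real M" using k(2) by (simp add: \<mu>_def)
  then show ?thesis using k(2) by (simp add: \<mu>_def pos_le_divide_eq)
qed

section \<open>Fundamental discriminants\<close>

lemma squarefree_int_iff: "squarefree (int n) \<longleftrightarrow> squarefree n"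
proof
  assume sq: "squarefree n"
  show "squarefree (int n)"
  proof (rule squarefreeI)
    fix x :: int assume "x\<^sup>2 dvd int n"
    then have "int ((nat \<bar>x\<bar>)\<^sup>2) dvd int n" by simp
    then have "(nat \<bar>x\<bar>)\<^sup>2 dvd n" by (simp only: int_dvd_int_iff)
    from squarefreeD[OF sq this] show "x dvd 1" by (simp add: nat_abs_dvd_iff)
  qed
next
  assume sq: "squarefree (int n)"
  show "squarefree n"
  proof (rule squarefreeI)
    fix x assume "x\<^sup>2 dvd n"
    then have "(int x)\<^sup>2 dvd int n" by (simp flip: of_nat_power)
    from squarefreeD[OF sq this] show "x dvd 1" by simp
  qed
qed

lemma squarefree_nat_abs: "squarefree (D :: int) \<Longrightarrow> squarefree (nat \<bar>D\<bar>)"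
proof -
  assume "squarefree D"
  then have "squarefree \<bar>D\<bar>" by (cases "D \<ge> 0") auto
  then show ?thesis using squarefree_int_iff[of "nat \<bar>D\<bar>"] by simp
qed

lemma card_residue_1_mod_4:
  "real M / 4 \<le> real (card {n \<in> {1..M}. n mod 4 = 1})" "real (card {n \<in> {1..M}. n mod 4 = 1}) \<le> real M / 4 + 1"
proof -
  have "bij_betw (\<lambda>t. 4 * t + 1) {..<(M + 3) div 4} {n \<in> {1..M}. n mod 4 = 1}"
  proof (rule bij_betw_byWitness[of _ "\<lambda>n. n div 4"])
    have 1: "4 * (n div 4) + 1 = n" if "n mod 4 = 1" for n :: nat using that by presburger
    have 2: "4 * t + 1 \<le> M" if "t < (M + 3) div 4" for t using that by linarith
    have 3: "n div 4 < (M + 3) div 4" if "n \<le> M" "n mod 4 = 1" for n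
    proof -
      have "4 * (n div 4 + 1) = 4 * (n div 4) + 1 + 3" by simp
      then have "4 * (n div 4 + 1) \<le> M + 3" unfolding 1[OF that(2)] using that(1) by simp
      then show ?thesis by (simp add: less_eq_div_iff_mult_less_eq mult.commute flip: Suc_le_eq)
    qed
    show "\<forall>n\<in>{n \<in> {1..M}. n mod 4 = 1}. 4 * (n div 4) + 1 = n" using 1 by blast
    show "(\<lambda>t. 4 * t + 1) ` {..<(M + 3) div 4} \<subseteq> {n \<in> {1..M}. n mod 4 = 1}" using 2 by fastforce
    show "(\<lambda>n. n div 4) ` {n \<in> {1..M}. n mod 4 = 1} \<subseteq> {..<(M + 3) div 4}" using 3 by auto
  qed auto
  then have "card {n \<in> {1..M}. n mod 4 = 1} = (M + 3) div 4" using bij_betw_same_card by fastforce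
  then have "M \<le> 4 * card {n \<in> {1..M}. n mod 4 = 1}" "4 * card {n \<in> {1..M}. n mod 4 = 1} \<le> M + 3" by linarith+
  then show "real M / 4 \<le> real (card {n \<in> {1..M}. n mod 4 = 1})" "real (card {n \<in> {1..M}. n mod 4 = 1}) \<le> real M / 4 + 1"
    by linarith+
qed

text \<open>An odd square is 1 modulo 4, so the cofactor stays in the class of 1 and the density 1/4
  of that class is retained.\<close>

lemma card_residue_square_multiple:
  assumes "odd j"
  shows "real (card {n \<in> {1..M}. n mod 4 = 1 \<and> j\<^sup>2 dvd n}) \<le> real M / (4 * (real j)\<^sup>2) + 1"
proof -
  have j0: "j\<^sup>2 > 0" using assms by (simp add: odd_pos)
  have "j mod 4 = 1 \<or> j mod 4 = 3" using assms by (rule odd_mod_4)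
  then have j4: "j\<^sup>2 mod 4 = 1" unfolding power_mod[symmetric, of j] by auto
  have "{n \<in> {1..M}. n mod 4 = 1 \<and> j\<^sup>2 dvd n} \<subseteq> (\<lambda>t. j\<^sup>2 * t) ` {t \<in> {1..M div j\<^sup>2}. t mod 4 = 1}"
  proof
    fix n assume n: "n \<in> {n \<in> {1..M}. n mod 4 = 1 \<and> j\<^sup>2 dvd n}"
    then obtain t where t: "n = j\<^sup>2 * t" by (auto elim: dvdE)
    have "n mod 4 = (j\<^sup>2 mod 4) * t mod 4" unfolding t by (simp add: mod_mult_left_eq)
    then have "t mod 4 = 1" using n j4 by simp
    moreover have "1 \<le> t" "t \<le> M div j\<^sup>2"
      using n t j0 by (auto simp: less_eq_div_iff_mult_less_eq mult.commute Suc_le_eq)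
    ultimately show "n \<in> (\<lambda>t. j\<^sup>2 * t) ` {t \<in> {1..M div j\<^sup>2}. t mod 4 = 1}" using t by auto
  qed
  then have "card {n \<in> {1..M}. n mod 4 = 1 \<and> j\<^sup>2 dvd n} \<le> card ((\<lambda>t. j\<^sup>2 * t) ` {t \<in> {1..M div j\<^sup>2}. t mod 4 = 1})"
    by (intro card_mono) auto
  also have "\<dots> \<le> card {t \<in> {1..M div j\<^sup>2}. t mod 4 = 1}" by (rule card_image_le) auto
  finally have "real (card {n \<in> {1..M}. n mod 4 = 1 \<and> j\<^sup>2 dvd n}) \<le> real (M div j\<^sup>2) / 4 + 1"
    using card_residue_1_mod_4(2)[of "M div j\<^sup>2"] by linarith
  also have "\<dots> \<le> real M / real (j\<^sup>2) / 4 + 1"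
    by (intro add_mono divide_right_mono of_nat_div_le_of_nat) auto
  finally show ?thesis by (simp add: mult.commute)
qed

lemma sum_odd_squares_le: "(\<Sum>i=1..s. 1 / (4 * (real (2 * i + 1))\<^sup>2)) \<le> 1/16"
proof -
  have "(\<Sum>i=1..s. 1 / (4 * (real (2 * i + 1))\<^sup>2)) \<le> 1/16 * (1 - 1 / (real s + 1))"
  proof (induction s)
    case (Suc s)
    have "1 / (4 * (real (2 * Suc s + 1))\<^sup>2) \<le> 1 / (16 * ((real s + 1) * (real s + 2)))"
      by (intro divide_left_mono) (auto simp: power2_eq_square algebra_simps intro!: mult_pos_pos add_pos_nonneg)
    also have "\<dots> = 1/16 * (1 / (real s + 1) - 1 / (real s + 2))" by (simp add: field_simps)
    finally have "1 / (4 * (real (2 * Suc s + 1))\<^sup>2) \<le> 1/16 * (1 / (real s + 1) - 1 / (real s + 2))" .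
    moreover have "(\<Sum>i=1..Suc s. 1 / (4 * (real (2 * i + 1))\<^sup>2)) =
      (\<Sum>i=1..s. 1 / (4 * (real (2 * i + 1))\<^sup>2)) + 1 / (4 * (real (2 * Suc s + 1))\<^sup>2)" by simp
    moreover have "1 / (real (Suc s) + 1) = 1 / (real s + 2)" by (simp add: add.commute)
    ultimately show ?case using Suc.IH unfolding right_diff_distrib by linarith
  qed simp
  also have "\<dots> \<le> 1/16" by simp
  finally show ?thesis .
qed

text \<open>Of the density 1/4 of the class, the odd squares take 1/16; the rounding errors, one for
  each square up to \<open>M\<close>, take at most another 1/16 once
  \<open>M \<ge> 256\<close>.\<close>

lemma card_squarefree_1_mod_4_ge:
  assumes "M \<ge> 256"
  shows "real M / 8 \<le> real (card {n \<in> {1..M}. n mod 4 = 1 \<and> squarefree n})"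
proof -
  define s where "s = nat \<lfloor>sqrt (real M)\<rfloor>"
  let ?A = "{n \<in> {1..M}. n mod 4 = 1}" and ?S = "{n \<in> {1..M}. n mod 4 = 1 \<and> squarefree n}"
  let ?B = "\<lambda>i. {n \<in> {1..M}. n mod 4 = 1 \<and> (2 * i + 1)\<^sup>2 dvd n}"
  have "?A \<subseteq> ?S \<union> (\<Union>i\<in>{1..s}. ?B i)"
  proof
    fix n assume n: "n \<in> ?A"
    show "n \<in> ?S \<union> (\<Union>i\<in>{1..s}. ?B i)"
    proof (cases "squarefree n")
      case False
      then obtain x where x: "x\<^sup>2 dvd n" "\<not> x dvd 1" by (auto simp: squarefree_def)
      have "n mod 4 = 1" using n by simp
      then have "odd n" by presburger
      then have "odd x" using x(1) by (auto simp: power2_eq_square elim!: dvdE)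
      then obtain i where i: "x = 2 * i + 1" by (elim oddE)
      have "x\<^sup>2 \<le> M" using dvd_imp_le[OF x(1)] n by auto
      then have "(real x)\<^sup>2 \<le> real M" by (metis of_nat_le_iff of_nat_power)
      then have "real x \<le> sqrt (real M)" by (rule real_le_rsqrt)
      then have "x \<le> s" unfolding s_def by (simp add: le_nat_floor)
      then have "i \<in> {1..s}" using x(2) i by auto
      then show ?thesis using x(1) i n by blast
    qed (use n in auto)
  qed
  then have "card ?A \<le> card (?S \<union> (\<Union>i\<in>{1..s}. ?B i))" by (intro card_mono) auto
  also have "\<dots> \<le> card ?S + card (\<Union>i\<in>{1..s}. ?B i)" by (rule card_Un_le)
  also have "card (\<Union>i\<in>{1..s}. ?B i) \<le> (\<Sum>i=1..s. card (?B i))" by (rule card_UN_le) auto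
  finally have "real (card ?A) \<le> real (card ?S) + (\<Sum>i=1..s. real (card (?B i)))"
    by (simp flip: of_nat_sum of_nat_add)
  also have "(\<Sum>i=1..s. real (card (?B i))) \<le> (\<Sum>i=1..s. real M * (1 / (4 * (real (2 * i + 1))\<^sup>2)) + 1)"
  proof (rule sum_mono)
    fix i show "real (card (?B i)) \<le> real M * (1 / (4 * (real (2 * i + 1))\<^sup>2)) + 1"
      using card_residue_square_multiple[of "2 * i + 1" M] by simp
  qed
  also have "\<dots> = real M * (\<Sum>i=1..s. 1 / (4 * (real (2 * i + 1))\<^sup>2)) + real s"
    by (simp only: sum.distrib sum_distrib_left[symmetric]) simp
  also have "\<dots> \<le> real M * (1/16) + sqrt (real M)"
    using sum_odd_squares_le[of s] by (intro add_mono mult_left_mono) (auto simp: s_def)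
  also have "sqrt (real M) \<le> real M / 16"
  proof -
    have "16 \<le> sqrt (real M)" using assms by (intro real_le_rsqrt) simp
    then have "16 * sqrt (real M) \<le> sqrt (real M) * sqrt (real M)" by (intro mult_right_mono) auto
    then show ?thesis by simp
  qed
  finally show ?thesis using card_residue_1_mod_4(1)[of M] by simp
qed

lemma finite_abs_le: "finite {D::int. real_of_int \<bar>D\<bar> \<le> Z}"
  by (rule finite_subset[of _ "{-\<lfloor>Z\<rfloor>..\<lfloor>Z\<rfloor>}"]) (auto simp: le_floor_iff abs_le_iff minus_le_iff)

text \<open>With a positive proportion of discriminants at hand, exceptional ones can be counted
  among all integers. The positive squarefree numbers that are 1 modulo 4 already provide
  it.\<close>

lemma card_fundamental_discriminants_ge:
  assumes "Z \<ge> 257"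
  shows "Z / 16 \<le> real (card {D. fundamental_discriminant D \<and> real_of_int \<bar>D\<bar> \<le> Z})"
proof -
  define M where "M = nat \<lfloor>Z\<rfloor>"
  have M: "real M \<le> Z" "Z \<le> real M + 1" "M \<ge> 256" using assms unfolding M_def by linarith+
  let ?S = "{n \<in> {1..M}. n mod 4 = 1 \<and> squarefree n}"
  have "int ` ?S \<subseteq> {D. fundamental_discriminant D \<and> real_of_int \<bar>D\<bar> \<le> Z}"
  proof
    fix D assume "D \<in> int ` ?S"
    then obtain n where n: "D = int n" "n \<in> ?S" by blast
    have "int n mod 4 = 1" using n(2) by (metis (mono_tags, lifting) mem_Collect_eq of_nat_1 of_nat_numeral zmod_int)
    moreover have "real n \<le> real M" using n(2) by simp
    ultimately show "D \<in> {D. fundamental_discriminant D \<and> real_of_int \<bar>D\<bar> \<le> Z}"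
      using n M(1) by (auto simp: fundamental_discriminant_def squarefree_int_iff)
  qed
  moreover have "finite {D. fundamental_discriminant D \<and> real_of_int \<bar>D\<bar> \<le> Z}"
    by (rule finite_subset[OF _ finite_abs_le[of Z]]) auto
  ultimately have "card (int ` ?S) \<le> card {D. fundamental_discriminant D \<and> real_of_int \<bar>D\<bar> \<le> Z}"
    by (intro card_mono)
  then have "real (card ?S) \<le> real (card {D. fundamental_discriminant D \<and> real_of_int \<bar>D\<bar> \<le> Z})"
    by (simp add: card_image)
  then show ?thesis using card_squarefree_1_mod_4_ge[OF M(3)] M by linarith
qed

lemma fundamental_discriminant_modulus:
  assumes "fundamental_discriminant D"
  obtains r m where "nat \<bar>D\<bar> = r * m" "r \<in> {1, 4, 8}" "odd m" "squarefree m"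
proof -
  consider "D mod 4 = 1" "squarefree D" | m where "D = 4 * m" "m mod 4 = 3" "squarefree m"
    | m where "D = 4 * m" "m mod 4 = 2" "squarefree m"
    using assms unfolding fundamental_discriminant_def by blast
  then show ?thesis
  proof cases
    case 1
    have "odd D" using 1(1) by presburger
    then have "odd (nat \<bar>D\<bar>)" by (simp add: even_nat_iff)
    then show ?thesis using that[of 1 "nat \<bar>D\<bar>"] squarefree_nat_abs[OF 1(2)] by simp
  next
    case (2 m)
    have "odd m" using 2(2) by presburger
    then have "odd (nat \<bar>m\<bar>)" by (simp add: even_nat_iff)
    moreover have "nat \<bar>D\<bar> = 4 * nat \<bar>m\<bar>" using 2(1) by (simp add: abs_mult nat_mult_distrib)
    ultimately show ?thesis using that[of 4 "nat \<bar>m\<bar>"] squarefree_nat_abs[OF 2(3)] by simp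
  next
    case (3 m)
    obtain l where l: "m = 2 * l" "odd l"
    proof -
      have "m = 2 * (m div 2)" "odd (m div 2)" using 3(2) by presburger+
      then show ?thesis using that by blast
    qed
    then have "odd (nat \<bar>l\<bar>)" by (simp add: even_nat_iff)
    moreover have "nat \<bar>D\<bar> = 8 * nat \<bar>l\<bar>" using 3(1) l by (simp add: abs_mult nat_mult_distrib)
    moreover have "squarefree l" using 3(3) l(1) squarefree_mono[of l m] by simp
    ultimately show ?thesis using that[of 8 "nat \<bar>l\<bar>"] squarefree_nat_abs[of l] by simp
  qed
qed

section \<open>The characters of a single discriminant\<close>

text \<open>A divisor up to \<open>W\<close> contains none of the primes above \<open>W\<close>, so
  it is determined by a subset of the remaining primes.\<close>

lemma small_divisors_card:
  fixes m W :: nat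
  assumes m: "odd m" "squarefree m" and k: "k \<le> card {p. prime p \<and> W < p \<and> p dvd m}"
  shows "card {d. d dvd m \<and> d \<le> W} * 2 ^ k \<le> 2 ^ card (prime_factors m)"
proof -
  have m0: "m > 0" using m(1) by (simp add: odd_pos)
  let ?B = "{p. prime p \<and> W < p \<and> p dvd m}" and ?P = "prime_factors m"
  have B: "?B \<subseteq> ?P" using m0 by (auto simp: in_prime_factors_iff)
  have "prime_factors ` {d. d dvd m \<and> d \<le> W} \<subseteq> Pow (?P - ?B)"
  proof clarify
    fix d p assume d: "d dvd m" "d \<le> W" and p: "p \<in> prime_factors d"
    have "prime p" "p dvd d" "d > 0" using p d m0 by (auto simp: in_prime_factors_iff)
    then have "p \<le> W" "p dvd m" using d dvd_imp_le[of p d] dvd_trans by auto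
    then show "p \<in> ?P - ?B" using \<open>prime p\<close> m0 by (auto simp: in_prime_factors_iff)
  qed
  moreover have "inj_on prime_factors {d. d dvd m \<and> d \<le> W}"
  proof (rule inj_onI)
    fix d e assume "d \<in> {d. d dvd m \<and> d \<le> W}" "e \<in> {d. d dvd m \<and> d \<le> W}" and eq: "prime_factors d = prime_factors e"
    then have "d dvd m" "e dvd m" by auto
    then have "odd d" "squarefree d" "odd e" "squarefree e"
      using m squarefree_mono dvd_trans by blast+
    then show "d = e" using eq prod_prime_factors_squarefree by metis
  qed
  ultimately have "card {d. d dvd m \<and> d \<le> W} \<le> card (Pow (?P - ?B))"
    by (intro card_inj_on_le) auto
  also have "\<dots> = 2 ^ (card ?P - card ?B)"
    using B finite_subset[OF B] by (simp add: card_Pow card_Diff_subset)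
  finally have "card {d. d dvd m \<and> d \<le> W} * 2 ^ k \<le> 2 ^ (card ?P - card ?B) * 2 ^ card ?B"
    using k by (intro mult_mono power_increasing) auto
  also have "\<dots> = 2 ^ card ?P"
    using card_mono[OF _ B] by (simp flip: power_add)
  finally show ?thesis .
qed

text \<open>The cut \<open>N\<close> may vary with \<open>d\<close>; it will be the one attached to
  the dyadic block of \<open>d\<close>.\<close>

definition usable_modulus :: "nat \<Rightarrow> nat \<Rightarrow> bool" where
  "usable_modulus Y d \<longleftrightarrow> (\<exists>N\<ge>1. good_modulus Y N d \<and> (1 + ln (real N)) / real Y \<le> 1/8 \<and>
     (128 * real d powr (2/3) / (real N + 1)) powr (1 / ln (real Y)) * (129 + ln (real d)) * real Y ^ 3 \<le> 1/8)"

lemma quadratic_character_L_ge: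
  assumes \<psi>: "\<psi> \<in> quadratic_characters (r * m)" and f: "realchar (r * m) f" "\<psi> = (\<lambda>n. of_int (f n))"
    and \<xi>: "char8 \<xi>" and d: "d dvd m" "d > 1" "usable_modulus Y d"
    and fx: "\<And>n. odd n \<Longrightarrow> coprime n (r * m) \<Longrightarrow> f n = \<xi> n * jac (int n) d"
    and m: "odd m" "squarefree m" and r: "r \<in> {1, 4, 8}" and Y: "Y \<ge> 3"
    and Q: "(\<Sum>p | prime p \<and> p dvd m \<and> Y < p. 1 / real p) \<le> 1/2"
  shows "Re (dirichlet_L 1 \<psi>) \<ge> 1/4 / (\<Prod>p\<in>primes_upto Y. 1 + 1 / real p)"
proof -
  let ?g = "\<lambda>n. real_of_int (\<xi> n * jac (int n) d)" and ?Q = "{p. prime p \<and> p dvd m \<and> Y < p}"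
  have m0: "m > 0" using m(1) by (simp add: odd_pos)
  have od: "odd d" "squarefree d" using m d(1) squarefree_mono dvd_trans by blast+
  obtain Lf where Lf: "hsum (\<lambda>n. real_of_int (f n)) {} \<longlonglongrightarrow> Lf" "dirichlet_L 1 \<psi> = of_real Lf"
    by (rule quadratic_character_L[OF \<psi> f])
  obtain N where N: "N \<ge> 1" "good_modulus Y N d" "(1 + ln (real N)) / real Y \<le> 1/8"
     "(128 * real d powr (2/3) / (real N + 1)) powr (1 / ln (real Y)) * (129 + ln (real d)) * real Y ^ 3 \<le> 1/8"
    using d(3) unfolding usable_modulus_def by blast
  obtain L where L: "hsum ?g {} \<longlonglongrightarrow> L" "L * (\<Prod>p\<in>primes_upto Y. 1 - ?g p / p) \<ge> 1/2"
    by (rule good_modulus_L[OF \<xi> od d(2) N(2) Y N(1,3,4)])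
  have "Lf \<ge> 1/4 / (\<Prod>p\<in>primes_upto Y. 1 + 1 / real p)"
  proof (rule L_lower_bound[OF _ _ Lf(1) _ _ L(1) finite_primes_upto _ _ _ _ _ L(2)])
    show "real_of_int (f (a * b)) = real_of_int (f a) * real_of_int (f b)" for a b
      using f(1) by (simp add: realchar_def)
    show "\<bar>real_of_int (f n)\<bar> \<le> 1" for n
      using abs_realchar_le_1[OF f(1), of n] by simp
    show "?g (a * b) = ?g a * ?g b" for a b using \<xi> by (simp add: char8_def jac_mult[OF od(1)])
    show "\<bar>?g n\<bar> \<le> 1" for n by (rule abs_char8_jac_le_1[OF \<xi>])
    show "prime q" if "q \<in> primes_upto Y" for q using that by (simp add: primes_upto_def)
    show "finite ?Q" using m0 by (intro finite_subset[OF _ finite_divisors_nat[OF m0]]) auto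
    show "prime q" if "q \<in> ?Q" for q using that by simp
    show "primes_upto Y \<inter> ?Q = {}" by (auto simp: primes_upto_def)
    show "(\<Sum>p\<in>?Q. 1 / real p) \<le> 1/2" using Q by simp
    fix n :: nat assume n: "n > 0" "\<And>p. p \<in> primes_upto Y \<Longrightarrow> \<not> p dvd n"
    \<comment> \<open>As 2 is among the sieved primes, only odd \<open>n\<close> remain, where the
      factorization \<open>fx\<close> applies.\<close>
    have n2: "odd n" using n(2)[of 2] Y by (simp add: primes_upto_def)
    show "real_of_int (f n) = (if \<exists>p\<in>?Q. p dvd n then 0 else ?g n)"
    proof (cases "\<exists>p\<in>?Q. p dvd n")
      case True
      then obtain p where p: "prime p" "p dvd m" "p dvd n" by auto
      then have "\<not> coprime n (r * m)" by (meson coprime_common_divisor dvd_mult not_prime_unit)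
      then have "f n = 0" using f(1) unfolding realchar_def by blast
      then show ?thesis using True by simp
    next
      case False
      have "coprime n m"
      proof (rule ccontr)
        assume "\<not> coprime n m"
        then obtain p where "prime p" "p dvd n" "p dvd m" by (rule not_coprime_prime_nat)
        then show False using False n(2)[of p] by (cases "p \<le> Y") (auto simp: primes_upto_def)
      qed
      moreover have "coprime n r" by (rule coprime_odd_two_power[OF r n2])
      ultimately have "coprime n (r * m)" by simp
      then show ?thesis using False fx[OF n2] by simp
    qed
  qed
  then show ?thesis using Lf(2) by simp
qed

text \<open>With \<open>\<omega>\<close> prime factors of \<open>m\<close>, the exceptional
  characters number at most a constant times \<open>2 ^ (\<omega> - k)\<close>, against at least
  \<open>2 ^ \<omega> - 1 \<ge> 2 ^ (\<omega> - 1)\<close> characters in all; hence the factor 2 in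
  the condition on \<open>\<delta>\<close>.\<close>

lemma many_large_L_values:
  assumes m: "odd m" "squarefree m" and r: "r \<in> {1, 4, 8}" and Y: "Y \<ge> 3" and W: "W \<ge> 1"
    and usable: "\<And>d. d dvd m \<Longrightarrow> d > W \<Longrightarrow> usable_modulus Y d"
    and k: "k \<ge> 1" "k \<le> card {p. prime p \<and> W < p \<and> p dvd m}"
    and Q: "(\<Sum>p | prime p \<and> p dvd m \<and> Y < p. 1 / real p) \<le> 1/2"
    and \<delta>: "2 * real (card {\<xi>. char8 \<xi>}) \<le> \<delta> * 2 ^ k"
    and t: "t \<le> 1/4 / (\<Prod>p\<in>primes_upto Y. 1 + 1 / real p)"
  shows "real (card {\<psi> \<in> quadratic_characters (r * m). Re (dirichlet_L 1 \<psi>) \<ge> t})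
    \<ge> (1 - \<delta>) * real (card (quadratic_characters (r * m)))"
proof -
  let ?X = "quadratic_characters (r * m)" and ?P = "\<lambda>\<psi>. Re (dirichlet_L 1 \<psi>) \<ge> t"
  let ?D = "{d. d dvd m \<and> d \<le> W}" and ?K = "card {\<xi>. char8 \<xi>}"
  have m0: "m > 0" using m(1) by (simp add: odd_pos)
  have finD: "finite ?D" by (rule finite_subset[of _ "{..W}"]) auto
  have fin: "finite ?X" by (rule finite_quadratic_characters[OF m r])
  have bad: "card {\<psi> \<in> ?X. \<not> ?P \<psi>} \<le> card ?D * ?K"
  proof (rule quadratic_exceptional_card(2)[OF m r finD])
    fix \<psi> f \<xi> d
    assume *: "\<psi> \<in> ?X" "realchar (r * m) f" "\<psi> = (\<lambda>n. of_int (f n))" "char8 \<xi>" "d dvd m"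
      "\<And>n. odd n \<Longrightarrow> coprime n (r * m) \<Longrightarrow> f n = \<xi> n * jac (int n) d" "d \<notin> ?D"
    then have "d > W" by simp
    then have "Re (dirichlet_L 1 \<psi>) \<ge> 1/4 / (\<Prod>p\<in>primes_upto Y. 1 + 1 / real p)"
      using W by (intro quadratic_character_L_ge[OF *(1-5) _ usable[OF *(5)] *(6) m r Y Q]) auto
    then show "?P \<psi>" using t by linarith
  qed
  have "{p. prime p \<and> W < p \<and> p dvd m} \<subseteq> prime_factors m" using m0 by (auto simp: in_prime_factors_iff)
  then have "card {p. prime p \<and> W < p \<and> p dvd m} \<le> card (prime_factors m)" by (intro card_mono) auto
  then have \<omega>: "1 \<le> card (prime_factors m)" using k by linarith
  have "(2::nat) ^ card (prime_factors m) \<le> 2 * (2 ^ card (prime_factors m) - 1)"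
  proof -
    have "(2::nat) ^ 1 \<le> 2 ^ card (prime_factors m)" using \<omega> by (intro power_increasing) auto
    then show ?thesis by simp
  qed
  also have "\<dots> \<le> 2 * card ?X" using quadratic_characters_card_ge[OF m r] by simp
  finally have X: "2 ^ card (prime_factors m) \<le> 2 * card ?X" .
  have "card {\<psi> \<in> ?X. \<not> ?P \<psi>} * 2 ^ k \<le> card ?D * ?K * 2 ^ k" using bad by simp
  also have "\<dots> = ?K * (card ?D * 2 ^ k)" by simp
  also have "\<dots> \<le> ?K * (2 * card ?X)"
    using small_divisors_card[OF m k(2)] X by (intro mult_left_mono) auto
  finally have "real (card {\<psi> \<in> ?X. \<not> ?P \<psi>} * 2 ^ k) \<le> real (?K * (2 * card ?X))" by (simp only: of_nat_le_iff)
  then have "real (card {\<psi> \<in> ?X. \<not> ?P \<psi>}) * 2 ^ k \<le> (2 * real ?K) * real (card ?X)" by (simp add: mult_ac)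
  also have "\<dots> \<le> (\<delta> * 2 ^ k) * real (card ?X)" using \<delta> by (intro mult_right_mono) auto
  finally have "real (card {\<psi> \<in> ?X. \<not> ?P \<psi>}) \<le> \<delta> * real (card ?X)"
    by (simp add: mult.commute mult.left_commute)
  moreover have "card ?X = card {\<psi> \<in> ?X. ?P \<psi>} + card {\<psi> \<in> ?X. \<not> ?P \<psi>}"
    using fin by (subst card_Un_disjoint[symmetric]) (auto intro!: arg_cong[of _ _ card])
  ultimately show ?thesis by (simp add: algebra_simps)
qed

section \<open>Counting the exceptional discriminants\<close>

lemma ln_le_of_le_exp: "0 < x \<Longrightarrow> x \<le> exp z \<Longrightarrow> ln x \<le> (z :: real)"
  using ln_mono[of x "exp z"] by simp

lemma two_power_le_real: "2 ^ j \<le> M \<Longrightarrow> (2 :: real) ^ j \<le> real M"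
  by (metis of_nat_le_iff of_nat_numeral of_nat_power)

text \<open>The second moment needs one cut for all \<open>d\<close> between \<open>2 ^ j\<close>
  and \<open>2 ^ (j + 1)\<close>. The exponent lies between 2/3, so that the tail saves
  \<open>7/10 - 2/3 = 1/30\<close>, and 3/4, so that the second moment saves
  \<open>1 - 7/10 * 4/3 = 1/15\<close>.\<close>

definition block_length :: "nat \<Rightarrow> nat" where
  "block_length j = nat \<lfloor>2 powr (7/10 * real j)\<rfloor>"

lemma block_length_bounds:
  "block_length j \<ge> 1" "real (block_length j) \<le> 2 powr (7/10 * real j)"
  "2 powr (7/10 * real j) \<le> real (block_length j) + 1"
proof -
  have "1 \<le> 2 powr (7/10 * real j)" by (intro ge_one_powr_ge_zero) auto
  then show "block_length j \<ge> 1" "real (block_length j) \<le> 2 powr (7/10 * real j)"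
    "2 powr (7/10 * real j) \<le> real (block_length j) + 1"
    unfolding block_length_def by linarith+
qed

lemma block_length_le: "block_length j \<le> 2 ^ j"
proof -
  have "real (block_length j) \<le> 2 powr (7/10 * real j)" by (rule block_length_bounds)
  also have "\<dots> \<le> 2 powr (real j)" by (intro powr_mono) auto
  also have "\<dots> = real (2 ^ j)" by (simp add: powr_realpow)
  finally show ?thesis by (simp only: of_nat_le_iff)
qed

text \<open>Here \<open>z\<close> stands for \<open>ln Z\<close>, and \<open>Y\<close> lies between
  \<open>z ^ 4\<close> and \<open>2 * z ^ 4\<close>. The second to fourth conditions make a modulus
  usable; the third one allows \<open>ln Y\<close> to be replaced by its upper bound under a
  nonpositive numerator. The last two serve the final threshold.\<close>

definition sufficiently_large :: "real \<Rightarrow> bool" where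
  "sufficiently_large z \<longleftrightarrow> z \<ge> 7 \<and> 8 * (1 + z) \<le> z ^ 4 \<and> ln 256 - z powr (1/8) / 30 \<le> 0 \<and>
     exp ((ln 256 - z powr (1/8) / 30) / ln (2 * z ^ 4)) * (129 + z) * (2 * z ^ 4) ^ 3 \<le> 1/8 \<and>
     1 \<le> ln z - ln 2 \<and> ln 4 + 6 + 2 * ln (ln (2 * z ^ 4)) \<le> sqrt (ln z - ln 2)"

lemma eventually_sufficiently_large: "\<forall>\<^sub>F z in at_top. sufficiently_large z"
  unfolding sufficiently_large_def by (intro eventually_conj; real_asymp)

lemma sufficiently_largeD:
  assumes "sufficiently_large z"
  shows "z \<ge> 2" "8 * (1 + z) \<le> z ^ 4" "ln 256 - z powr (1/8) / 30 \<le> 0"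
    "exp ((ln 256 - z powr (1/8) / 30) / ln (2 * z ^ 4)) * (129 + z) * (2 * z ^ 4) ^ 3 \<le> 1/8"
    "z \<ge> 7" "1 \<le> ln z - ln 2" "ln 4 + 6 + 2 * ln (ln (2 * z ^ 4)) \<le> sqrt (ln z - ln 2)"
  using assms by (auto simp: sufficiently_large_def)

text \<open>As \<open>d > W\<close>, the saving \<open>d powr (-1/30)\<close> is at most
  \<open>exp (- z powr (1/8) / 30)\<close>. Even its power \<open>1 / ln Y\<close> beats the factors
  \<open>129 + z\<close> and \<open>Y ^ 3\<close>, which are polynomial in \<open>z\<close>.\<close>

lemma usable_modulus_good_block:
  assumes d: "2 ^ j \<le> d" "d < 2 ^ (j + 1)" "d > W" "real d \<le> exp z"
    and good: "good_modulus Y (block_length j) d"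
    and Y: "z ^ 4 \<le> real Y" "real Y \<le> 2 * z ^ 4" and W: "exp (z powr (1/8)) \<le> real W"
    and z: "sufficiently_large z"
  shows "usable_modulus Y d"
proof -
  note z = sufficiently_largeD[OF z]
  let ?N = "block_length j"
  have d1: "real d \<ge> 1" using d(1) le_trans[of 1 "2 ^ j" d] by simp
  have lnd: "ln (real d) \<le> z" using d(4) d1 by (intro ln_le_of_le_exp) auto
  have z4: "z ^ 4 \<ge> 16" using power_mono[OF z(1), of 4] by simp
  have N: "real ?N \<le> exp z"
  proof -
    have "?N \<le> d" using block_length_le[of j] d(1) by linarith
    then have "real ?N \<le> real d" by (simp only: of_nat_le_iff)
    then show ?thesis using d(4) by linarith
  qed
  have "ln (real ?N) \<le> z" using N block_length_bounds(1)[of j] by (intro ln_le_of_le_exp) auto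
  then have "(1 + ln (real ?N)) / real Y \<le> (1 + z) / z ^ 4"
    using Y z4 z(1) by (intro frac_le) auto
  also have "\<dots> \<le> 1/8" 
  proof -
    have "z ^ 4 > 0" using z4 by linarith
    then show ?thesis using z(2) by (subst pos_divide_le_eq) auto
  qed
  finally have c1: "(1 + ln (real ?N)) / real Y \<le> 1/8" .
  let ?B = "128 * real d powr (2/3) / (real ?N + 1)"
  \<comment> \<open>Inside the block only \<open>d / 2 < 2 ^ j\<close> is known; the resulting
    factor \<open>2 powr (7/10) \<le> 2\<close> raises 128 to 256.\<close>
  have "(real d / 2) powr (7/10) \<le> (2 ^ j) powr (7/10)"
  proof (intro powr_mono2)
    have "real d \<le> real (2 ^ (j + 1))" using d(2) by (simp only: of_nat_le_iff less_imp_le)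
    then have "real d \<le> 2 * 2 ^ j" by simp
    then show "real d / 2 \<le> 2 ^ j" by simp
  qed auto
  also have "\<dots> = 2 powr (7/10 * real j)" by (simp add: powr_powr mult.commute flip: powr_realpow)
  also have "\<dots> \<le> real ?N + 1" by (rule block_length_bounds)
  finally have dN: "(real d / 2) powr (7/10) \<le> real ?N + 1" .
  have "?B \<le> 128 * real d powr (2/3) / (real d / 2) powr (7/10)"
    using dN d1 by (intro divide_left_mono mult_pos_pos) auto
  also have "\<dots> = 128 * 2 powr (7/10) * real d powr (2/3 - 7/10)"
    unfolding powr_diff using d1 by (simp add: powr_divide)
  also have "\<dots> \<le> 128 * 2 powr 1 * real W powr (-1/30)"
  proof (intro mult_mono powr_mono)
    have "0 < exp (z powr (1/8))" by simp
    then have "0 < real W" using W by linarith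
    then show "real d powr (2/3 - 7/10) \<le> real W powr (-1/30)" using d(3) by (simp add: powr_mono2')
  qed auto
  also have "\<dots> \<le> 256 * exp (z powr (1/8)) powr (-1/30)"
    using powr_mono2'[of "-1/30" "exp (z powr (1/8))" "real W"] W by simp
  also have "\<dots> = exp (ln 256) * exp (- (z powr (1/8) / 30))" by (simp add: powr_def)
  also have "\<dots> = exp (ln 256 - z powr (1/8) / 30)"
    by (simp only: exp_add[symmetric] diff_conv_add_uminus)
  finally have B: "?B \<le> exp (ln 256 - z powr (1/8) / 30)" .
  have lnY: "0 < ln (real Y)" "ln (real Y) \<le> ln (2 * z ^ 4)" using Y z4 by (simp, intro ln_mono) auto
  have "?B powr (1 / ln (real Y)) \<le> exp (ln 256 - z powr (1/8) / 30) powr (1 / ln (real Y))"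
    using B lnY d1 by (intro powr_mono2) auto
  also have "\<dots> = exp ((ln 256 - z powr (1/8) / 30) / ln (real Y))" by (simp add: powr_def)
  also have "\<dots> \<le> exp ((ln 256 - z powr (1/8) / 30) / ln (2 * z ^ 4))"
    using lnY z(3) by (simp add: divide_left_mono_neg)
  finally have "?B powr (1 / ln (real Y)) * (129 + ln (real d)) * real Y ^ 3
     \<le> exp ((ln 256 - z powr (1/8) / 30) / ln (2 * z ^ 4)) * (129 + z) * (2 * z ^ 4) ^ 3"
    using lnd Y z(1) d1 by (intro mult_mono power_mono) auto
  also note z(4)
  finally show ?thesis unfolding usable_modulus_def
    using good c1 block_length_bounds(1)[of j] by blast
qed

lemma bad_block_count:
  assumes "2 ^ j \<le> exp z" "0 < V" "V \<le> 2 ^ j" "Y \<ge> 1" "z \<ge> 0"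
  shows "real (card {d \<in> {1..<2 ^ (j + 1)}. odd d \<and> squarefree d \<and> \<not> good_modulus Y (block_length j) d})
    \<le> 2 ^ j * (8192 * (32 * V powr (-1/15) + 2 * (1 + z)\<^sup>2 / real Y))"
proof -
  let ?N = "block_length j"
  have "real (card {d \<in> {1..<2 ^ (j + 1)}. odd d \<and> squarefree d \<and> \<not> good_modulus Y ?N d})
    \<le> 8192 * (32 * real ?N powr (4/3) + real (2 ^ (j + 1)) * ((1 + ln (real ?N))\<^sup>2 / real Y))"
    by (rule bad_modulus_count) (use assms block_length_bounds in auto)
  also have "\<dots> \<le> 8192 * (32 * (2 ^ j * V powr (-1/15)) + real (2 ^ (j + 1)) * ((1 + z)\<^sup>2 / real Y))"
  proof (intro mult_left_mono add_mono divide_right_mono power_mono add_left_mono)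
    have p: "(2::real) ^ j = 2 powr real j" by (simp add: powr_realpow)
    have "real ?N powr (4/3) \<le> (2 powr (7/10 * real j)) powr (4/3)"
      using block_length_bounds[of j] by (intro powr_mono2) auto
    also have "\<dots> = 2 powr (real j + real j * (-1/15))" by (simp add: powr_powr algebra_simps)
    also have "\<dots> = 2 ^ j * (2 ^ j) powr (-1/15)" by (simp only: p powr_powr powr_add)
    also have "\<dots> \<le> 2 ^ j * V powr (-1/15)" using assms by (intro mult_left_mono powr_mono2') auto
    finally show "real ?N powr (4/3) \<le> 2 ^ j * V powr (-1/15)" .
    have "real ?N \<le> real (2 ^ j)" using block_length_le[of j] by (simp only: of_nat_le_iff)
    also have "\<dots> = 2 ^ j" by simp
    finally have "real ?N \<le> exp z" using assms(1) by linarith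
    then show "ln (real ?N) \<le> z" using block_length_bounds(1)[of j] by (intro ln_le_of_le_exp) auto
    show "0 \<le> 1 + ln (real ?N)" using block_length_bounds(1)[of j] by simp
  qed auto
  also have "\<dots> = 2 ^ j * (8192 * (32 * V powr (-1/15) + 2 * (1 + z)\<^sup>2 / real Y))"
    by (simp add: algebra_simps)
  finally show ?thesis .
qed

lemma card_UN_real_le:
  assumes "finite I" "\<And>i. i \<in> I \<Longrightarrow> real (card (A i)) \<le> c"
  shows "real (card (\<Union>i\<in>I. A i)) \<le> real (card I) * c"
proof -
  have "real (card (\<Union>i\<in>I. A i)) \<le> real (\<Sum>i\<in>I. card (A i))"
    using card_UN_le[OF assms(1)] by (simp only: of_nat_le_iff)
  also have "\<dots> \<le> (\<Sum>i\<in>I. c)" unfolding of_nat_sum by (rule sum_mono) (rule assms(2))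
  finally show ?thesis by simp
qed

text \<open>A block at \<open>2 ^ j\<close> holds at most \<open>2 ^ j * \<eta>\<close> bad
  \<open>d\<close>, each with at most \<open>M / 2 ^ j\<close> multiples, so the block costs
  \<open>M * \<eta>\<close> whatever \<open>j\<close> is. At most \<open>2 * z + 1\<close> blocks
  occur.\<close>

lemma unusable_divisor_count:
  assumes M: "real M \<le> exp z"
    and Y: "z ^ 4 \<le> real Y" "real Y \<le> 2 * z ^ 4" and W: "exp (z powr (1/8)) \<le> real W"
    and z: "sufficiently_large z"
  shows "real (card {n \<in> {1..M}. \<exists>d. d dvd n \<and> odd d \<and> squarefree d \<and> W < d \<and> \<not> usable_modulus Y d})
    \<le> real M * ((2 * z + 1) * (8192 * (32 * (exp (z powr (1/8)) / 2) powr (-1/15) + 2 * (1 + z)\<^sup>2 / z ^ 4)))"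
proof -
  note z' = z and z = sufficiently_largeD[OF z]
  \<comment> \<open>A block containing some \<open>d > W\<close> starts above \<open>W / 2\<close>,
    which is at least \<open>V\<close>.\<close>
  define V where "V = exp (z powr (1/8)) / 2"
  define \<eta> where "\<eta> = 8192 * (32 * V powr (-1/15) + 2 * (1 + z)\<^sup>2 / z ^ 4)"
  let ?A = "{n \<in> {1..M}. \<exists>d. d dvd n \<and> odd d \<and> squarefree d \<and> W < d \<and> \<not> usable_modulus Y d}"
  let ?J = "{j. 2 ^ j \<le> M \<and> W < 2 ^ (j + 1)}"
  let ?D = "\<lambda>j. {d \<in> {1..<2 ^ (j + 1)}. odd d \<and> squarefree d \<and> \<not> good_modulus Y (block_length j) d}"
  let ?E = "\<lambda>j. {d \<in> ?D j. 2 ^ j \<le> d}"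
  have z4: "z ^ 4 \<ge> 16" using power_mono[OF z(1), of 4] by simp
  have V0: "V > 0" by (simp add: V_def)
  have \<eta>0: "\<eta> \<ge> 0" using z4 by (simp add: \<eta>_def)
  have J_sub: "?J \<subseteq> {..nat \<lfloor>2 * z\<rfloor>}"
  proof
    fix j assume "j \<in> ?J"
    then have "2 ^ j \<le> exp z" by (intro order.trans[OF two_power_le_real M]) simp
    then have "ln (2 ^ j) \<le> z" by (intro ln_le_of_le_exp) auto
    then have "real j * ln 2 \<le> z" by (simp add: ln_realpow)
    moreover have "real j * (1/2) \<le> real j * ln 2"
      by (intro mult_left_mono ln_two_ge_half) auto
    ultimately have "real j \<le> 2 * z" by linarith
    then show "j \<in> {..nat \<lfloor>2 * z\<rfloor>}" by (simp add: le_nat_floor)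
  qed
  then have finJ: "finite ?J" using finite_subset by blast
  have "card ?J \<le> nat \<lfloor>2 * z\<rfloor> + 1" using card_mono[OF _ J_sub] by simp
  then have "real (card ?J) \<le> real (nat \<lfloor>2 * z\<rfloor> + 1)" by (simp only: of_nat_le_iff)
  then have cardJ: "real (card ?J) \<le> 2 * z + 1" using z(1) by simp linarith
  have "?A \<subseteq> (\<Union>j\<in>?J. \<Union>d\<in>?E j. {n \<in> {1..M}. d dvd n})"
  proof
    fix n assume n: "n \<in> ?A"
    then obtain d where d: "d dvd n" "odd d" "squarefree d" "W < d" "\<not> usable_modulus Y d" by blast
    have dM: "1 \<le> d" "d \<le> M" using dvd_imp_le[OF d(1)] n d(4) by auto
    obtain j where j: "2 ^ j \<le> d" "d < 2 ^ (j + 1)" using ex_power_ivl1[of 2 d] dM(1) by auto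
    have "\<not> good_modulus Y (block_length j) d"
    proof
      assume g: "good_modulus Y (block_length j) d"
      have "real d \<le> exp z" using dM(2) M by linarith
      from usable_modulus_good_block[OF j d(4) this g Y W z'] show False using d(5) by blast
    qed
    then have "d \<in> ?E j" using d j dM by auto
    moreover have "j \<in> ?J" using j dM(2) d(4) by auto
    ultimately show "n \<in> (\<Union>j\<in>?J. \<Union>d\<in>?E j. {n \<in> {1..M}. d dvd n})" using n d(1) by blast
  qed
  moreover have "finite (\<Union>j\<in>?J. \<Union>d\<in>?E j. {n \<in> {1..M}. d dvd n})" using finJ by auto
  ultimately have "real (card ?A) \<le> real (card (\<Union>j\<in>?J. \<Union>d\<in>?E j. {n \<in> {1..M}. d dvd n}))"
    by (simp only: of_nat_le_iff card_mono)
  also have "\<dots> \<le> real (card ?J) * (real M * \<eta>)"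
  proof (rule card_UN_real_le[OF finJ])
    fix j assume j: "j \<in> ?J"
    have "real (card (\<Union>d\<in>?E j. {n \<in> {1..M}. d dvd n})) \<le> real (card (?E j)) * (real M / 2 ^ j)"
    proof (rule card_UN_real_le)
      fix d assume d: "d \<in> ?E j"
      then have "2 ^ j \<le> d" by simp
      then have "(2::real) ^ j \<le> real d" by (rule two_power_le_real)
      moreover have "0 < real d" using d by simp
      moreover have "real (card {n \<in> {1..M}. d dvd n}) \<le> real M / real d"
        using card_multiples_nat[of d M] d of_nat_div_le_of_nat[of M d] by simp
      ultimately show "real (card {n \<in> {1..M}. d dvd n}) \<le> real M / 2 ^ j"
        by (smt (verit) divide_left_mono mult_pos_pos of_nat_0_le_iff zero_less_power)
    qed auto
    also have "\<dots> \<le> (2 ^ j * \<eta>) * (real M / 2 ^ j)"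
    proof (intro mult_right_mono)
      have "card (?E j) \<le> card (?D j)" by (intro card_mono) auto
      then have "real (card (?E j)) \<le> real (card (?D j))" by (simp only: of_nat_le_iff)
      also have "\<dots> \<le> 2 ^ j * (8192 * (32 * V powr (-1/15) + 2 * (1 + z)\<^sup>2 / real Y))"
      proof (rule bad_block_count[OF _ V0])
        show "2 ^ j \<le> exp z" by (rule order.trans[OF two_power_le_real M]) (use j in simp)
        have "W \<le> 2 ^ (j + 1)" using j by simp
        then have "real W \<le> real (2 ^ (j + 1))" by (simp only: of_nat_le_iff)
        then have "real W \<le> 2 * 2 ^ j" by simp
        then show "V \<le> 2 ^ j" using W unfolding V_def by linarith
      qed (use Y z4 z(1) in auto)
      also have "\<dots> \<le> 2 ^ j * \<eta>"
      proof -
        have "0 < z ^ 4" "0 < real Y" using Y z4 by linarith+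
        then show ?thesis unfolding \<eta>_def
          using Y(1) by (intro mult_left_mono add_left_mono divide_left_mono) auto
      qed
      finally show "real (card (?E j)) \<le> 2 ^ j * \<eta>" .
    qed auto
    also have "\<dots> = real M * \<eta>" by simp
    finally show "real (card (\<Union>d\<in>?E j. {n \<in> {1..M}. d dvd n})) \<le> real M * \<eta>" .
  qed
  also have "\<dots> \<le> (2 * z + 1) * (real M * \<eta>)" using cardJ \<eta>0 by (intro mult_right_mono) auto
  finally show ?thesis by (simp add: \<eta>_def V_def mult_ac)
qed

text \<open>\<open>\<mu>\<close> is what the two weak Mertens bounds leave for the primes between
  \<open>W\<close> and \<open>M\<close>. It tends to infinity because \<open>ln W\<close> is about
  \<open>z powr (1/8)\<close>, whose contribution \<open>2/8 * ln z\<close> stays below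
  \<open>ln z / 2\<close>.\<close>

lemma few_prime_factors_count:
  assumes M: "exp (z - 1) \<le> real M" and W: "W \<ge> 2" "real W \<le> 2 * exp (z powr (1/8))" and z: "z \<ge> 2"
    and \<mu>: "\<mu> = ln (z - 1) / 2 - 6 - 2 * ln (ln 2 + z powr (1/8))" "\<mu> > 0" "2 * real k \<le> \<mu>"
  shows "real (card {n \<in> {1..M}. card {p \<in> {p. prime p \<and> W < p \<and> p \<le> M}. p dvd n} < k}) \<le> 12 * real M / \<mu>"
proof -
  let ?T = "{p. prime p \<and> W < p \<and> p \<le> M}"
  have "exp 1 \<le> exp (z - 1)" using z by simp
  moreover have "(2::real) \<le> exp 1" using exp_ge_add_one_self[of 1] by simp
  ultimately have M2: "real M \<ge> 2" using M by linarith
  have lnM: "z - 1 \<le> ln (real M)" using M M2 by (subst ln_ge_iff) auto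
  have lnW: "0 < ln (real W)" "ln (real W) \<le> ln 2 + z powr (1/8)"
    using W ln_mono[of "real W" "2 * exp (z powr (1/8))"] by (auto simp: ln_mult)
  have T: "finite ?T" by (rule finite_subset[of _ "{..M}"]) auto
  have "primes_upto M \<subseteq> primes_upto W \<union> ?T" by (auto simp: primes_upto_def)
  then have "(\<Sum>p\<in>primes_upto M. 1 / real p) \<le> (\<Sum>p\<in>primes_upto W \<union> ?T. 1 / real p)"
    using T by (intro sum_mono2) auto
  also have "\<dots> = (\<Sum>p\<in>primes_upto W. 1 / real p) + (\<Sum>p\<in>?T. 1 / real p)"
    using T by (intro sum.union_disjoint) (auto simp: primes_upto_def)
  finally have "ln (ln (real M)) / 2 - (6 + 2 * ln (ln (real W))) \<le> (\<Sum>p\<in>?T. 1 / real p)"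
    using sum_inverse_primes_ge[of M] sum_inverse_primes_le[of W] M2 W(1) by simp
  moreover have "ln (z - 1) \<le> ln (ln (real M))" using lnM z by (intro ln_mono) auto
  moreover have "ln (ln (real W)) \<le> ln (ln 2 + z powr (1/8))" using lnW by (intro ln_mono) auto
  ultimately have sum: "\<mu> \<le> (\<Sum>p\<in>?T. 1 / real p)" unfolding \<mu>(1) by linarith
  have "card ?T \<le> card {1..M}" by (intro card_mono) (auto simp: prime_gt_0_nat Suc_le_eq)
  then have "real (card {n \<in> {1..M}. card {p \<in> ?T. p dvd n} < k}) \<le> 12 * real M / (\<Sum>p\<in>?T. 1 / real p)"
    using sum \<mu> T by (intro turan_few_prime_factors) auto
  also have "\<dots> \<le> 12 * real M / \<mu>" using sum \<mu> by (intro divide_left_mono mult_pos_pos) auto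
  finally show ?thesis .
qed

section \<open>From exceptional moduli to exceptional discriminants\<close>

lemma card_abs_preimage_le:
  assumes "finite A"
  shows "finite {D::int. nat \<bar>D\<bar> \<in> A}" "card {D::int. nat \<bar>D\<bar> \<in> A} \<le> 2 * card A"
proof -
  have sub: "{D::int. nat \<bar>D\<bar> \<in> A} \<subseteq> int ` A \<union> (\<lambda>n. - int n) ` A"
  proof
    fix D :: int assume "D \<in> {D. nat \<bar>D\<bar> \<in> A}"
    moreover have "D = int (nat \<bar>D\<bar>) \<or> D = - int (nat \<bar>D\<bar>)" by linarith
    ultimately show "D \<in> int ` A \<union> (\<lambda>n. - int n) ` A" by blast
  qed
  then show "finite {D::int. nat \<bar>D\<bar> \<in> A}" using assms finite_subset by blast
  have "card {D::int. nat \<bar>D\<bar> \<in> A} \<le> card (int ` A \<union> (\<lambda>n. - int n) ` A)"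
    using assms by (intro card_mono sub) auto
  also have "\<dots> \<le> card (int ` A) + card ((\<lambda>n. - int n) ` A)" by (rule card_Un_le)
  also have "\<dots> \<le> card A + card A" by (intro add_mono card_image_le assms)
  finally show "card {D::int. nat \<bar>D\<bar> \<in> A} \<le> 2 * card A" by simp
qed

lemma card_abs_le:
  assumes "s \<ge> 0"
  shows "real (card {D::int. real_of_int \<bar>D\<bar> \<le> s}) \<le> 2 * s + 1"
proof -
  have "{D::int. real_of_int \<bar>D\<bar> \<le> s} = {-\<lfloor>s\<rfloor>..\<lfloor>s\<rfloor>}" by (auto simp: le_floor_iff abs_le_iff minus_le_iff)
  moreover have "0 \<le> \<lfloor>s\<rfloor>" using assms by simp
  ultimately have "real (card {D::int. real_of_int \<bar>D\<bar> \<le> s}) = 2 * of_int \<lfloor>s\<rfloor> + 1" by simp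
  then show ?thesis by linarith
qed

text \<open>A number up to \<open>exp z\<close> has at most \<open>2 * z\<close> prime factors, and
  each of those counted contributes less than \<open>1 / Y \<le> 1 / (4 * z)\<close>.\<close>

lemma sum_large_prime_divisors_le:
  assumes "m > 0" "real m \<le> exp z" "4 * z \<le> real Y" "Y \<ge> 1"
  shows "(\<Sum>p | prime p \<and> p dvd m \<and> Y < p. 1 / real p) \<le> 1/2"
proof -
  let ?Q = "{p. prime p \<and> p dvd m \<and> Y < p}"
  have fin: "finite ?Q" by (rule finite_subset[OF _ finite_divisors_nat[OF assms(1)]]) auto
  have "(2::nat) ^ card ?Q \<le> \<Prod>?Q"
    using prod_mono[of ?Q "\<lambda>_. 2" "\<lambda>p. p"] by (auto dest: prime_ge_2_nat)
  also have "\<dots> \<le> m" using assms(1) fin by (intro dvd_imp_le prod_primes_dvd) auto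
  finally have "(2::real) ^ card ?Q \<le> exp z" using assms(2) two_power_le_real order.trans by blast
  then have "ln (2 ^ card ?Q) \<le> z" by (intro ln_le_of_le_exp) auto
  then have "real (card ?Q) * ln 2 \<le> z" by (simp add: ln_realpow)
  moreover have "real (card ?Q) * (1/2) \<le> real (card ?Q) * ln 2"
    by (intro mult_left_mono ln_two_ge_half) auto
  ultimately have c: "2 * real (card ?Q) \<le> real Y" using assms(3) by linarith
  have "(\<Sum>p\<in>?Q. 1 / real p) \<le> (\<Sum>p\<in>?Q. 1 / real Y)"
    using assms(4) by (intro sum_mono divide_left_mono) auto
  also have "\<dots> = real (card ?Q) / real Y" by simp
  also have "\<dots> \<le> 1/2" using c assms(4) by (simp add: divide_le_eq)
  finally show ?thesis .
qed

text \<open>The Euler factors cost at most a constant times the square of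
  \<open>ln (2 * z ^ 4)\<close>. With \<open>a \<ge> 1/2\<close> the exponent
  \<open>x powr a\<close> is at least \<open>sqrt (ln z - ln 2)\<close>, which dominates the
  logarithm of that cost.\<close>

lemma threshold_le:
  assumes Y: "2 \<le> Y" "real Y \<le> 2 * z ^ 4" and z: "z > 0"
    and x: "ln z - ln 2 \<le> x" "1 \<le> ln z - ln 2" and a: "1/2 \<le> a"
    and main: "ln 4 + 6 + 2 * ln (ln (2 * z ^ 4)) \<le> sqrt (ln z - ln 2)"
  shows "exp (- (x powr a)) \<le> 1/4 / (\<Prod>p\<in>primes_upto Y. 1 + 1 / real p)"
proof -
  have "(\<Prod>p\<in>primes_upto Y. 1 + 1 / real p) \<le> (\<Prod>p\<in>primes_upto Y. exp (1 / real p))"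
    by (intro prod_mono) (auto simp: add_nonneg_nonneg)
  also have "\<dots> = exp (\<Sum>p\<in>primes_upto Y. 1 / real p)" by (simp add: exp_sum)
  also have "\<dots> \<le> exp (6 + 2 * ln (ln (2 * z ^ 4)))"
  proof -
    have "0 < ln (real Y)" using Y by simp
    then have "ln (ln (real Y)) \<le> ln (ln (2 * z ^ 4))" using Y by (intro ln_mono) auto
    then show ?thesis using sum_inverse_primes_le[OF Y(1)] by simp
  qed
  finally have P: "(\<Prod>p\<in>primes_upto Y. 1 + 1 / real p) \<le> exp (6 + 2 * ln (ln (2 * z ^ 4)))" .
  have P0: "0 < (\<Prod>p\<in>primes_upto Y. 1 + 1 / real p)" by (intro prod_pos) (simp add: add_pos_nonneg)
  have "sqrt (ln z - ln 2) = (ln z - ln 2) powr (1/2)" using x by (simp add: powr_half_sqrt)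
  also have "\<dots> \<le> x powr (1/2)" using x by (intro powr_mono2) auto
  also have "\<dots> \<le> x powr a" using x a by (intro powr_mono) auto
  finally have "exp (- (x powr a)) \<le> exp (- (ln 4 + 6 + 2 * ln (ln (2 * z ^ 4))))" using main by simp
  also have "\<dots> = 1/4 / exp (6 + 2 * ln (ln (2 * z ^ 4)))"
    by (simp add: exp_minus exp_add exp_diff field_simps)
  also have "\<dots> \<le> 1/4 / (\<Prod>p\<in>primes_upto Y. 1 + 1 / real p)"
    using P P0 by (intro divide_left_mono) auto
  finally show ?thesis .
qed

text \<open>The bounds for small \<open>\<bar>D\<bar>\<close> (\<open>2 * sqrt Z + 1\<close>
  integers), for bad divisors and for few prime factors, divided by the lower bound
  \<open>Z / 16\<close> for the number of discriminants. In the last two the sign of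
  \<open>D\<close> gives a factor 2.\<close>

definition exceptional_density :: "real \<Rightarrow> real" where
  "exceptional_density z = 16 * (2 * exp (- z / 2) + exp (- z) +
     2 * ((2 * z + 1) * (8192 * (32 * (exp (z powr (1/8)) / 2) powr (-1/15) + 2 * (1 + z)\<^sup>2 / z ^ 4))) +
     24 / (ln (z - 1) / 2 - 6 - 2 * ln (ln 2 + z powr (1/8))))"

lemma exceptional_density_tendsto: "(exceptional_density \<longlongrightarrow> 0) at_top"
  unfolding exceptional_density_def by real_asymp

lemma most_discriminants:
  fixes P :: "int \<Rightarrow> bool"
  assumes z: "z = ln Z" and large: "sufficiently_large z"
    and k: "k \<ge> 1" "2 * real k \<le> ln (z - 1) / 2 - 6 - 2 * ln (ln 2 + z powr (1/8))"
    and \<delta>: "2 * real (card {\<xi>. char8 \<xi>}) \<le> \<delta> * 2 ^ k" and Z: "Z > 0"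
    and a: "1/2 \<le> a"
    and P: "\<And>D. P D \<longleftrightarrow> real (card {\<psi> \<in> quadratic_characters (nat \<bar>D\<bar>).
              Re (dirichlet_L 1 \<psi>) \<ge> exp (- 1 * ln (ln (real_of_int \<bar>D\<bar>)) powr a)})
          \<ge> (1 - \<delta>) * real (card (quadratic_characters (nat \<bar>D\<bar>)))"
  shows "\<bar>real (card {D. fundamental_discriminant D \<and> real_of_int \<bar>D\<bar> \<le> Z \<and> P D})
     / real (card {D. fundamental_discriminant D \<and> real_of_int \<bar>D\<bar> \<le> Z}) - 1\<bar> \<le> exceptional_density z"
proof -
  define M where "M = nat \<lfloor>Z\<rfloor>"
  define Y where "Y = nat \<lceil>z ^ 4\<rceil>"
  define W where "W = nat \<lceil>exp (z powr (1/8))\<rceil>"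
  define \<mu> where "\<mu> = ln (z - 1) / 2 - 6 - 2 * ln (ln 2 + z powr (1/8))"
  define \<eta> where "\<eta> = (2 * z + 1) * (8192 * (32 * (exp (z powr (1/8)) / 2) powr (-1/15) + 2 * (1 + z)\<^sup>2 / z ^ 4))"
  have Zz: "Z = exp z" using z Z by simp
  note z = sufficiently_largeD[OF large]
  have "6 ^ 4 \<le> z ^ 4" using z(5) by (intro power_mono) auto
  then have z4: "z ^ 4 \<ge> 1296" by simp
  have Yb: "z ^ 4 \<le> real Y" "real Y \<le> z ^ 4 + 1" using z4 unfolding Y_def by linarith+
  then have Y: "z ^ 4 \<le> real Y" "real Y \<le> 2 * z ^ 4" "Y \<ge> 3" using z4 by linarith+
  have "z powr (1/8) \<ge> 1" using z(5) by (intro ge_one_powr_ge_zero) auto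
  then have e1: "exp (z powr (1/8)) \<ge> 2" using exp_ge_add_one_self[of "z powr (1/8)"] by linarith
  have "0 \<le> \<lceil>exp (z powr (1/8))\<rceil>" using e1 by linarith
  then have "real W = of_int \<lceil>exp (z powr (1/8))\<rceil>" by (simp add: W_def)
  then have "exp (z powr (1/8)) \<le> real W" "real W \<le> exp (z powr (1/8)) + 1" by linarith+
  then have W: "exp (z powr (1/8)) \<le> real W" "real W \<le> 2 * exp (z powr (1/8))" "W \<ge> 2" using e1 by linarith+
  have Z257: "Z \<ge> 257"
  proof -
    have "exp 1 \<ge> (5/2 :: real)" using exp_lower_Taylor_quadratic[of 1] by simp
    then have "(5/2 :: real) ^ 7 \<le> exp 1 ^ 7" by (intro power_mono) auto
    also have "\<dots> = exp (7 * 1 :: real)" by (subst exp_of_nat_mult[symmetric]) simp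
    also have "\<dots> \<le> exp z" using z(5) by simp
    finally show ?thesis unfolding Zz by (simp add: power_divide)
  qed
  have M: "real M \<le> Z" "Z \<le> real M + 1" using Z257 unfolding M_def by linarith+
  have Mz: "real M \<le> exp z" "exp (z - 1) \<le> real M"
  proof -
    have "exp (z - 1) = Z / exp 1" by (simp add: exp_diff Zz)
    also have "\<dots> \<le> Z / 2" using Z exp_ge_add_one_self[of 1] by (intro divide_left_mono) auto
    also have "\<dots> \<le> real M" using M Z257 by linarith
    finally show "exp (z - 1) \<le> real M" .
  qed (use M Zz in simp)
  have \<mu>0: "\<mu> > 0" using k unfolding \<mu>_def by linarith
  let ?F = "{D. fundamental_discriminant D \<and> real_of_int \<bar>D\<bar> \<le> Z}"
  let ?G = "{D. fundamental_discriminant D \<and> real_of_int \<bar>D\<bar> \<le> Z \<and> P D}"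
  let ?T = "{p. prime p \<and> W < p \<and> p \<le> M}"
  let ?A2 = "{n \<in> {1..M}. \<exists>d. d dvd n \<and> odd d \<and> squarefree d \<and> W < d \<and> \<not> usable_modulus Y d}"
  let ?A3 = "{n \<in> {1..M}. card {p \<in> ?T. p dvd n} < k}"
  \<comment> \<open>Beyond \<open>sqrt Z\<close> the logarithm of \<open>\<bar>D\<bar>\<close> is at
    least \<open>z / 2\<close>, so a threshold in \<open>D\<close> can be compared with one in
    \<open>z\<close>.\<close>
  let ?E1 = "{D::int. real_of_int \<bar>D\<bar> \<le> sqrt Z}"
  let ?E2 = "{D::int. nat \<bar>D\<bar> \<in> ?A2}" and ?E3 = "{D::int. nat \<bar>D\<bar> \<in> ?A3}"
  have finF: "finite ?F" by (rule finite_subset[OF _ finite_abs_le[of Z]]) auto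
  have "?F - ?G \<subseteq> ?E1 \<union> (?E2 \<union> ?E3)"
  proof
    fix D assume D: "D \<in> ?F - ?G"
    then have fd: "fundamental_discriminant D" and DZ: "real_of_int \<bar>D\<bar> \<le> Z" and nP: "\<not> P D" by auto
    show "D \<in> ?E1 \<union> (?E2 \<union> ?E3)"
    proof (rule ccontr)
      assume nE: "D \<notin> ?E1 \<union> (?E2 \<union> ?E3)"
      obtain r m where rm: "nat \<bar>D\<bar> = r * m" "r \<in> {1, 4, 8}" "odd m" "squarefree m"
        by (rule fundamental_discriminant_modulus[OF fd])
      let ?n = "nat \<bar>D\<bar>"
      have big: "sqrt Z < real_of_int \<bar>D\<bar>" using nE by simp
      have m0: "m > 0" using rm(3) by (simp add: odd_pos)
      have n1: "?n \<ge> 1" using rm m0 by auto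
      have "?n \<le> M" unfolding M_def using DZ by (simp add: le_floor_iff nat_mono)
      then have nM: "?n \<in> {1..M}" using n1 by simp
      have us: "usable_modulus Y d" if "d dvd m" "d > W" for d
      proof (rule ccontr)
        assume "\<not> usable_modulus Y d"
        moreover have "odd d" "squarefree d" using that(1) rm squarefree_mono dvd_trans by blast+
        moreover have "d dvd ?n" using that(1) rm(1) by simp
        ultimately have "D \<in> ?E2" using nM that(2) by blast
        then show False using nE by blast
      qed
      have "k \<le> card {p \<in> ?T. p dvd ?n}"
      proof (rule ccontr)
        assume "\<not> k \<le> card {p \<in> ?T. p dvd ?n}"
        then have "D \<in> ?E3" using nM by simp
        then show False using nE by blast
      qed
      also have "\<dots> \<le> card {p. prime p \<and> W < p \<and> p dvd m}"
      proof (rule card_mono)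
        show "finite {p. prime p \<and> W < p \<and> p dvd m}"
          by (rule finite_subset[OF _ finite_divisors_nat[OF m0]]) auto
        show "{p \<in> ?T. p dvd ?n} \<subseteq> {p. prime p \<and> W < p \<and> p dvd m}"
        proof
          fix p assume "p \<in> {p \<in> ?T. p dvd ?n}"
          then have p: "prime p" "W < p" "p dvd r * m" using rm(1) by auto
          \<comment> \<open>Primes above \<open>W \<ge> 2\<close> cannot divide the 2-part
            \<open>r\<close>, so they divide \<open>m\<close>.\<close>
          have "p \<noteq> 2" using p(2) W(3) by simp
          then have "\<not> p dvd 2 ^ j" for j using p(1) prime_dvd_power primes_dvd_imp_eq two_is_prime_nat by blast
          from this[of 0] this[of 2] this[of 3] have "\<not> p dvd r" using rm(2) by auto
          then show "p \<in> {p. prime p \<and> W < p \<and> p dvd m}" using p prime_dvd_mult_iff by blast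
        qed
      qed
      finally have kk: "k \<le> card {p. prime p \<and> W < p \<and> p dvd m}" .
      have "m \<le> ?n" unfolding rm(1) using rm(2) by auto
      also have "\<dots> \<le> M" using nM by simp
      finally have "real m \<le> real M" by (simp only: of_nat_le_iff)
      then have mz: "real m \<le> exp z" using Mz by linarith
      have "4 * z \<le> 8 * (1 + z)" using z(5) by simp
      then have "4 * z \<le> real Y" using order.trans[OF z(2) Y(1)] by (rule order.trans)
      then have Q: "(\<Sum>p | prime p \<and> p dvd m \<and> Y < p. 1 / real p) \<le> 1/2"
        using Y(3) by (intro sum_large_prime_divisors_le[OF m0 mz]) auto
      have "exp (- (ln (ln (real_of_int \<bar>D\<bar>)) powr a)) \<le> 1/4 / (\<Prod>p\<in>primes_upto Y. 1 + 1 / real p)"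
      proof (rule threshold_le[OF _ Y(2) _ _ z(6) a z(7)])
        have sq: "sqrt Z = exp (z / 2)" unfolding Zz by (simp add: real_sqrt_unique power2_eq_square flip: exp_add)
        then have "exp (z / 2) < real_of_int \<bar>D\<bar>" using big by simp
        then have "z / 2 \<le> ln (real_of_int \<bar>D\<bar>)"
          by (subst ln_ge_iff) (auto intro: less_trans[OF exp_gt_zero])
        then have "ln (z / 2) \<le> ln (ln (real_of_int \<bar>D\<bar>))" using z(5) by (intro ln_mono) auto
        then show "ln z - ln 2 \<le> ln (ln (real_of_int \<bar>D\<bar>))" using z(5) by (simp add: ln_div)
      qed (use Y(3) z(5) in auto)
      then have "P D" unfolding P rm(1)
        using many_large_L_values[OF rm(3,4,2) Y(3) _ us k(1) kk Q \<delta>, of "exp (- 1 * ln (ln (real_of_int \<bar>D\<bar>)) powr a)"] W(3)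
        by simp
      then show False using nP by simp
    qed
  qed
  moreover have fE: "finite (?E1 \<union> (?E2 \<union> ?E3))"
    using finite_abs_le[of "sqrt Z"] card_abs_preimage_le(1)[of ?A2] card_abs_preimage_le(1)[of ?A3] by simp
  ultimately have "card (?F - ?G) \<le> card (?E1 \<union> (?E2 \<union> ?E3))" by (intro card_mono)
  also have "\<dots> \<le> card ?E1 + (card ?E2 + card ?E3)"
    by (rule order.trans[OF card_Un_le add_left_mono[OF card_Un_le]])
  also have "\<dots> \<le> card ?E1 + (2 * card ?A2 + 2 * card ?A3)"
    using card_abs_preimage_le(2)[of ?A2] card_abs_preimage_le(2)[of ?A3] by simp
  finally have "real (card (?F - ?G)) \<le> real (card ?E1 + (2 * card ?A2 + 2 * card ?A3))" by (simp only: of_nat_le_iff)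
  also have "\<dots> = real (card ?E1) + 2 * real (card ?A2) + 2 * real (card ?A3)" by simp
  also have "\<dots> \<le> (2 * sqrt Z + 1) + 2 * (real M * \<eta>) + 2 * (12 * real M / \<mu>)"
  proof (intro add_mono mult_left_mono)
    show "real (card ?E1) \<le> 2 * sqrt Z + 1" using Z by (intro card_abs_le) auto
    show "real (card ?A2) \<le> real M * \<eta>" unfolding \<eta>_def
      by (rule unusable_divisor_count[OF Mz(1) Y(1,2) W(1) large])
    show "real (card ?A3) \<le> 12 * real M / \<mu>"
      by (rule few_prime_factors_count[OF Mz(2) W(3,2) _ \<mu>_def \<mu>0]) (use z(5) k(2) \<mu>_def in auto)
  qed auto
  also have "\<dots> \<le> (2 * sqrt Z + 1) + 2 * (Z * \<eta>) + 2 * (12 * Z / \<mu>)"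
  proof (intro add_mono mult_left_mono mult_right_mono divide_right_mono)
    show "0 \<le> \<eta>" unfolding \<eta>_def using z(5) z4 by (intro mult_nonneg_nonneg add_nonneg_nonneg) auto
  qed (use M \<mu>0 in auto)
  also have "\<dots> = Z / 16 * exceptional_density z"
  proof -
    have "sqrt Z = Z * exp (- z / 2)" unfolding Zz by (simp add: real_sqrt_unique power2_eq_square flip: exp_add)
    moreover have "1 = Z * exp (- z)" unfolding Zz by (simp flip: exp_add)
    ultimately show ?thesis unfolding exceptional_density_def \<eta>_def[symmetric] \<mu>_def[symmetric]
      by (simp add: algebra_simps)
  qed
  finally have FG: "real (card (?F - ?G)) \<le> Z / 16 * exceptional_density z" .
  have F16: "Z / 16 \<le> real (card ?F)" by (rule card_fundamental_discriminants_ge[OF Z257])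
  then have F0: "real (card ?F) > 0" using Z by linarith
  have "?G \<subseteq> ?F" by auto
  then have "card (?F - ?G) = card ?F - card ?G" "card ?G \<le> card ?F"
    using finF finite_subset by (auto intro!: card_Diff_subset card_mono)
  then have eq: "real (card ?F) - real (card ?G) = real (card (?F - ?G))" by simp
  have ed0: "0 \<le> exceptional_density z"
    using order.trans[OF of_nat_0_le_iff FG] Z by (simp add: zero_le_mult_iff)
  have "\<bar>real (card ?G) / real (card ?F) - 1\<bar> = real (card (?F - ?G)) / real (card ?F)"
  proof -
    have "real (card ?G) / real (card ?F) - 1 = - (real (card (?F - ?G)) / real (card ?F))"
      unfolding eq[symmetric] using F0 by (simp add: diff_divide_distrib)
    then show ?thesis by simp
  qed
  also have "\<dots> \<le> (Z / 16 * exceptional_density z) / real (card ?F)" using FG by (intro divide_right_mono) auto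
  also have "\<dots> \<le> (real (card ?F) * exceptional_density z) / real (card ?F)"
    using F16 ed0 by (intro divide_right_mono mult_right_mono) auto
  also have "\<dots> = exceptional_density z" using F0 by simp
  finally show ?thesis .
qed

theorem theorem1p4:
  fixes \<delta> :: real
  assumes "\<delta> > 0"
  shows "\<exists>c::real. \<forall>\<epsilon>::real. \<epsilon> > 0 \<longrightarrow>
    ((\<lambda>Z::real.
        real (card {D::int. fundamental_discriminant D \<and> real_of_int \<bar>D\<bar> \<le> Z \<and>
          real (card {\<psi> \<in> quadratic_characters (nat \<bar>D\<bar>).
              Re (dirichlet_L 1 \<psi>) \<ge>
                exp (- c * ln (ln (real_of_int \<bar>D\<bar>)) powr (1 - ln 2 / 2 + \<epsilon>))})
          \<ge> (1 - \<delta>) * real (card (quadratic_characters (nat \<bar>D\<bar>)))})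
        / real (card {D::int. fundamental_discriminant D \<and> real_of_int \<bar>D\<bar> \<le> Z}))
      \<longlongrightarrow> 1) at_top"
\<comment> \<open>The constant 1 serves every \<open>\<delta>\<close>, because
  \<open>\<delta>\<close> enters through the number \<open>k\<close> of prime factors above
  \<open>W\<close>.\<close>
proof (intro exI[of _ 1] allI impI)
  fix \<epsilon> :: real assume \<epsilon>: "\<epsilon> > 0"
  let ?a = "1 - ln 2 / 2 + \<epsilon>"
  have "ln 2 \<le> (1::real)" using ln_le_minus_one[of 2] by simp
  then have a: "1/2 \<le> ?a" using \<epsilon> by linarith
  define P where "P D \<longleftrightarrow> real (card {\<psi> \<in> quadratic_characters (nat \<bar>D\<bar>).
              Re (dirichlet_L 1 \<psi>) \<ge> exp (- 1 * ln (ln (real_of_int \<bar>D\<bar>)) powr ?a)})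
          \<ge> (1 - \<delta>) * real (card (quadratic_characters (nat \<bar>D\<bar>)))" for D :: int
  \<comment> \<open>\<open>k0\<close> makes the bad proportion at most \<open>\<delta>\<close>;
    passing to \<open>Suc k0\<close> ensures \<open>k \<ge> 1\<close>.\<close>
  obtain k0 where "2 * real (card {\<xi>. char8 \<xi>}) / \<delta> < 2 ^ k0"
    using real_arch_pow[of 2 "2 * real (card {\<xi>. char8 \<xi>}) / \<delta>"] by auto
  moreover have "(2::real) ^ k0 \<le> 2 ^ Suc k0" by simp
  ultimately have "2 * real (card {\<xi>. char8 \<xi>}) / \<delta> \<le> 2 ^ Suc k0" by linarith
  then have \<delta>: "2 * real (card {\<xi>. char8 \<xi>}) \<le> \<delta> * 2 ^ Suc k0" using assms by (simp add: divide_le_eq mult.commute)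
  have ev: "\<forall>\<^sub>F Z in at_top. Q (ln Z)" if "\<forall>\<^sub>F z in at_top. Q z" for Q :: "real \<Rightarrow> bool"
    using that ln_at_top by (rule eventually_compose_filterlim)
  note eventually_sufficiently_large
  moreover have "\<forall>\<^sub>F z::real in at_top. 2 * real (Suc k0) \<le> ln (z - 1) / 2 - 6 - 2 * ln (ln 2 + z powr (1/8))"
  proof -
    have "filterlim (\<lambda>z::real. ln (z - 1) / 2 - 6 - 2 * ln (ln 2 + z powr (1/8))) at_top at_top" by real_asymp
    then show ?thesis unfolding filterlim_at_top by blast
  qed
  ultimately have "\<forall>\<^sub>F z in at_top. sufficiently_large z \<and>
      2 * real (Suc k0) \<le> ln (z - 1) / 2 - 6 - 2 * ln (ln 2 + z powr (1/8))"
    by (rule eventually_conj)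
  from ev[OF this] eventually_gt_at_top[of 0]
  have "\<forall>\<^sub>F Z::real in at_top.
     norm (real (card {D. fundamental_discriminant D \<and> real_of_int \<bar>D\<bar> \<le> Z \<and> P D})
       / real (card {D. fundamental_discriminant D \<and> real_of_int \<bar>D\<bar> \<le> Z}) - 1) \<le> exceptional_density (ln Z)"
  proof eventually_elim
    case (elim Z)
    then show ?case unfolding real_norm_def
      by (intro most_discriminants[where k = "Suc k0" and \<delta> = \<delta> and a = ?a] refl \<delta> a P_def) auto
  qed
  moreover have "((\<lambda>Z. exceptional_density (ln Z)) \<longlongrightarrow> 0) at_top"
    by (rule filterlim_compose[OF exceptional_density_tendsto ln_at_top])
  ultimately have "((\<lambda>Z. real (card {D. fundamental_discriminant D \<and> real_of_int \<bar>D\<bar> \<le> Z \<and> P D})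
       / real (card {D. fundamental_discriminant D \<and> real_of_int \<bar>D\<bar> \<le> Z}) - 1) \<longlongrightarrow> 0) at_top"
    by (rule Lim_null_comparison)
  then show "((\<lambda>Z::real.
        real (card {D::int. fundamental_discriminant D \<and> real_of_int \<bar>D\<bar> \<le> Z \<and>
          real (card {\<psi> \<in> quadratic_characters (nat \<bar>D\<bar>).
              Re (dirichlet_L 1 \<psi>) \<ge>
                exp (- 1 * ln (ln (real_of_int \<bar>D\<bar>)) powr (1 - ln 2 / 2 + \<epsilon>))})
          \<ge> (1 - \<delta>) * real (card (quadratic_characters (nat \<bar>D\<bar>)))})
        / real (card {D::int. fundamental_discriminant D \<and> real_of_int \<bar>D\<bar> \<le> Z}))
      \<longlongrightarrow> 1) at_top"
    unfolding P_def by (subst (asm) LIM_zero_iff)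
qed

end
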